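(* Let $d,n\ge1$ be integers. Consider an $n$-copy estimation problem with single-copy prior $p$, parameters $\vec{\mathfrak{s}}=(\mathfrak{s}^{(1)},\dots,\mathfrak{s}^{(l)})$ and channel $\mathcal{E}$ (described in the context), and assume the figure of merit for a strategy (POVM) $M$ can be expressed as a functional of the conditional probabilities $q_M(B|\vec S\in\vec\Delta)$. Suppose that for a commutative von Neumann algebra $\mathcal{A}\subseteq\mathrm{End}(\mathbb{C}^d)$ with gauge group $G_{\mathcal{A}}$: 1. $p$ and $\vec{\mathfrak{s}}$ have $G_{\mathcal{A}}$ as a symmetry; 2. $\mathcal{E}$ is noiseless on $\mathcal{A}^{\otimes n}$; 3. $p$ is a $G_{\mathcal{A}}$-distortion of a prior that has support only on the pure states (for instance, $p$ itself has support only on the pure states). Then the optimal measurement can be implemented by measuring a set of observables which generates $\mathcal{A}$ separately on each of the $n$ qudits and then performing a classical processing on the outcomes; that is, if an optimal POVM exists, then there is an optimal POVM which is realized in this way.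
   Context: A von Neumann algebra $\mathcal{A}\subseteq\mathrm{End}(\mathbb{C}^d)$ is a complex subalgebra containing the identity and closed under adjoint; its gauge group $G_{\mathcal{A}}$ is the group of all unitaries in $\mathrm{U}(d)$ commuting with every element of $\mathcal{A}$. A quantum channel is a completely positive trace-preserving map. Scenario: $d\rho$ is a fixed reference (Borel) measure on the set of density operators in $\mathrm{End}(\mathbb{C}^d)$, invariant under $\rho\mapsto V\rho V^\dagger$ for all $V\in\mathrm{U}(d)$. A state $\rho$ is chosen randomly according to a probability density $p$ relative to $d\rho$ (the single-copy prior), and $\rho^{\otimes n}$ is sent through a quantum channel $\mathcal{E}$ on $\mathrm{End}((\mathbb{C}^d)^{\otimes n})$, then measured. $\mathrm{supp}(p)$ is the set of states to which $p$ assigns nonzero density. The parameters are (measurable) functions $\mathfrak{s}^{(i)}:\mathrm{supp}(p)\to\mathbb{R}$, $\vec{\mathfrak{s}}=(\mathfrak{s}^{(1)},\dots,\mathfrak{s}^{(l)})$, and $\vec S=\vec{\mathfrak{s}}(\rho)$ is the induced random vector. $p$ has a subgroup $H\subseteq\mathrm{U}(d)$ as a symmetry if $p(V\rho V^\dagger)=p(\rho)$ for all $V\in H$ and all $\rho$. $\vec{\mathfrak{s}}$ has $H$ as a symmetry if $\vec{\mathfrak{s}}(V\rho V^\dagger)=\vec{\mathfrak{s}}(\rho)$ for all $V\in H$ and all $\rho\in\mathrm{supp}(p)$. $\mathcal{E}$ is noiseless on $\mathcal{A}^{\otimes n}$ if $\mathrm{tr}(R\,\mathcal{E}(\rho))=\mathrm{tr}(R\rho)$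 for all $R\in\mathcal{A}^{\otimes n}$ and all states $\rho$ in $\mathrm{End}((\mathbb{C}^d)^{\otimes n})$ (and analogously for a channel on $\mathrm{End}(\mathbb{C}^d)$ and $\mathcal{A}$). Given a prior density $\tilde p$ (relative to $d\rho$) with support confined to pure states, $p$ is a $G_{\mathcal{A}}$-distortion of $\tilde p$ via $\mathcal{N}$ if $p$ can be realized by sampling a pure state from $\tilde p$ and applying a quantum channel $\mathcal{N}$ on $\mathrm{End}(\mathbb{C}^d)$ to it (i.e. the law with density $p$ is the pushforward under $\mathcal{N}$ of the law with density $\tilde p$), where $\mathcal{N}$ is noiseless on $\mathcal{A}$ and $G_{\mathcal{A}}$-covariant, i.e. $\mathcal{N}(V\cdot V^\dagger)=V\mathcal{N}(\cdot)V^\dagger$ for all $V\in G_{\mathcal{A}}$. A POVM with outcome space a measurable space $(\Omega,\sigma(\Omega))$ is a countably additive map $M$ from $\sigma(\Omega)$ to positive operators with $M(\Omega)=\mathbb{I}^{\otimes n}$. Set $q_M(B|\rho)=\mathrm{tr}(M(B)\mathcal{E}(\rho^{\otimes n}))$, $\Pr(\vec S\in\vec\Delta)=\int_{\vec{\mathfrak{s}}(\rho)\in\vec\Delta}d\rho\,p(\rho)$ and, for $l$-dimensional intervals $\vec\Delta$ of nonzero probability, $$q_M(B|\vec S\in\vec\Delta)=\frac{1}{\Pr(\vec S\in\vec\Delta)}\int_{\vec{\mathfrak{s}}(\rho)\in\vec\Delta}d\rho\,p(\rho)\,q_M(B|\rho).$$ A figure of merit assigns a real number to each POVM on the fixed outcome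 space $\Omega$; it is a functional of $q_M(B|\vec S\in\vec\Delta)$ if it takes equal values on any two POVMs for which these conditional probabilities all agree. A POVM is optimal if it maximizes (or minimizes, for a cost) the figure of merit over all POVMs $\sigma(\Omega)\to\mathrm{End}((\mathbb{C}^d)^{\otimes n})$. Measuring generators separately: given Hermitian operators $A_1,\dots,A_k\in\mathcal{A}$ that together with $\mathbb{I}$ generate $\mathcal{A}$, let $E_1,\dots,E_r$ be their nonzero joint spectral projectors. A POVM $M$ is realized by measuring these observables separately on each qudit followed by classical processing if there are probability measures $\nu(\cdot|i_1,\dots,i_n)$ on $(\Omega,\sigma(\Omega))$, for $(i_1,\dots,i_n)\in\{1,\dots,r\}^n$, such that $M(B)=\sum_{i_1,\dots,i_n}\nu(B|i_1,\dots,i_n)\,E_{i_1}\otimes\cdots\otimes E_{i_n}$ for all $B\in\sigma(\Omega)$. *)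

theory Defs
  imports "HOL-Probability.Probability"
begin

section \<open>Operators on finite-dimensional Hilbert spaces\<close>

text \<open>
  Operators on \<open>\<complex>\<^sup>d\<close> are matrices \<open>complex^'d^'d\<close> with \<open>d = CARD('d)\<close>. The space
  \<open>(\<complex>\<^sup>d)\<^sup>\<otimes>\<^sup>n\<close> has the product basis, indexed by the functions \<open>'n \<Rightarrow> 'd\<close> with
  \<open>n = CARD('n)\<close>, so its operators are matrices over the index type \<open>'n \<Rightarrow> 'd\<close>.
\<close>

type_synonym 'a cmat = "complex^'a^'a"

definition dagger :: "'a::finite cmat \<Rightarrow> 'a cmat" where
  "dagger A = (\<chi> i j. cnj (A $ j $ i))"

definition cscale :: "complex \<Rightarrow> 'a::finite cmat \<Rightarrow> 'a cmat" where
  "cscale c A = (\<chi> i j. c * A $ i $ j)"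

definition cinner :: "complex^'a::finite \<Rightarrow> complex^'a \<Rightarrow> complex" where
  "cinner v w = (\<Sum>i\<in>UNIV. cnj (v $ i) * w $ i)"

definition hermitian :: "'a::finite cmat \<Rightarrow> bool" where
  "hermitian A \<longleftrightarrow> dagger A = A"

definition unitary :: "'a::finite cmat \<Rightarrow> bool" where
  "unitary U \<longleftrightarrow> U ** dagger U = mat 1 \<and> dagger U ** U = mat 1"

definition conjugate_by :: "'a::finite cmat \<Rightarrow> 'a cmat \<Rightarrow> 'a cmat" where
  "conjugate_by V X = V ** X ** dagger V"

definition positive_op :: "'a::finite cmat \<Rightarrow> bool" where
  "positive_op A \<longleftrightarrow> (\<forall>v. cinner v (A *v v) \<in> \<real>\<^sub>\<ge>\<^sub>0)"

definition density_ops :: "'a::finite cmat set" where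
  "density_ops = {\<rho>. positive_op \<rho> \<and> trace \<rho> = 1}"

definition pure_states :: "'a::finite cmat set" where
  "pure_states = {\<rho>. \<exists>\<psi>::complex^'a. norm \<psi> = 1 \<and> \<rho> = (\<chi> i j. \<psi> $ i * cnj (\<psi> $ j))}"

definition tensor :: "('n::finite \<Rightarrow> 'd::finite cmat) \<Rightarrow> ('n \<Rightarrow> 'd) cmat" where
  "tensor A = (\<chi> f g. \<Prod>k\<in>UNIV. A k $ f k $ g k)"

definition tensor_power :: "'d::finite cmat \<Rightarrow> ('n::finite \<Rightarrow> 'd) cmat" where
  "tensor_power \<rho> = tensor (\<lambda>_. \<rho>)"


section \<open>Quantum channels\<close>

definition complex_linear :: "('a::finite cmat \<Rightarrow> 'a cmat) \<Rightarrow> bool" where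
  "complex_linear \<Phi> \<longleftrightarrow>
     (\<forall>X Y. \<Phi> (X + Y) = \<Phi> X + \<Phi> Y) \<and> (\<forall>c X. \<Phi> (cscale c X) = cscale c (\<Phi> X))"

text \<open>
  Positivity of the block operator \<open>(X i j)\<^bsub>i,j<k\<^esub>\<close> on \<open>\<complex>\<^sup>k \<otimes> \<complex>\<^sup>a\<close>, whose vectors are
  the families \<open>(v i)\<^bsub>i<k\<^esub>\<close>. The operator \<open>id\<^sub>k \<otimes> \<Phi>\<close> acts on it by applying
  \<open>\<Phi>\<close> to every block.
\<close>

definition positive_block_op :: "nat \<Rightarrow> (nat \<Rightarrow> nat \<Rightarrow> 'a::finite cmat) \<Rightarrow> bool" where
  "positive_block_op k X \<longleftrightarrow>
     (\<forall>v :: nat \<Rightarrow> complex^'a. (\<Sum>i<k. \<Sum>j<k. cinner (v i) (X i j *v v j)) \<in> \<real>\<^sub>\<ge>\<^sub>0)"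

definition completely_positive :: "('a::finite cmat \<Rightarrow> 'a cmat) \<Rightarrow> bool" where
  "completely_positive \<Phi> \<longleftrightarrow>
     (\<forall>k X. positive_block_op k X \<longrightarrow> positive_block_op k (\<lambda>i j. \<Phi> (X i j)))"

definition quantum_channel :: "('a::finite cmat \<Rightarrow> 'a cmat) \<Rightarrow> bool" where
  "quantum_channel \<Phi> \<longleftrightarrow>
     complex_linear \<Phi> \<and> completely_positive \<Phi> \<and> (\<forall>X. trace (\<Phi> X) = trace X)"

definition noiseless_on :: "('a::finite cmat \<Rightarrow> 'a cmat) \<Rightarrow> 'a cmat set \<Rightarrow> bool" where
  "noiseless_on \<Phi> \<A> \<longleftrightarrow>
     (\<forall>R\<in>\<A>. \<forall>\<rho>\<in>density_ops. trace (R ** \<Phi> \<rho>) = trace (R ** \<rho>))"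

definition covariant_under :: "('a::finite cmat \<Rightarrow> 'a cmat) \<Rightarrow> 'a cmat set \<Rightarrow> bool" where
  "covariant_under \<Phi> H \<longleftrightarrow>
     (\<forall>V\<in>H. \<forall>X. \<Phi> (conjugate_by V X) = conjugate_by V (\<Phi> X))"


section \<open>Von Neumann algebras\<close>

definition complex_subspace :: "'a::finite cmat set \<Rightarrow> bool" where
  "complex_subspace S \<longleftrightarrow>
     0 \<in> S \<and> (\<forall>A\<in>S. \<forall>B\<in>S. A + B \<in> S) \<and> (\<forall>c. \<forall>A\<in>S. cscale c A \<in> S)"

definition von_neumann_algebra :: "'a::finite cmat set \<Rightarrow> bool" where
  "von_neumann_algebra \<A> \<longleftrightarrow>
     complex_subspace \<A> \<and> mat 1 \<in> \<A> \<and>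
     (\<forall>A\<in>\<A>. \<forall>B\<in>\<A>. A ** B \<in> \<A>) \<and> (\<forall>A\<in>\<A>. dagger A \<in> \<A>)"

definition commutative_algebra :: "'a::finite cmat set \<Rightarrow> bool" where
  "commutative_algebra \<A> \<longleftrightarrow> (\<forall>A\<in>\<A>. \<forall>B\<in>\<A>. A ** B = B ** A)"

definition gauge_group :: "'a::finite cmat set \<Rightarrow> 'a cmat set" where
  "gauge_group \<A> = {V. unitary V \<and> (\<forall>A\<in>\<A>. V ** A = A ** V)}"

definition tensor_power_algebra :: "'d::finite cmat set \<Rightarrow> ('n::finite \<Rightarrow> 'd) cmat set" where
  "tensor_power_algebra \<A> = complex_subspace hull {tensor A | A. \<forall>k. A k \<in> \<A>}"

definition generating_observables :: "'a::finite cmat set \<Rightarrow> 'a cmat set \<Rightarrow> bool" where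
  "generating_observables \<A> As \<longleftrightarrow>
     finite As \<and> As \<subseteq> \<A> \<and> (\<forall>A\<in>As. hermitian A) \<and>
     von_neumann_algebra hull (insert (mat 1) As) = \<A>"

definition orthogonal_projector_onto :: "'a::finite cmat \<Rightarrow> (complex^'a) set \<Rightarrow> bool" where
  "orthogonal_projector_onto E W \<longleftrightarrow> hermitian E \<and> E ** E = E \<and> range (\<lambda>v. E *v v) = W"

text \<open>The function \<open>a\<close> assigns to each observable the eigenvalue that is measured.\<close>

definition joint_spectral_projectors :: "'a::finite cmat set \<Rightarrow> 'a cmat set" where
  "joint_spectral_projectors As =
     {E. E \<noteq> 0 \<and> (\<exists>a :: 'a cmat \<Rightarrow> real.
        orthogonal_projector_onto E {v. \<forall>A\<in>As. A *v v = complex_of_real (a A) *s v})}"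


section \<open>Priors, parameters and symmetries\<close>

text \<open>\<open>\<mu>\<close> is the reference measure \<open>d\<rho>\<close>, a Borel measure on the set of density operators.\<close>

definition reference_measure :: "'d::finite cmat measure \<Rightarrow> bool" where
  "reference_measure \<mu> \<longleftrightarrow>
     sets \<mu> = sets (restrict_space borel density_ops) \<and>
     (\<forall>V. unitary V \<longrightarrow> distr \<mu> \<mu> (conjugate_by V) = \<mu>)"

definition prior_density :: "'d::finite cmat measure \<Rightarrow> ('d cmat \<Rightarrow> real) \<Rightarrow> bool" where
  "prior_density \<mu> p \<longleftrightarrow>
     p \<in> borel_measurable \<mu> \<and> (\<forall>\<rho>\<in>density_ops. 0 \<le> p \<rho>) \<and>
     (\<integral>\<^sup>+ \<rho>. ennreal (p \<rho>) \<partial>\<mu>) = 1"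

definition law :: "'d::finite cmat measure \<Rightarrow> ('d cmat \<Rightarrow> real) \<Rightarrow> 'd cmat measure" where
  "law \<mu> p = density \<mu> (\<lambda>\<rho>. ennreal (p \<rho>))"

definition supp :: "('d::finite cmat \<Rightarrow> real) \<Rightarrow> 'd cmat set" where
  "supp p = {\<rho>\<in>density_ops. p \<rho> \<noteq> 0}"

definition parameters ::
  "'d::finite cmat measure \<Rightarrow> ('d cmat \<Rightarrow> real) \<Rightarrow> ('d cmat \<Rightarrow> real^'l::finite) \<Rightarrow> bool" where
  "parameters \<mu> p s \<longleftrightarrow> s \<in> borel_measurable (restrict_space \<mu> (supp p))"

definition prior_symmetry :: "'d::finite cmat set \<Rightarrow> ('d cmat \<Rightarrow> real) \<Rightarrow> bool" where
  "prior_symmetry H p \<longleftrightarrow> (\<forall>V\<in>H. \<forall>\<rho>\<in>density_ops. p (conjugate_by V \<rho>) = p \<rho>)"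

definition parameter_symmetry ::
  "'d::finite cmat set \<Rightarrow> ('d cmat \<Rightarrow> real) \<Rightarrow> ('d cmat \<Rightarrow> real^'l::finite) \<Rightarrow> bool" where
  "parameter_symmetry H p s \<longleftrightarrow> (\<forall>V\<in>H. \<forall>\<rho>\<in>supp p. s (conjugate_by V \<rho>) = s \<rho>)"

text \<open>\<open>p\<close> is a \<open>G\<^sub>\<A>\<close>-distortion of \<open>p'\<close> via \<open>\<N>\<close>.\<close>

definition gauge_distortion ::
  "'d::finite cmat measure \<Rightarrow> 'd cmat set \<Rightarrow> ('d cmat \<Rightarrow> real) \<Rightarrow> ('d cmat \<Rightarrow> real) \<Rightarrow>
     ('d cmat \<Rightarrow> 'd cmat) \<Rightarrow> bool" where
  "gauge_distortion \<mu> \<A> p p' \<N> \<longleftrightarrow>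
     quantum_channel \<N> \<and> noiseless_on \<N> \<A> \<and> covariant_under \<N> (gauge_group \<A>) \<and>
     law \<mu> p = distr (law \<mu> p') \<mu> \<N>"


section \<open>Measurements and figures of merit\<close>

text \<open>
  The measurable space \<open>(\<Omega>, \<sigma>(\<Omega>))\<close> is given by \<open>space \<Omega>\<close> and \<open>sets \<Omega>\<close>; the measure
  carried by \<open>\<Omega>\<close> is never used. Values of \<open>M\<close> outside \<open>sets \<Omega>\<close> are irrelevant.
\<close>

definition povm :: "'w measure \<Rightarrow> ('w set \<Rightarrow> 'a::finite cmat) \<Rightarrow> bool" where
  "povm \<Omega> M \<longleftrightarrow>
     (\<forall>B\<in>sets \<Omega>. positive_op (M B)) \<and> M (space \<Omega>) = mat 1 \<and>
     (\<forall>F :: nat \<Rightarrow> 'w set. range F \<subseteq> sets \<Omega> \<longrightarrow> disjoint_family F \<longrightarrow>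
        (\<lambda>i. M (F i)) sums M (\<Union>i. F i))"

definition param_event ::
  "('d::finite cmat \<Rightarrow> real) \<Rightarrow> ('d cmat \<Rightarrow> real^'l::finite) \<Rightarrow> (real^'l) set \<Rightarrow> 'd cmat set" where
  "param_event p s \<Delta> = {\<rho>\<in>supp p. s \<rho> \<in> \<Delta>}"

definition param_prob ::
  "'d::finite cmat measure \<Rightarrow> ('d cmat \<Rightarrow> real) \<Rightarrow> ('d cmat \<Rightarrow> real^'l::finite) \<Rightarrow>
     (real^'l) set \<Rightarrow> real" where
  "param_prob \<mu> p s \<Delta> = set_lebesgue_integral \<mu> (param_event p s \<Delta>) p"

text \<open>The trace below is real, since it is the trace of a product of positive operators.\<close>

definition outcome_prob ::
  "(('n::finite \<Rightarrow> 'd::finite) cmat \<Rightarrow> ('n \<Rightarrow> 'd) cmat) \<Rightarrow> ('w set \<Rightarrow> ('n \<Rightarrow> 'd) cmat) \<Rightarrow>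
     'w set \<Rightarrow> 'd cmat \<Rightarrow> real" where
  "outcome_prob \<E> M B \<rho> = Re (trace (M B ** \<E> (tensor_power \<rho>)))"

definition cond_prob ::
  "'d::finite cmat measure \<Rightarrow> ('d cmat \<Rightarrow> real) \<Rightarrow> ('d cmat \<Rightarrow> real^'l::finite) \<Rightarrow>
     (('n::finite \<Rightarrow> 'd) cmat \<Rightarrow> ('n \<Rightarrow> 'd) cmat) \<Rightarrow> ('w set \<Rightarrow> ('n \<Rightarrow> 'd) cmat) \<Rightarrow>
     'w set \<Rightarrow> (real^'l) set \<Rightarrow> real" where
  "cond_prob \<mu> p s \<E> M B \<Delta> =
     1 / param_prob \<mu> p s \<Delta> *
     set_lebesgue_integral \<mu> (param_event p s \<Delta>) (\<lambda>\<rho>. p \<rho> * outcome_prob \<E> M B \<rho>)"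

text \<open>
  In \<open>real^'l\<close>, \<^const>\<open>is_interval\<close> describes exactly the products of \<open>l\<close> real intervals,
  each of which may be open, closed, half-open, degenerate or unbounded.
\<close>

definition functional_of_cond_prob ::
  "'d::finite cmat measure \<Rightarrow> ('d cmat \<Rightarrow> real) \<Rightarrow> ('d cmat \<Rightarrow> real^'l::finite) \<Rightarrow>
     (('n::finite \<Rightarrow> 'd) cmat \<Rightarrow> ('n \<Rightarrow> 'd) cmat) \<Rightarrow> 'w measure \<Rightarrow>
     (('w set \<Rightarrow> ('n \<Rightarrow> 'd) cmat) \<Rightarrow> real) \<Rightarrow> bool" where
  "functional_of_cond_prob \<mu> p s \<E> \<Omega> fom \<longleftrightarrow>
     (\<forall>M M'. povm \<Omega> M \<longrightarrow> povm \<Omega> M' \<longrightarrow>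
        (\<forall>B\<in>sets \<Omega>. \<forall>\<Delta>. is_interval \<Delta> \<and> param_prob \<mu> p s \<Delta> \<noteq> 0 \<longrightarrow>
           cond_prob \<mu> p s \<E> M B \<Delta> = cond_prob \<mu> p s \<E> M' B \<Delta>) \<longrightarrow>
        fom M = fom M')"

definition maximizing_povm ::
  "'w measure \<Rightarrow> (('w set \<Rightarrow> 'a::finite cmat) \<Rightarrow> real) \<Rightarrow> ('w set \<Rightarrow> 'a cmat) \<Rightarrow> bool" where
  "maximizing_povm \<Omega> fom M \<longleftrightarrow> povm \<Omega> M \<and> (\<forall>M'. povm \<Omega> M' \<longrightarrow> fom M' \<le> fom M)"

definition minimizing_povm ::
  "'w measure \<Rightarrow> (('w set \<Rightarrow> 'a::finite cmat) \<Rightarrow> real) \<Rightarrow> ('w set \<Rightarrow> 'a cmat) \<Rightarrow> bool" where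
  "minimizing_povm \<Omega> fom M \<longleftrightarrow> povm \<Omega> M \<and> (\<forall>M'. povm \<Omega> M' \<longrightarrow> fom M \<le> fom M')"

text \<open>
  Outcome strings \<open>(i\<^sub>1,\<dots>,i\<^sub>n)\<close> are represented by the corresponding families \<open>e\<close> of joint
  spectral projectors; \<open>\<nu> e\<close> is the probability measure \<open>\<nu>(\<cdot>|i\<^sub>1,\<dots>,i\<^sub>n)\<close>.
\<close>

definition realized_by_separate_measurement ::
  "'w measure \<Rightarrow> 'd::finite cmat set \<Rightarrow> ('w set \<Rightarrow> ('n::finite \<Rightarrow> 'd) cmat) \<Rightarrow> bool" where
  "realized_by_separate_measurement \<Omega> As M \<longleftrightarrow>
     (\<exists>\<nu> :: ('n \<Rightarrow> 'd cmat) \<Rightarrow> 'w measure.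
        (\<forall>e \<in> UNIV \<rightarrow> joint_spectral_projectors As.
           prob_space (\<nu> e) \<and> sets (\<nu> e) = sets \<Omega>) \<and>
        (\<forall>B\<in>sets \<Omega>.
           M B = (\<Sum>e \<in> UNIV \<rightarrow> joint_spectral_projectors As.
                    measure (\<nu> e) B *\<^sub>R tensor e)))"

end

theory Submission
  imports Defs
begin

text \<open>
  In the Heisenberg picture a POVM element \<open>M(B)\<close> becomes \<open>X = \<E>\<^sup>*(M(B))\<close>. Since prior and
  parameters are gauge invariant, \<open>X\<close> may be replaced by a gauge-invariant element \<open>Y\<close> of the
  closed convex hull of its orbit under \<open>V\<^sup>\<otimes>\<^sup>n\<close>, \<open>V \<in> G\<^sub>\<A>\<close>, without changing any conditional
  probability. For a pure state \<open>\<psi>\<close> the weights \<open>q(E) = \<parallel>E \<psi>\<parallel>\<^sup>2\<close> in the joint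
  eigenspaces determine \<open>\<psi>\<close> up to the gauge group, so the expectation of \<open>Y\<close> in
  \<open>\<N>(\<psi>)\<^sup>\<otimes>\<^sup>n\<close> depends on \<open>q\<close> only. Phase invariance kills the blocks of \<open>Y\<close> between
  outcome strings of different type, which makes this expectation
  \<open>\<Sum>\<^sub>i \<nu>(B|i) q(i\<^sub>1) \<dots> q(i\<^sub>n)\<close> with probabilities \<open>\<nu>(B|i)\<close>. By noiselessness the
  separate measurement with postprocessing \<open>\<nu>\<close> has the same outcome probabilities.
\<close>

section \<open>Matrix algebra\<close>

text \<open>The obstacle is that \<open>\<N>\<close> sends pure states to mixed ones. To compare
  \<open>\<N>(\<psi>)\<close> with a fixed reference operator one must pull through
  \<open>\<N>\<close> an operator with the weights \<open>norm (E *v \<psi>)\<close> on the blocks,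
  and this operator is not unitary, so covariance alone does not help. Noiselessness forbids
  transfer between diagonal blocks and covariance forbids all other transfers; hence
  \<open>\<N>\<close> commutes with compression to any pair of blocks, and with arbitrary block
  weights. Phases cannot separate strings that are permutations of one another, so coherences inside
  a type survive and the single coefficients carry no positivity. Their average over a type does,
  being the expectation of a compression of \<open>Y\<close> to the type. It is normalised because
  the reference vector has unit weight in every block. Countable additivity of
  \<open>\<nu>(B|i)\<close> in \<open>B\<close> comes for free: adjoint, averaging and extraction of
  coefficients are linear maps chosen independently of \<open>B\<close>.\<close>

lemma dagger_nth [simp]: "dagger A $ i $ j = cnj (A $ j $ i)"
  by (simp add: dagger_def)

lemma cscale_nth [simp]: "cscale c A $ i $ j = c * A $ i $ j"
  by (simp add: cscale_def)

lemma mat_mult_nth: "(A ** B) $ i $ j = (\<Sum>k\<in>UNIV. A $ i $ k * B $ k $ j)"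
  by (simp add: matrix_matrix_mult_def)

lemma mat_vec_nth: "(A *v x) $ i = (\<Sum>k\<in>UNIV. A $ i $ k * x $ k)"
  by (simp add: matrix_vector_mult_def)

lemma dagger_dagger [simp]: "dagger (dagger A) = A"
  by (simp add: vec_eq_iff)

lemma dagger_mult: "dagger (A ** B) = dagger B ** dagger A"
  by (simp add: vec_eq_iff mat_mult_nth cnj_sum mult.commute)

lemma dagger_diff: "dagger (A - B) = dagger A - dagger B"
  by (simp add: vec_eq_iff)

lemma dagger_zero [simp]: "dagger 0 = 0"
  by (simp add: vec_eq_iff)

lemma dagger_sum: "dagger (\<Sum>x\<in>S. f x) = (\<Sum>x\<in>S. dagger (f x))"
  by (simp add: vec_eq_iff cnj_sum)

lemma dagger_cscale: "dagger (cscale c A) = cscale (cnj c) (dagger A)"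
  by (simp add: vec_eq_iff)

lemma dagger_scaleR: "dagger (r *\<^sub>R A) = r *\<^sub>R dagger A"
  by (simp add: vec_eq_iff)

lemma dagger_mat_1 [simp]: "dagger (mat 1) = mat 1"
  by (simp add: vec_eq_iff mat_def)

lemma cscale_left_add: "cscale (a + b) A = cscale a A + cscale b A"
  by (simp add: vec_eq_iff algebra_simps)

lemma cscale_zero [simp]: "cscale 0 A = 0" "cscale c 0 = 0"
  by (simp_all add: vec_eq_iff)

lemma cscale_one [simp]: "cscale 1 A = A"
  by (simp add: vec_eq_iff)

lemma cscale_cscale [simp]: "cscale a (cscale b A) = cscale (a * b) A"
  by (simp add: vec_eq_iff)

lemma cscale_sum: "cscale c (\<Sum>x\<in>S. f x) = (\<Sum>x\<in>S. cscale c (f x))"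
  by (simp add: vec_eq_iff sum_distrib_left)

lemma scaleR_eq_cscale: "r *\<^sub>R A = cscale (complex_of_real r) A"
  by (simp add: vec_eq_iff) (metis scaleR_conv_of_real)

lemma cscale_mult_left [simp]: "cscale c A ** B = cscale c (A ** B)"
  by (simp add: vec_eq_iff mat_mult_nth sum_distrib_left mult.assoc)

lemma cscale_mult_right [simp]: "A ** cscale c B = cscale c (A ** B)"
  by (simp add: vec_eq_iff mat_mult_nth sum_distrib_left mult_ac)

lemma cscale_mult_vec: "cscale c A *v x = c *s (A *v x)"
  by (simp add: vec_eq_iff mat_vec_nth sum_distrib_left mult.assoc)

lemma mat_mult_add_left: "(A + B) ** C = A ** C + B ** (C :: 'a::finite cmat)"
  by (simp add: vec_eq_iff mat_mult_nth sum.distrib algebra_simps)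

lemma mat_mult_diff_left: "(A - B) ** C = A ** C - B ** (C :: 'a::finite cmat)"
  by (simp add: vec_eq_iff mat_mult_nth sum_subtractf algebra_simps)

lemma mat_mult_diff_right: "C ** (A - B) = C ** A - C ** (B :: 'a::finite cmat)"
  by (simp add: vec_eq_iff mat_mult_nth sum_subtractf algebra_simps)

lemma mat_mult_zero [simp]: "0 ** (A :: 'a::finite cmat) = 0" "(A :: 'a::finite cmat) ** 0 = 0"
  by (simp_all add: vec_eq_iff mat_mult_nth)

lemma mat_mult_sum_left: "(\<Sum>x\<in>S. f x) ** (C :: 'a::finite cmat) = (\<Sum>x\<in>S. f x ** C)"
  by (induction S rule: infinite_finite_induct) (simp_all add: mat_mult_add_left)

lemma mat_mult_sum_right: "(C :: 'a::finite cmat) ** (\<Sum>x\<in>S. f x) = (\<Sum>x\<in>S. C ** f x)"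
  by (induction S rule: infinite_finite_induct) (simp_all add: matrix_add_ldistrib)

lemma mat_mult_scaleR:
  fixes A B :: "'a::finite cmat"
  shows "(r *\<^sub>R A) ** B = r *\<^sub>R (A ** B)" "A ** (r *\<^sub>R B) = r *\<^sub>R (A ** B)"
  by (simp_all only: scaleR_eq_cscale cscale_mult_left cscale_mult_right)

lemma mat_sum_vec: "(\<Sum>x\<in>S. f x) *v v = (\<Sum>x\<in>S. f x *v (v :: complex^'a::finite))"
  by (induction S rule: infinite_finite_induct) (simp_all add: matrix_vector_mult_add_rdistrib)

lemma mat_vec_sum: "A *v (\<Sum>x\<in>S. f x) = (\<Sum>x\<in>S. A *v (f x :: complex^'a::finite))"
  by (induction S rule: infinite_finite_induct) (simp_all add: matrix_vector_right_distrib)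

lemma mat_vec_smult: "A *v (c *s x) = c *s (A *v (x :: complex^'a::finite))"
  by (simp add: vec_eq_iff mat_vec_nth sum_distrib_left mult_ac)

lemma trace_cscale: "trace (cscale c A) = c * trace A"
  by (simp add: trace_def sum_distrib_left)

lemma trace_scaleR: "trace (r *\<^sub>R A) = complex_of_real r * trace (A :: 'a::finite cmat)"
  by (simp add: scaleR_eq_cscale trace_cscale)

lemma trace_zero [simp]: "trace (0 :: 'a::finite cmat) = 0"
  by (simp add: trace_def)

lemma trace_sum: "trace (\<Sum>x\<in>S. f x) = (\<Sum>x\<in>S. trace (f x :: 'a::finite cmat))"
  by (induction S rule: infinite_finite_induct) (simp_all add: trace_add)

lemma trace_cyclic3: "trace (A ** B ** C) = trace (B ** C ** (A :: 'a::finite cmat))"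
  by (metis matrix_mul_assoc trace_mul_sym)

section \<open>Rank-one operators and inner products\<close>

definition ketbra :: "complex^'a::finite \<Rightarrow> complex^'a \<Rightarrow> 'a cmat" where
  "ketbra v w = (\<chi> i j. v $ i * cnj (w $ j))"

lemma ketbra_nth [simp]: "ketbra v w $ i $ j = v $ i * cnj (w $ j)"
  by (simp add: ketbra_def)

lemma mat_mult_ketbra: "A ** ketbra v w = ketbra (A *v v) w"
  by (simp add: vec_eq_iff mat_mult_nth mat_vec_nth sum_distrib_right mult.assoc)

lemma ketbra_mult_mat: "ketbra v w ** A = ketbra v (dagger A *v w)"
  by (simp add: vec_eq_iff mat_mult_nth mat_vec_nth sum_distrib_left cnj_sum mult_ac)

lemma ketbra_mult_vec: "ketbra v w *v u = cinner w u *s v"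
  by (simp add: vec_eq_iff mat_vec_nth cinner_def sum_distrib_left mult_ac)

lemma trace_ketbra: "trace (ketbra v w) = cinner w v"
  by (simp add: trace_def cinner_def mult.commute)

lemma dagger_ketbra: "dagger (ketbra v w) = ketbra w v"
  by (simp add: vec_eq_iff)

lemma conjugate_by_ketbra: "conjugate_by V (ketbra v w) = ketbra (V *v v) (V *v w)"
  by (simp add: conjugate_by_def mat_mult_ketbra ketbra_mult_mat)

lemma pure_states_iff: "\<rho> \<in> pure_states \<longleftrightarrow> (\<exists>\<psi>. norm \<psi> = 1 \<and> \<rho> = ketbra \<psi> \<psi>)"
  by (simp add: pure_states_def ketbra_def)

lemma cinner_commute: "cinner w v = cnj (cinner v w)"
  by (simp add: cinner_def cnj_sum mult.commute)

lemma cinner_adjoint: "cinner v (A *v w) = cinner (dagger A *v v) w"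
  unfolding cinner_def mat_vec_nth sum_distrib_left sum_distrib_right cnj_sum
  by (subst sum.swap) (simp add: mult_ac)

lemma cinner_add_right: "cinner v (a + b) = cinner v a + cinner v b"
  by (simp add: cinner_def sum.distrib algebra_simps)

lemma cinner_smult_right: "cinner v (c *s w) = c * cinner v w"
  by (simp add: cinner_def sum_distrib_left mult_ac)

lemma cinner_smult_left: "cinner (c *s v) w = cnj c * cinner v w"
  by (simp add: cinner_def sum_distrib_left mult_ac)

lemma cinner_add_left: "cinner (a + b) v = cinner a v + cinner b v"
  by (simp add: cinner_def sum.distrib algebra_simps)

text \<open>Bridge to the real Euclidean structure, through which compactness, orthogonal
  decomposition and dimension arguments apply to complex vectors.\<close>

lemma inner_eq_Re_cinner: "inner v w = Re (cinner v w)"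
  by (simp add: inner_vec_def cinner_def inner_complex_def)

lemma cinner_self: "cinner v v = complex_of_real ((norm v)\<^sup>2)"
proof (rule complex_eqI)
  show "Re (cinner v v) = Re (complex_of_real ((norm v)\<^sup>2))"
    by (simp add: inner_eq_Re_cinner[symmetric] power2_norm_eq_inner)
  have "cnj (cinner v v) = cinner v v"
    by (simp add: cinner_commute[symmetric])
  then show "Im (cinner v v) = Im (complex_of_real ((norm v)\<^sup>2))"
    by (simp add: complex_eq_iff)
qed

lemma cinner_self_eq_0: "cinner v v = 0 \<longleftrightarrow> v = 0"
  by (simp add: cinner_self)

lemma inner_adjoint: "inner v (A *v w) = inner (dagger A *v v) w"
  by (simp add: inner_eq_Re_cinner cinner_adjoint)

text \<open>In this Hilbert-Schmidt form unitary conjugations are isometries of a Euclidean space,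
  as the averaging argument requires.\<close>

lemma inner_mat: "inner A B = Re (trace (dagger A ** (B :: 'a::finite cmat)))"
proof -
  have "trace (dagger A ** B) = (\<Sum>i\<in>UNIV. \<Sum>k\<in>UNIV. cnj (A $ k $ i) * B $ k $ i)"
    by (simp add: trace_def mat_mult_nth)
  also have "Re \<dots> = (\<Sum>i\<in>UNIV. \<Sum>k\<in>UNIV. inner (A $ k $ i) (B $ k $ i))"
    by (simp add: inner_complex_def)
  also have "\<dots> = (\<Sum>k\<in>UNIV. \<Sum>i\<in>UNIV. inner (A $ k $ i) (B $ k $ i))"
    by (rule sum.swap)
  finally show ?thesis
    by (simp add: inner_vec_def)
qed

section \<open>Positive operators\<close>

lemma positive_op_iff: "positive_op A \<longleftrightarrow> (\<forall>v. Im (cinner v (A *v v)) = 0 \<and> 0 \<le> Re (cinner v (A *v v)))"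
  unfolding positive_op_def by (auto simp: complex_nonneg_Reals_iff)

lemma mat_vec_scaleR: "A *v (r *\<^sub>R x) = r *\<^sub>R (A *v (x :: complex^'a::finite))"
  by (simp add: vec_eq_iff mat_vec_nth scaleR_sum_right)

lemma positive_op_add: "positive_op A \<Longrightarrow> positive_op B \<Longrightarrow> positive_op (A + B)"
  by (auto simp: positive_op_iff matrix_vector_mult_add_rdistrib cinner_add_right)

lemma positive_op_zero [simp]: "positive_op 0"
  by (simp add: positive_op_iff cinner_def)

lemma positive_op_scaleR: "positive_op A \<Longrightarrow> 0 \<le> r \<Longrightarrow> positive_op (r *\<^sub>R A)"
  by (auto simp: positive_op_iff scaleR_eq_cscale cscale_mult_vec cinner_smult_right)

lemma positive_op_sum: "(\<And>x. x \<in> S \<Longrightarrow> positive_op (f x)) \<Longrightarrow> positive_op (\<Sum>x\<in>S. f x)"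
  by (induction S rule: infinite_finite_induct) (auto intro: positive_op_add)

lemma positive_op_dagger_mult: "positive_op (dagger B ** B)"
  by (simp add: positive_op_iff matrix_vector_mul_assoc[symmetric] cinner_adjoint[of _ "dagger B"] cinner_self)

lemma positive_op_sandwich: "positive_op A \<Longrightarrow> positive_op (B ** A ** dagger B)"
  by (simp add: positive_op_def matrix_vector_mul_assoc[symmetric] cinner_adjoint[of _ B])

lemma positive_op_conjugate_by: "positive_op A \<Longrightarrow> positive_op (conjugate_by V A)"
  by (simp add: conjugate_by_def positive_op_sandwich)

lemma positive_op_ketbra: "positive_op (ketbra v v)"
proof -
  have "cinner w (ketbra v v *v w) = cinner v w * cnj (cinner v w)" for w
    by (simp add: ketbra_mult_vec cinner_smult_right cinner_commute[of w v])
  then show ?thesis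
    by (simp add: positive_op_def complex_mult_cnj complex_nonneg_Reals_iff)
qed

text \<open>A real quadratic form makes the form of \<open>dagger A - A\<close> vanish on the
  diagonal. Polarising with \<open>v + w\<close> and with \<open>v\<close> plus i times
  \<open>w\<close> makes it vanish everywhere, which is the complex phenomenon behind
  hermiticity.\<close>

lemma positive_op_hermitian:
  assumes "positive_op A"
  shows "dagger A = A"
proof -
  have re: "cnj (cinner v (A *v v)) = cinner v (A *v v)" for v
    using assms by (simp add: positive_op_iff complex_eq_iff)
  define D where "D = dagger A - A"
  have q: "cinner v (D *v v) = 0" for v
  proof -
    have "cinner v (D *v v) = cinner v (dagger A *v v) - cinner v (A *v v)"
      using cinner_add_right[of v "D *v v" "A *v v"]
      by (simp add: D_def matrix_vector_mult_diff_rdistrib)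
    also have "cinner v (dagger A *v v) = cnj (cinner v (A *v v))"
      by (simp add: cinner_adjoint[of v "dagger A"] cinner_commute[of "A *v v" v])
    finally show ?thesis by (simp add: re)
  qed
  have "cinner v (D *v w) = 0" for v w
  proof -
    have 1: "cinner v (D *v w) + cinner w (D *v v) = 0"
      using q[of "v + w"] q[of v] q[of w]
      by (simp add: matrix_vector_right_distrib cinner_add_right cinner_add_left add.commute)
    have 2: "\<i> * cinner v (D *v w) - \<i> * cinner w (D *v v) = 0"
      using q[of "v + \<i> *s w"] q[of v] q[of w]
      by (simp add: matrix_vector_right_distrib cinner_add_right cinner_add_left mat_vec_smult
          cinner_smult_right cinner_smult_left)
    from 2 have "cinner v (D *v w) = cinner w (D *v v)"
      by (simp flip: right_diff_distrib)
    with 1 show ?thesis by (simp flip: mult_2)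
  qed
  then have "D *v w = 0" for w
    by (metis cinner_self_eq_0)
  then have "D = 0"
    by (simp add: matrix_eq)
  then show ?thesis by (simp add: D_def)
qed

text \<open>A nonnegative quadratic form attains its minimum \<open>0\<close> only where its gradient vanishes.\<close>

lemma psd_null_vector:
  fixes v :: "complex^'a::finite"
  assumes herm: "dagger A = A" and W: "subspace W" "v \<in> W" "A *v v \<in> W"
    and pos: "\<And>w. w \<in> W \<Longrightarrow> 0 \<le> inner w (A *v w)" and null: "inner v (A *v v) = 0"
  shows "A *v v = 0"
proof (rule ccontr)
  define u where "u = A *v v"
  assume "A *v v \<noteq> 0"
  then have nu: "0 < inner u u" by (simp add: u_def)
  define c where "c = inner u (A *v u)"
  have c: "0 \<le> c" using pos[OF W(3)] by (simp add: c_def u_def)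
  have key: "0 \<le> 2 * t * inner u u + t\<^sup>2 * c" for t
  proof -
    have "v + t *\<^sub>R u \<in> W"
      using W by (simp add: u_def subspace_add subspace_scale)
    from pos[OF this] show ?thesis
      using null inner_adjoint[of v A u] herm
      by (simp add: mat_vec_scaleR c_def u_def[symmetric] power2_eq_square inner_commute algebra_simps)
  qed
  \<comment> \<open>The quadratic in \<open>t\<close> would be smallest at
    \<open>- inner u u / c\<close>; using \<open>c + 1\<close> avoids a separate case for
    \<open>c = 0\<close> and still makes the value negative.\<close>
  define t where "t = - (inner u u / (c + 1))"
  have "0 \<le> 2 * t * inner u u + t\<^sup>2 * c" by (rule key)
  also have "\<dots> \<le> 2 * t * inner u u + t * (t * (c + 1))"
    by (simp add: power2_eq_square algebra_simps)
  also have "t * (c + 1) = - inner u u"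
    using c by (simp add: t_def)
  also have "2 * t * inner u u + t * (- inner u u) = t * inner u u"
    by simp
  also have "\<dots> < 0"
    using nu c by (intro mult_neg_pos) (auto simp: t_def)
  finally show False by simp
qed

text \<open>The diagonal entries are nonnegative and add up to zero, so every basis vector is a null
  vector of the form. This later turns vanishing probability of a block into vanishing of the block
  itself.\<close>

lemma positive_op_trace_0:
  assumes "positive_op A" "trace A = 0"
  shows "A = 0"
proof -
  have d: "cinner (axis i 1) (A *v axis i 1) = A $ i $ i" for i
    by (simp add: cinner_def mat_vec_nth axis_def if_distrib if_distribR cong: if_cong)
  have nn: "0 \<le> Re (A $ i $ i)" for i
    using assms(1) d[of i] by (simp add: positive_op_iff) metis
  have "(\<Sum>i\<in>UNIV. Re (A $ i $ i)) = 0"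
    using assms(2) by (simp add: trace_def complex_eq_iff)
  then have "Re (A $ i $ i) = 0" for i
    using nn by (simp add: sum_nonneg_eq_0_iff)
  then have "inner (axis i 1) (A *v axis i 1) = 0" for i
    by (simp add: inner_eq_Re_cinner d)
  moreover have "0 \<le> inner w (A *v w)" for w
    using assms(1) by (simp add: inner_eq_Re_cinner positive_op_iff)
  ultimately have "A *v axis i 1 = 0" for i
    using psd_null_vector[of A UNIV "axis i 1"] positive_op_hermitian[OF assms(1)] by simp
  then have "(A *v axis i 1) $ j = 0" for i j by simp
  then show ?thesis
    by (simp add: vec_eq_iff mat_vec_nth axis_def if_distrib cong: if_cong)
qed

section \<open>Joint spectral projectors\<close>

lemma scaleR_eq_smult: "r *\<^sub>R (v :: complex^'a) = complex_of_real r *s v"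
  by (simp add: vec_eq_iff) (metis scaleR_conv_of_real)

lemma vec_subspace_imp_subspace: "vec.subspace (W :: (complex^'a::finite) set) \<Longrightarrow> subspace W"
  by (simp add: vec.subspace_def subspace_def scaleR_eq_smult)

lemma hermitian_if_symmetric:
  assumes "\<And>v w. inner v (E *v w) = inner (E *v v) w"
  shows "dagger E = E"
proof -
  have "inner (dagger E *v v - E *v v) w = 0" for v w
    using assms[of v w] by (simp add: inner_adjoint inner_diff_left)
  then have "dagger E *v v = E *v v" for v
    by (metis eq_iff_diff_eq_0 inner_eq_zero_iff)
  then show ?thesis by (simp add: matrix_eq)
qed

text \<open>The real orthogonal projection onto \<open>W\<close> is already complex linear: a
  complex scalar crosses the real inner product as its conjugate, and \<open>W\<close> is closed
  under such scalars.\<close>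

lemma orthogonal_projector_exists:
  fixes W :: "(complex^'a::finite) set"
  assumes W: "vec.subspace W"
  shows "\<exists>E. orthogonal_projector_onto E W"
proof -
  note sub = vec_subspace_imp_subspace[OF W]
  define P where "P x y \<longleftrightarrow> y \<in> W \<and> (\<forall>w\<in>W. inner (x - y) w = 0)" for x y
  have ex: "\<exists>y. P x y" for x
  proof -
    obtain y z where "y \<in> span W" "\<And>w. w \<in> span W \<Longrightarrow> orthogonal z w" "x = y + z"
      using orthogonal_subspace_decomp_exists[of W x] by blast
    moreover have "span W = W" using sub by (simp add: span_eq_iff)
    ultimately have "P x y" by (simp add: P_def orthogonal_def)
    then show ?thesis ..
  qed
  have uniq: "y = z" if "P x y" "P x z" for x y z
  proof -
    have "y - z \<in> W" using that sub by (simp add: P_def subspace_diff)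
    then have "inner (x - z) (y - z) - inner (x - y) (y - z) = 0"
      using that by (simp add: P_def)
    then show ?thesis by (simp flip: inner_diff_left)
  qed
  define f where "f x = (SOME y. P x y)" for x
  have f: "P x (f x)" for x unfolding f_def using ex by (rule someI_ex)
  have fI: "f x = y" if "P x y" for x y using f that uniq by blast
  have ii: "inner (c *s v) w = inner v (cnj c *s w)" for c and v w :: "complex^'a"
    by (simp add: inner_eq_Re_cinner cinner_smult_left cinner_smult_right)
  have lin: "Vector_Spaces.linear (*s) (*s) f"
  proof (unfold_locales, goal_cases)
    case (1 x y)
    show ?case
      using f[of x] f[of y] sub
      by (intro fI) (simp add: P_def subspace_add add_diff_add inner_add_left)
  next
    case (2 c x)
    have "inner (c *s x - c *s f x) w = 0" if "w \<in> W" for w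
    proof -
      have "cnj c *s w \<in> W" using that W by (simp add: vec.subspace_scale)
      then show ?thesis
        using f[of x] by (simp add: P_def ii flip: vector_ssub_ldistrib)
    qed
    then show ?case
      using f[of x] W by (intro fI) (simp add: P_def vec.subspace_scale)
  qed
  define E where "E = matrix f"
  have E: "E *v x = f x" for x
    unfolding E_def using lin by (rule matrix_works)
  have fW: "f w = w" if "w \<in> W" for w using that by (intro fI) (simp add: P_def)
  have "inner v (f w) = inner (f v) w" for v w
  proof -
    have "inner (v - f v) (f w) = 0" "inner (w - f w) (f v) = 0"
      using f[of v] f[of w] by (simp_all add: P_def)
    then have "inner v (f w) = inner (f v) (f w)" "inner w (f v) = inner (f w) (f v)"
      by (simp_all add: inner_diff_left)
    then show ?thesis by (metis inner_commute)
  qed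
  then have "hermitian E"
    by (simp add: hermitian_def hermitian_if_symmetric E)
  moreover have "E ** E = E"
    using f fW by (simp add: matrix_eq matrix_vector_mul_assoc[symmetric] E P_def)
  moreover have "range (\<lambda>v. E *v v) = W"
  proof
    show "range (\<lambda>v. E *v v) \<subseteq> W" using f by (auto simp: E P_def)
    show "W \<subseteq> range (\<lambda>v. E *v v)"
    proof
      fix w assume "w \<in> W"
      then have "w = E *v w" by (simp add: E fW)
      then show "w \<in> range (\<lambda>v. E *v v)" by blast
    qed
  qed
  ultimately show ?thesis unfolding orthogonal_projector_onto_def by blast
qed

text \<open>Maximise the Rayleigh quotient over the compact unit sphere of \<open>W\<close>. With
  the maximum \<open>l\<close>, the form of \<open>l - A\<close> is nonnegative on \<open>W\<close>
  and vanishes at the maximiser, which is then a null vector. The bound holds on \<open>W\<close>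
  only, hence the restriction to a subspace in \<open>psd_null_vector\<close>.\<close>

lemma ex_max_eigenvalue:
  fixes W :: "(complex^'a::finite) set"
  assumes W: "vec.subspace W" "W \<noteq> {0}" and A: "dagger A = A" "\<And>v. v \<in> W \<Longrightarrow> A *v v \<in> W"
  shows "\<exists>v\<in>W. \<exists>l::real. v \<noteq> 0 \<and> A *v v = complex_of_real l *s v"
proof -
  note sub = vec_subspace_imp_subspace[OF W(1)]
  define S where "S = W \<inter> sphere 0 1"
  have "closed W" using sub by (rule closed_subspace)
  then have "compact S" by (simp add: S_def closed_Int_compact)
  obtain w where w: "w \<in> W" "w \<noteq> 0" using W by (auto simp: vec.subspace_def)
  then have "(1 / norm w) *\<^sub>R w \<in> S" using sub by (simp add: S_def subspace_scale)
  then have "S \<noteq> {}" by blast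
  moreover have "continuous_on S (\<lambda>v. inner v (A *v v))"
  proof -
    have "linear (\<lambda>v. A *v v)"
      by (simp add: linear_iff matrix_vector_right_distrib mat_vec_scaleR)
    then show ?thesis by (intro continuous_intros linear_continuous_on linear_conv_bounded_linear[THEN iffD1])
  qed
  ultimately obtain v where v: "v \<in> S" and vmax: "\<And>u. u \<in> S \<Longrightarrow> inner u (A *v u) \<le> inner v (A *v v)"
    using continuous_attains_sup[OF \<open>compact S\<close>] by blast
  define l where "l = inner v (A *v v)"
  define B where "B = l *\<^sub>R mat 1 - A"
  have B: "B *v x = l *\<^sub>R x - A *v x" for x
    by (simp add: B_def matrix_vector_mult_diff_rdistrib scaleR_eq_cscale cscale_mult_vec scaleR_eq_smult)
  have nv: "norm v = 1" "v \<in> W" using v by (auto simp: S_def)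
  have "B *v v = 0"
  proof (rule psd_null_vector)
    show "dagger B = B" by (simp add: B_def dagger_diff dagger_scaleR A)
    show "subspace W" "v \<in> W" by fact+
    show "B *v v \<in> W" using nv A(2)[of v] sub by (simp add: B subspace_diff subspace_scale)
    show "inner v (B *v v) = 0"
      using nv by (simp add: B inner_diff_right l_def flip: power2_norm_eq_inner)
  next
    fix u assume u: "u \<in> W"
    show "0 \<le> inner u (B *v u)"
    proof (cases "u = 0")
      case False
      then have "(1 / norm u) *\<^sub>R u \<in> S" using sub u by (simp add: S_def subspace_scale)
      from vmax[OF this] have "inner u (A *v u) / (norm u)\<^sup>2 \<le> l"
        by (simp add: mat_vec_scaleR l_def power2_eq_square)
      with False have "inner u (A *v u) \<le> l * (norm u)\<^sup>2" by (simp add: divide_le_eq)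
      then show ?thesis by (simp add: B inner_diff_right power2_norm_eq_inner)
    qed (simp add: B)
  qed
  then have "A *v v = complex_of_real l *s v" by (simp add: B scaleR_eq_smult)
  moreover have "v \<noteq> 0" using nv by auto
  ultimately show ?thesis using nv by blast
qed

section \<open>Joint spectral decomposition of commuting Hermitian observables\<close>

locale commuting_observables =
  fixes As :: "'a::finite cmat set"
  assumes hermitian_As: "A \<in> As \<Longrightarrow> dagger A = A"
    and commute_As: "A \<in> As \<Longrightarrow> B \<in> As \<Longrightarrow> A ** B = B ** A"
begin

abbreviation J where "J \<equiv> joint_spectral_projectors As"

text \<open>An invariant subspace of minimal dimension consists of joint eigenvectors only, because
  the eigenspaces of each observable in it are invariant again.\<close>

lemma joint_eigenvector:
  assumes "vec.subspace W" "W \<noteq> {0}" "\<And>A v. A \<in> As \<Longrightarrow> v \<in> W \<Longrightarrow> A *v v \<in> W"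
  shows "\<exists>v\<in>W. \<exists>a. v \<noteq> 0 \<and> (\<forall>A\<in>As. A *v v = complex_of_real (a A) *s v)"
proof -
  define P where "P U \<longleftrightarrow> vec.subspace U \<and> U \<noteq> {0} \<and> U \<subseteq> W \<and> (\<forall>A\<in>As. \<forall>v\<in>U. A *v v \<in> U)" for U
  have "P W" using assms by (simp add: P_def)
  \<comment> \<open>\<open>dim\<close> is the real dimension. It serves as well as the complex one,
    since a proper complex subspace also has smaller real dimension.\<close>
  then obtain U where U: "P U" and min: "\<And>U'. P U' \<Longrightarrow> dim U \<le> dim U'"
    using ex_has_least_nat[of P W dim] by blast
  have "\<exists>l::real. \<forall>v\<in>U. A *v v = complex_of_real l *s v" if A: "A \<in> As" for A
  proof -
    obtain w l where w: "w \<in> U" "w \<noteq> 0" "A *v w = complex_of_real l *s w"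
      using ex_max_eigenvalue[of U A] U A hermitian_As by (auto simp: P_def)
    define U' where "U' = {v \<in> U. A *v v = complex_of_real l *s v}"
    have "vec.subspace U'"
      using U by (auto simp: U'_def P_def vec.subspace_def matrix_vector_right_distrib mat_vec_smult
          vector_add_ldistrib mult.commute)
    moreover have "B *v v \<in> U'" if "B \<in> As" "v \<in> U'" for B v
    proof -
      have "A *v (B *v v) = B *v (A *v v)"
        using commute_As[OF A that(1)] by (simp add: matrix_vector_mul_assoc)
      then show ?thesis using U that by (simp add: U'_def P_def mat_vec_smult)
    qed
    moreover have "U' \<noteq> {0}" "U' \<subseteq> U" using w by (auto simp: U'_def)
    ultimately have P': "P U'" using U by (auto simp: P_def)
    then have "U' = U"
      using min[OF P'] U by (intro subspace_dim_equal \<open>U' \<subseteq> U\<close>)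
        (auto simp: P_def vec_subspace_imp_subspace)
    then show ?thesis by (auto simp: U'_def)
  qed
  then obtain a where a: "\<And>A v. A \<in> As \<Longrightarrow> v \<in> U \<Longrightarrow> A *v v = complex_of_real (a A) *s v"
    by metis
  moreover obtain v where "v \<in> U" "v \<noteq> 0" using U by (auto simp: P_def vec.subspace_def)
  moreover have "U \<subseteq> W" using U by (simp add: P_def)
  ultimately show ?thesis by blast
qed

lemma J_projector:
  assumes "E \<in> J"
  shows "dagger E = E" "E ** E = E" "E \<noteq> 0"
  using assms by (auto simp: joint_spectral_projectors_def orthogonal_projector_onto_def hermitian_def)

lemma J_eigenvalue:
  assumes "E \<in> J" "A \<in> As"
  shows "\<exists>r::real. A ** E = cscale (complex_of_real r) E"
proof -
  obtain a :: "'a cmat \<Rightarrow> real"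
    where a: "range (\<lambda>v. E *v v) = {v. \<forall>A\<in>As. A *v v = complex_of_real (a A) *s v}"
    using assms by (auto simp: joint_spectral_projectors_def orthogonal_projector_onto_def)
  have "A *v (E *v v) = complex_of_real (a A) *s (E *v v)" for v
    using a assms(2) by blast
  then show ?thesis
    by (auto simp: matrix_eq matrix_vector_mul_assoc[symmetric] cscale_mult_vec)
qed

lemma projector_range_fix:
  assumes "E ** E = E" "x \<in> range (\<lambda>v. E *v v)"
  shows "E *v x = x"
  using assms by (auto simp: matrix_vector_mul_assoc)

text \<open>If no observable told \<open>E\<close> and \<open>F\<close> apart, both would project
  onto the same joint eigenspace, and an orthogonal projector is determined by its range.\<close>

lemma J_separated:
  assumes E: "E \<in> J" "F \<in> J" "E \<noteq> F"
  shows "\<exists>A\<in>As. \<exists>r s::real. r \<noteq> s \<and> A ** E = cscale (complex_of_real r) E \<and>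
    A ** F = cscale (complex_of_real s) F"
proof (rule ccontr)
  assume neg: "\<not> ?thesis"
  obtain a b :: "'a cmat \<Rightarrow> real"
    where a: "range (\<lambda>v. E *v v) = {v. \<forall>A\<in>As. A *v v = complex_of_real (a A) *s v}"
      and b: "range (\<lambda>v. F *v v) = {v. \<forall>A\<in>As. A *v v = complex_of_real (b A) *s v}"
    using E by (auto simp: joint_spectral_projectors_def orthogonal_projector_onto_def)
  have "A ** E = cscale (complex_of_real (a A)) E" "A ** F = cscale (complex_of_real (b A)) F"
    if "A \<in> As" for A
    using a b that by (auto simp: matrix_eq matrix_vector_mul_assoc[symmetric] cscale_mult_vec)
  with neg have "\<forall>A\<in>As. a A = b A" by blast
  then have r: "range (\<lambda>v. E *v v) = range (\<lambda>v. F *v v)" using a b by simp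
  have EF: "E ** F = F" "F ** E = E"
  proof -
    have "F *v v \<in> range (\<lambda>v. E *v v)" "E *v v \<in> range (\<lambda>v. F *v v)" for v
      by (simp add: r, simp flip: r)
    then have "E *v (F *v v) = F *v v" "F *v (E *v v) = E *v v" for v
      using projector_range_fix[OF J_projector(2)] E by blast+
    then show "E ** F = F" "F ** E = E"
      by (simp_all add: matrix_eq matrix_vector_mul_assoc[symmetric])
  qed
  \<comment> \<open>Equal ranges give \<open>E ** F = F\<close> and \<open>F ** E = E\<close>; the
    adjoint of the second is \<open>E ** F = E\<close>.\<close>
  have "E = dagger (F ** E)" using EF J_projector(1)[OF E(1)] by simp
  also have "\<dots> = E ** F" using J_projector(1) E unfolding dagger_mult by simp
  also have "\<dots> = F" by (rule EF)
  finally show False using E by simp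
qed

text \<open>A separating observable placed between \<open>E\<close> and \<open>F\<close> can be
  evaluated to either side, with two different eigenvalues.\<close>

lemma J_orthogonal:
  assumes E: "E \<in> J" "F \<in> J" "E \<noteq> F"
  shows "E ** F = 0"
proof -
  obtain A and r s :: real where A: "A \<in> As" "r \<noteq> s" "A ** E = cscale (complex_of_real r) E"
    "A ** F = cscale (complex_of_real s) F"
    using J_separated[OF E] by blast
  have "dagger (A ** E) = E ** A" using hermitian_As[OF A(1)] J_projector(1)[OF E(1)] by (metis dagger_mult)
  then have "E ** A = cscale (complex_of_real r) E"
    using J_projector(1)[OF E(1)] unfolding A(3) by (simp add: dagger_cscale)
  then have "cscale (complex_of_real r) (E ** F) = cscale (complex_of_real s) (E ** F)"
    using A(4) matrix_mul_assoc[of E A F] by simp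
  then show ?thesis using \<open>r \<noteq> s\<close> by (simp add: vec_eq_iff)
qed

text \<open>The eigenvalue functions \<open>a\<close> form an infinite set, so finiteness is read
  off from dimension: the projectors are nonzero and pairwise Hilbert-Schmidt orthogonal.\<close>

lemma finite_J: "finite J"
proof (rule independent_imp_finite, rule pairwise_orthogonal_independent)
  show "pairwise orthogonal J"
    by (auto simp: pairwise_def orthogonal_def inner_mat J_projector J_orthogonal)
  show "0 \<notin> J" using J_projector by blast
qed

lemma J_mult: "E \<in> J \<Longrightarrow> F \<in> J \<Longrightarrow> E ** F = (if E = F then E else 0)"
  using J_orthogonal J_projector by auto

text \<open>The complement \<open>Q\<close> commutes with all observables, so a nonzero range of
  \<open>Q\<close> is invariant and contains a joint eigenvector. That vector lies in the range of
  some \<open>E\<close> in \<open>J\<close>, although \<open>E ** Q = 0\<close>.\<close>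

lemma sum_J: "\<Sum>J = mat 1"
proof (rule ccontr)
  define Q where "Q = mat 1 - \<Sum>J"
  assume "\<Sum>J \<noteq> mat 1"
  then have "Q \<noteq> 0" by (simp add: Q_def)
  have EQ: "E ** Q = 0" if "E \<in> J" for E
  proof -
    have "E ** \<Sum>J = (\<Sum>F\<in>J. if E = F then E else 0)"
      using that J_mult by (simp add: mat_mult_sum_right)
    then show ?thesis using that finite_J by (simp add: Q_def mat_mult_diff_right)
  qed
  have comm: "A ** Q = Q ** A" if "A \<in> As" for A
  proof -
    have "A ** E = E ** A" if E: "E \<in> J" for E
    proof -
      obtain r :: real where r: "A ** E = cscale (complex_of_real r) E"
        using J_eigenvalue[OF E \<open>A \<in> As\<close>] by blast
      have "E ** A = dagger (A ** E)" using \<open>A \<in> As\<close> hermitian_As J_projector(1)[OF E] by (simp add: dagger_mult)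
      also have "\<dots> = A ** E" using r J_projector(1)[OF E] by (simp add: dagger_cscale)
      finally show ?thesis by simp
    qed
    then show ?thesis by (simp add: Q_def mat_mult_diff_right mat_mult_diff_left mat_mult_sum_left mat_mult_sum_right)
  qed
  define W where "W = range (\<lambda>v. Q *v v)"
  have "vec.subspace W"
    unfolding W_def
  proof (rule vec.subspaceI)
    show "0 \<in> range ((*v) Q)" by (metis matrix_vector_mult_0_right rangeI)
    show "x + y \<in> range ((*v) Q)" if "x \<in> range ((*v) Q)" "y \<in> range ((*v) Q)" for x y
      using that by (auto simp: matrix_vector_right_distrib[symmetric])
    show "c *s x \<in> range ((*v) Q)" if "x \<in> range ((*v) Q)" for c x
      using that by (auto simp: mat_vec_smult[symmetric])
  qed
  moreover have "W \<noteq> {0}" using \<open>Q \<noteq> 0\<close> by (auto simp: W_def matrix_eq)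
  moreover have "A *v v \<in> W" if "A \<in> As" "v \<in> W" for A v
    using that comm by (auto simp: W_def matrix_vector_mul_assoc) (auto simp: matrix_vector_mul_assoc[symmetric])
  ultimately obtain v and a :: "'a cmat \<Rightarrow> real" where v: "v \<in> W" "v \<noteq> 0"
    "\<And>A. A \<in> As \<Longrightarrow> A *v v = complex_of_real (a A) *s v"
    using joint_eigenvector[of W] by blast
  define U where "U = {v. \<forall>A\<in>As. A *v v = complex_of_real (a A) *s v}"
  have "vec.subspace U"
    by (auto simp: U_def vec.subspace_def matrix_vector_right_distrib mat_vec_smult
          vector_add_ldistrib mult.commute)
  then obtain E where E: "orthogonal_projector_onto E U"
    using orthogonal_projector_exists by blast
  have vU: "v \<in> U" using v by (simp add: U_def)
  then have Ev: "E *v v = v"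
    using E by (auto simp: orthogonal_projector_onto_def matrix_vector_mul_assoc intro!: projector_range_fix)
  then have "E \<in> J"
    using E v(2) unfolding joint_spectral_projectors_def U_def by auto
  from EQ[OF this] v(1) have "E *v v = 0"
    by (auto simp: W_def matrix_vector_mul_assoc)
  with Ev v show False by simp
qed

end

text \<open>The joint spectral decomposition for the single observable \<open>A\<close> is the
  spectral theorem; the root takes square roots of the eigenvalues.\<close>

lemma positive_op_sqrt:
  assumes "positive_op A"
  shows "\<exists>B. A = dagger B ** B"
proof -
  interpret commuting_observables "{A}"
    using positive_op_hermitian[OF assms] by unfold_locales auto
  obtain r where r: "\<And>E. E \<in> J \<Longrightarrow> A ** E = cscale (complex_of_real (r E)) E"
    using bchoice[of J "\<lambda>E r. A ** E = cscale (complex_of_real r) E"] J_eigenvalue by blast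
  have nn: "0 \<le> r E" if E: "E \<in> J" for E
  proof -
    obtain v where v: "E *v v \<noteq> 0" using J_projector(3)[OF E] by (auto simp: matrix_eq)
    have "A *v (E *v v) = complex_of_real (r E) *s (E *v v)"
      using r[OF E] by (simp add: matrix_vector_mul_assoc cscale_mult_vec)
    then have "0 \<le> Re (complex_of_real (r E) * cinner (E *v v) (E *v v))"
      using assms unfolding positive_op_iff by (metis cinner_smult_right)
    then have "0 \<le> r E * (norm (E *v v))\<^sup>2" by (simp add: cinner_self)
    with v show ?thesis by (simp add: zero_le_mult_iff)
  qed
  define B where "B = (\<Sum>E\<in>J. sqrt (r E) *\<^sub>R E)"
  have "dagger B = B" by (simp add: B_def dagger_sum dagger_scaleR J_projector)
  have "B ** B = (\<Sum>E\<in>J. \<Sum>F\<in>J. sqrt (r E) *\<^sub>R sqrt (r F) *\<^sub>R (F ** E))"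
    by (simp add: B_def mat_mult_sum_left mat_mult_sum_right mat_mult_scaleR scaleR_sum_right)
  also have "\<dots> = (\<Sum>E\<in>J. \<Sum>F\<in>J. if E = F then r E *\<^sub>R E else 0)"
    using nn by (intro sum.cong refl) (auto simp: J_mult)
  also have "\<dots> = (\<Sum>E\<in>J. A ** E)"
    using finite_J by (simp add: r scaleR_eq_cscale)
  also have "\<dots> = A" by (simp add: sum_J flip: mat_mult_sum_right)
  finally show ?thesis using \<open>dagger B = B\<close> by metis
qed

text \<open>With factorisations of both operators the trace becomes the squared Hilbert-Schmidt norm
  of \<open>D ** dagger C\<close>.\<close>

lemma trace_mult_positive:
  assumes "positive_op A" "positive_op B"
  shows "0 \<le> Re (trace (A ** B))" "Im (trace (A ** B)) = 0"
proof -
  obtain C where C: "A = dagger C ** C" using positive_op_sqrt[OF assms(1)] by blast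
  obtain D where D: "B = dagger D ** D" using positive_op_sqrt[OF assms(2)] by blast
  define G where "G = D ** dagger C"
  have "trace (A ** B) = trace (dagger G ** G)"
    unfolding G_def C D dagger_mult dagger_dagger
    by (metis matrix_mul_assoc trace_mul_sym)
  moreover have "trace (dagger G ** G) = complex_of_real (inner G G)"
  proof -
    have "cnj (trace (dagger G ** G)) = trace (dagger G ** G)"
      by (simp add: trace_def mat_mult_nth mult.commute)
    then show ?thesis by (simp add: complex_eq_iff inner_mat)
  qed
  ultimately show "0 \<le> Re (trace (A ** B))" "Im (trace (A ** B)) = 0" by simp_all
qed

section \<open>Commutative von Neumann algebras and their gauge groups\<close>

lemma von_neumann_algebra_hull: "von_neumann_algebra (von_neumann_algebra hull S)"
  unfolding hull_def von_neumann_algebra_def complex_subspace_def by blast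

lemma von_neumann_algebra_imp_subspace: "von_neumann_algebra \<A> \<Longrightarrow> subspace \<A>"
  by (auto simp: von_neumann_algebra_def complex_subspace_def subspace_def scaleR_eq_cscale)

text \<open>Hermitian and antihermitian parts of a finite real basis suffice. This keeps the final
  statement about all generating sets from being vacuous.\<close>

lemma generating_observables_exist:
  assumes "von_neumann_algebra \<A>"
  shows "\<exists>As. generating_observables \<A> As"
proof -
  obtain B where B: "B \<subseteq> \<A>" "independent B" "\<A> \<subseteq> span B"
    using basis_exists[of \<A>] by metis
  define As where "As = (\<lambda>A. A + dagger A) ` B \<union> (\<lambda>A. cscale \<i> (A + cscale (-1) (dagger A))) ` B"
  define H where "H = von_neumann_algebra hull (insert (mat 1) As)"
  have closed: "A + C \<in> X" "cscale c A \<in> X" "dagger A \<in> X"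
    if "von_neumann_algebra X" "A \<in> X" "C \<in> X" for X A C and c :: complex
    using that by (auto simp: von_neumann_algebra_def complex_subspace_def)
  have vH: "von_neumann_algebra H"
    unfolding H_def by (rule von_neumann_algebra_hull)
  have "As \<subseteq> \<A>"
    using B(1) closed[OF assms] by (auto simp: As_def)
  moreover have "mat 1 \<in> \<A>" using assms by (simp add: von_neumann_algebra_def)
  ultimately have "H \<subseteq> \<A>"
    unfolding H_def by (intro hull_minimal assms) auto
  moreover have "B \<subseteq> H"
  proof
    fix A assume "A \<in> B"
    then have "A + dagger A \<in> H" "cscale \<i> (A + cscale (-1) (dagger A)) \<in> H"
      unfolding H_def by (auto intro!: hull_inc simp: As_def)
    \<comment> \<open>The second observable is i times \<open>A - dagger A\<close>, so the factor
      -i/2 returns half of that difference.\<close>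
    then have "cscale (1/2) (A + dagger A) + cscale (- \<i>/2) (cscale \<i> (A + cscale (-1) (dagger A))) \<in> H"
      using closed[OF vH] by blast
    also have "cscale (1/2) (A + dagger A) + cscale (- \<i>/2) (cscale \<i> (A + cscale (-1) (dagger A))) = A"
      by (simp add: vec_eq_iff field_simps)
    finally show "A \<in> H" .
  qed
  then have "span B \<subseteq> H"
    by (rule span_minimal) (rule von_neumann_algebra_imp_subspace[OF vH])
  ultimately have "H = \<A>" using B(3) by blast
  moreover have "hermitian A" if "A \<in> As" for A
    using that by (auto simp: As_def hermitian_def vec_eq_iff algebra_simps)
  moreover have "finite As"
    using independent_imp_finite[OF B(2)] by (simp add: As_def)
  ultimately show ?thesis
    using \<open>As \<subseteq> \<A>\<close> unfolding generating_observables_def H_def by blast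
qed

section \<open>Unitaries and the gauge group\<close>

lemma unitaryI: "dagger U ** U = mat 1 \<Longrightarrow> unitary U"
  by (simp add: unitary_def matrix_left_right_inverse)

lemma unitary_mult: "unitary U \<Longrightarrow> unitary V \<Longrightarrow> unitary (U ** V)"
  unfolding unitary_def dagger_mult
  by (metis matrix_mul_assoc matrix_mul_rid)

lemma unitary_dagger: "unitary U \<Longrightarrow> unitary (dagger U)"
  by (simp add: unitary_def)

lemma gauge_group_mult: "U \<in> gauge_group \<A> \<Longrightarrow> V \<in> gauge_group \<A> \<Longrightarrow> U ** V \<in> gauge_group \<A>"
  unfolding gauge_group_def by (auto simp: unitary_mult) (metis matrix_mul_assoc)

lemma mat_1_in_gauge_group: "mat 1 \<in> gauge_group \<A>"
  by (simp add: gauge_group_def unitary_def)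

lemma gauge_group_dagger:
  assumes "von_neumann_algebra \<A>" "V \<in> gauge_group \<A>"
  shows "dagger V \<in> gauge_group \<A>"
proof -
  have "dagger V ** A = A ** dagger V" if "A \<in> \<A>" for A
  proof -
    have "dagger A \<in> \<A>" using assms(1) that by (simp add: von_neumann_algebra_def)
    then have "dagger (V ** dagger A) = dagger (dagger A ** V)"
      using assms(2) by (simp add: gauge_group_def)
    then show ?thesis by (simp add: dagger_mult)
  qed
  then show ?thesis using assms(2) by (simp add: gauge_group_def unitary_dagger)
qed

locale generated_algebra =
  fixes \<A> :: "'a::finite cmat set" and As
  assumes vn: "von_neumann_algebra \<A>" and comm: "commutative_algebra \<A>"
    and gen: "generating_observables \<A> As"
begin

sublocale commuting_observables As
  using gen comm
  by unfold_locales (auto simp: generating_observables_def hermitian_def commutative_algebra_def)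

text \<open>The matrices acting as a scalar on every \<open>E\<close> form a von Neumann algebra
  \<open>T\<close> containing the generators, hence all of the generated algebra. Scalars are
  demanded on both sides because the adjoint exchanges the sides.\<close>

lemma alg_eigenvalue:
  assumes "A \<in> \<A>" "E \<in> J"
  shows "\<exists>c. A ** E = cscale c E \<and> E ** A = cscale c E"
proof -
  define T where "T = {A. \<forall>E\<in>J. \<exists>c. A ** E = cscale c E \<and> E ** A = cscale c E}"
  have "von_neumann_algebra T"
    unfolding von_neumann_algebra_def complex_subspace_def
  proof (intro conjI ballI allI)
    show "0 \<in> T" by (auto simp: T_def intro!: exI[of _ 0])
    show "mat 1 \<in> T" by (auto simp: T_def intro!: exI[of _ 1])
    fix A assume A: "A \<in> T"
    show "cscale c A \<in> T" for c using A unfolding T_def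
      by (auto simp: cscale_mult_left cscale_mult_right) (metis cscale_cscale)
    have "\<exists>c. dagger A ** E = cscale c E \<and> E ** dagger A = cscale c E" if E: "E \<in> J" for E
    proof -
      obtain c where c: "A ** E = cscale c E" "E ** A = cscale c E" using A E by (auto simp: T_def)
      have "dagger (A ** E) = E ** dagger A" "dagger (E ** A) = dagger A ** E"
        using J_projector(1)[OF E] by (simp_all only: dagger_mult)
      then show ?thesis
        using J_projector(1)[OF E] unfolding c by (auto simp: dagger_cscale intro!: exI[of _ "cnj c"])
    qed
    then show "dagger A \<in> T" by (simp add: T_def)
    fix B assume B: "B \<in> T"
    have "\<exists>c. (A + B) ** E = cscale c E \<and> E ** (A + B) = cscale c E"
      "\<exists>c. (A ** B) ** E = cscale c E \<and> E ** (A ** B) = cscale c E" if E: "E \<in> J" for E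
    proof -
      obtain c d where c: "A ** E = cscale c E" "E ** A = cscale c E"
        "B ** E = cscale d E" "E ** B = cscale d E" using A B E by (auto simp: T_def) metis
      show "\<exists>c. (A + B) ** E = cscale c E \<and> E ** (A + B) = cscale c E"
        using c by (auto simp: mat_mult_add_left matrix_add_ldistrib cscale_left_add intro!: exI[of _ "c + d"])
      have "(A ** B) ** E = A ** (B ** E)" by (simp only: matrix_mul_assoc)
      moreover have "E ** (A ** B) = (E ** A) ** B" by (simp only: matrix_mul_assoc)
      ultimately show "\<exists>c. (A ** B) ** E = cscale c E \<and> E ** (A ** B) = cscale c E"
        using c by (auto simp: mult.commute intro!: exI[of _ "c * d"])
    qed
    then show "A + B \<in> T" "A ** B \<in> T" by (auto simp: T_def)
  qed
  moreover have "insert (mat 1) As \<subseteq> T"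
  proof -
    have "A \<in> T" if A: "A \<in> As" for A
    proof -
      have "\<exists>c. A ** E = cscale c E \<and> E ** A = cscale c E" if E: "E \<in> J" for E
      proof -
        obtain r :: real where r: "A ** E = cscale (complex_of_real r) E"
          using J_eigenvalue[OF E A] by blast
        have "E ** A = dagger (A ** E)"
          using hermitian_As[OF A] J_projector(1)[OF E] by (simp only: dagger_mult)
        then show ?thesis using r J_projector(1)[OF E] by (auto simp: dagger_cscale)
      qed
      then show ?thesis by (simp add: T_def)
    qed
    moreover have "mat 1 \<in> T" by (auto simp: T_def intro!: exI[of _ 1])
    ultimately show ?thesis by blast
  qed
  ultimately have "von_neumann_algebra hull (insert (mat 1) As) \<subseteq> T"
    by (intro hull_minimal)
  then show ?thesis
    using gen assms unfolding generating_observables_def T_def by blast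
qed

lemma alg_closed:
  assumes "A \<in> \<A>" "B \<in> \<A>"
  shows "A + B \<in> \<A>" "A ** B \<in> \<A>" "cscale c A \<in> \<A>" "mat 1 \<in> \<A>"
  using vn assms by (auto simp: von_neumann_algebra_def complex_subspace_def)

text \<open>A product of interpolating factors picks out a single joint spectral projector.\<close>

lemma J_in_alg:
  assumes E: "E \<in> J"
  shows "E \<in> \<A>"
proof -
  have sep: "\<exists>A\<in>\<A>. A ** E = E \<and> A ** F = 0" if F: "F \<in> J" "F \<noteq> E" for F
  proof -
    obtain A and r s :: real where A: "A \<in> As" "r \<noteq> s" "A ** E = cscale (complex_of_real r) E"
      "A ** F = cscale (complex_of_real s) F"
      using J_separated[OF E F(1)] F by metis
    \<comment> \<open>The Lagrange factor \<open>(A - s) / (r - s)\<close>: one on the range of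
      \<open>E\<close>, zero on the range of \<open>F\<close>.\<close>
    define B where "B = cscale (complex_of_real (1 / (r - s))) (A + cscale (- complex_of_real s) (mat 1))"
    have "As \<subseteq> \<A>" using gen by (simp add: generating_observables_def)
    with A have "A \<in> \<A>" by blast
    then have "B \<in> \<A>" unfolding B_def by (intro alg_closed)
    moreover have "B ** E = cscale (complex_of_real (1 / (r - s)) * complex_of_real (r - s)) E"
      by (simp add: B_def mat_mult_add_left A flip: cscale_left_add)
    moreover have "complex_of_real (1 / (r - s)) * complex_of_real (r - s) = 1"
      using A(2) by (simp flip: of_real_mult)
    moreover have "B ** F = 0"
      by (simp add: B_def mat_mult_add_left A flip: cscale_left_add)
    ultimately show ?thesis by auto
  qed
  have "\<exists>A\<in>\<A>. A ** E = E \<and> (\<forall>F\<in>S. A ** F = 0)" if "finite S" "S \<subseteq> J - {E}" for S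
    using that
  proof (induction S rule: finite_induct)
    case empty
    have "mat 1 \<in> \<A>" using vn by (simp add: von_neumann_algebra_def)
    then show ?case by force
  next
    case (insert F S)
    then obtain A B where AB: "A \<in> \<A>" "A ** E = E" "\<forall>F\<in>S. A ** F = 0" "B \<in> \<A>" "B ** E = E" "B ** F = 0"
      using sep[of F] by auto
    have "B ** A = A ** B" using AB comm by (simp add: commutative_algebra_def)
    then have "(B ** A) ** F = A ** (B ** F)" by (simp add: matrix_mul_assoc)
    then have "(B ** A) ** F = 0" using AB by simp
    moreover have assoc: "(B ** A) ** G = B ** (A ** G)" for G by (simp only: matrix_mul_assoc)
    have "(B ** A) ** E = E" unfolding assoc using AB by simp
    moreover have "(B ** A) ** G = 0" if "G \<in> S" for G unfolding assoc using AB that by simp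
    ultimately show ?case
      using alg_closed(2)[OF AB(4,1)] by blast
  qed
  then obtain A where A: "A \<in> \<A>" "A ** E = E" "\<forall>F\<in>J - {E}. A ** F = 0"
    using finite_J by blast
  have "A = (\<Sum>F\<in>J. A ** F)" by (simp add: sum_J flip: mat_mult_sum_right)
  also have "\<dots> = (\<Sum>F\<in>J. if F = E then E else 0)" using A by (intro sum.cong) auto
  also have "\<dots> = E" using finite_J E by simp
  finally show ?thesis using A by simp
qed

text \<open>General complex weights serve two purposes: unimodular \<open>z\<close> gives gauge
  unitaries, while nonnegative \<open>z\<close> gives the operators that stretch the reference
  vector to prescribed block norms.\<close>

definition blockdiag :: "('a cmat \<Rightarrow> complex) \<Rightarrow> 'a cmat" where
  "blockdiag z = (\<Sum>E\<in>J. cscale (z E) E)"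

lemma J_mult_blockdiag:
  assumes "E \<in> J"
  shows "E ** blockdiag z = cscale (z E) E" "blockdiag z ** E = cscale (z E) E"
proof -
  have "(\<Sum>F\<in>J. cscale (z F) (if E = F then E else 0)) = (\<Sum>F\<in>J. if E = F then cscale (z F) E else 0)"
    by (intro sum.cong) auto
  then show "E ** blockdiag z = cscale (z E) E"
    using assms finite_J by (simp add: blockdiag_def mat_mult_sum_right J_mult)
  have "(\<Sum>F\<in>J. cscale (z F) (if F = E then F else 0)) = (\<Sum>F\<in>J. if E = F then cscale (z F) E else 0)"
    by (intro sum.cong) auto
  then show "blockdiag z ** E = cscale (z E) E"
    using assms finite_J by (simp add: blockdiag_def mat_mult_sum_left J_mult)
qed

lemma dagger_blockdiag: "dagger (blockdiag z) = blockdiag (\<lambda>E. cnj (z E))"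
  by (simp add: blockdiag_def dagger_sum dagger_cscale J_projector)

text \<open>Every \<open>A\<close> in the algebra is the sum of the \<open>A ** E\<close>, and each
  of these is a multiple of \<open>E\<close>.\<close>

lemma gauge_groupI:
  assumes "unitary V" "\<And>E. E \<in> J \<Longrightarrow> V ** E = E ** V"
  shows "V \<in> gauge_group \<A>"
proof -
  have "V ** A = A ** V" if A: "A \<in> \<A>" for A
  proof -
    have e: "V ** (A ** E) = (A ** E) ** V" if E: "E \<in> J" for E
      using alg_eigenvalue[OF A E] assms(2)[OF E] by auto
    have "V ** A = V ** (A ** \<Sum>J)" by (simp add: sum_J)
    also have "\<dots> = (A ** \<Sum>J) ** V" using e by (simp add: mat_mult_sum_left mat_mult_sum_right)
    also have "\<dots> = A ** V" by (simp add: sum_J)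
    finally show ?thesis .
  qed
  then show ?thesis using assms(1) by (simp add: gauge_group_def)
qed

lemma gauge_group_commutes_J: "V \<in> gauge_group \<A> \<Longrightarrow> E \<in> J \<Longrightarrow> V ** E = E ** V"
  using J_in_alg by (auto simp: gauge_group_def)

lemma phases_in_gauge_group:
  assumes "\<And>E. E \<in> J \<Longrightarrow> cmod (z E) = 1"
  shows "blockdiag z \<in> gauge_group \<A>"
proof (rule gauge_groupI)
  have "cnj (z E) * z E = 1" if "E \<in> J" for E
    using assms[OF that] by (metis complex_norm_square mult.commute of_real_1 one_power2)
  then have "dagger (blockdiag z) ** blockdiag z = \<Sum>J"
    unfolding dagger_blockdiag
    by (subst blockdiag_def) (simp add: mat_mult_sum_left J_mult_blockdiag)
  then show "unitary (blockdiag z)" by (intro unitaryI) (simp add: sum_J)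
qed (simp add: J_mult_blockdiag)

text \<open>Householder reflection along \<open>v - w\<close>. It fixes every other block because
  \<open>v - w\<close> lies in the range of \<open>E\<close>.\<close>

lemma reflection_in_gauge_group:
  assumes E: "E \<in> J" and v: "E *v v = v" "E *v w = w" "norm v = norm w" "Im (cinner v w) = 0"
  shows "\<exists>V\<in>gauge_group \<A>. V *v v = w"
proof (cases "v = w")
  case True
  then show ?thesis using mat_1_in_gauge_group by force
next
  case False
  define u where "u = v - w"
  define c where "c = 2 / (norm u)\<^sup>2"
  define V where "V = mat 1 - c *\<^sub>R ketbra u u"
  have nu: "norm u \<noteq> 0" using False by (simp add: u_def)
  have Eu: "E *v u = u" using v by (simp add: u_def matrix_vector_mult_diff_distrib)
  have "dagger V = V" by (simp add: V_def dagger_diff dagger_scaleR dagger_ketbra)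
  have uu: "ketbra u u ** ketbra u u = (norm u)\<^sup>2 *\<^sub>R ketbra u u"
  proof -
    have "ketbra u u ** ketbra u u = ketbra (cinner u u *s u) u"
      by (simp only: mat_mult_ketbra ketbra_mult_vec)
    also have "\<dots> = cscale (cinner u u) (ketbra u u)"
      by (simp add: vec_eq_iff)
    finally show ?thesis by (simp add: cinner_self scaleR_eq_cscale)
  qed
  have "V ** V = mat 1 - c *\<^sub>R ketbra u u - c *\<^sub>R ketbra u u + (c * c * (norm u)\<^sup>2) *\<^sub>R ketbra u u"
    by (simp add: V_def mat_mult_diff_left mat_mult_diff_right mat_mult_scaleR uu scaleR_diff_right mult.assoc)
  also have "c * c * (norm u)\<^sup>2 = c * (c * (norm u)\<^sup>2)" by simp
  also have "c * (norm u)\<^sup>2 = 2" using nu by (simp add: c_def)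
  also have "c * 2 = c + c" by simp
  finally have "V ** V = mat 1" by (simp only: scaleR_add_left diff_diff_eq diff_add_cancel)
  then have VV: "dagger V ** V = mat 1" using \<open>dagger V = V\<close> by simp
  have "V \<in> gauge_group \<A>"
  proof (rule gauge_groupI)
    show "unitary V" using VV by (rule unitaryI)
    fix F assume F: "F \<in> J"
    have "F *v u = (if F = E then u else 0)"
      using J_mult[OF F E] Eu by (metis matrix_vector_mul_assoc matrix_vector_mult_0)
    then have "F ** ketbra u u = ketbra u u ** F"
      using J_projector(1)[OF F] by (simp add: mat_mult_ketbra ketbra_mult_mat) (simp add: vec_eq_iff)
    then show "V ** F = F ** V"
      by (simp add: V_def mat_mult_diff_left mat_mult_diff_right mat_mult_scaleR)
  qed
  moreover have "V *v v = w"
  proof -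
    \<comment> \<open>This is where \<open>cinner v w\<close> must be real: otherwise
      \<open>cinner u v\<close> would have an imaginary part and the reflection would miss
      \<open>w\<close>.\<close>
    have cc: "cinner u v = complex_of_real ((norm u)\<^sup>2 / 2)"
    proof (rule complex_eqI)
      have "(norm u)\<^sup>2 = inner v v + inner w w - 2 * inner v w"
        by (simp add: u_def power2_norm_eq_inner inner_diff_left inner_diff_right inner_commute)
      also have "inner w w = inner v v" using v(3) by (simp flip: power2_norm_eq_inner)
      finally have "(norm u)\<^sup>2 / 2 = inner u v"
        by (simp add: u_def inner_diff_left inner_commute[of w v])
      then show "Re (cinner u v) = Re (complex_of_real ((norm u)\<^sup>2 / 2))"
        by (simp add: inner_eq_Re_cinner)
      have "Im (cinner w v) = 0" using v(4) cinner_commute[of w v] by simp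
      moreover have "cinner v v = cinner u v + cinner w v"
        using cinner_add_left[of u w v] by (simp add: u_def)
      moreover have "Im (cinner v v) = 0" by (simp add: cinner_self)
      ultimately show "Im (cinner u v) = Im (complex_of_real ((norm u)\<^sup>2 / 2))" by simp
    qed
    have "V *v v = v - (c * ((norm u)\<^sup>2 / 2)) *\<^sub>R u"
      by (simp add: V_def matrix_vector_mult_diff_rdistrib scaleR_eq_cscale cscale_mult_vec ketbra_mult_vec
          cc scaleR_eq_smult)
    also have "c * ((norm u)\<^sup>2 / 2) = 1" using nu by (simp add: c_def)
    finally show ?thesis by (simp add: u_def)
  qed
  ultimately show ?thesis by blast
qed

text \<open>A global phase, itself a gauge unitary, first makes the inner product with
  \<open>w\<close> real; then a reflection finishes.\<close>

lemma gauge_transitive_block: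
  assumes E: "E \<in> J" and v: "E *v v = v" "E *v w = w" "norm v = norm w"
  shows "\<exists>V\<in>gauge_group \<A>. V *v v = w"
proof -
  \<comment> \<open>The value 1 replaces \<open>sgn 0 = 0\<close>, which would not be a
    phase.\<close>
  define c where "c = (if cinner v w = 0 then 1 else sgn (cinner v w))"
  have nc: "cmod c = 1" by (simp add: c_def norm_sgn)
  have ci: "cinner (c *s v) w = complex_of_real (cmod (cinner v w))"
  proof (cases "cinner v w = 0")
    case False
    then have "cnj (sgn (cinner v w)) * cinner v w = complex_of_real (cmod (cinner v w))"
      by (simp add: sgn_eq complex_norm_square[symmetric] mult.commute power2_eq_square field_simps)
    then show ?thesis using False by (simp add: c_def cinner_smult_left)
  qed (simp add: cinner_smult_left)
  have "norm (c *s v) = norm v"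
  proof -
    have "complex_of_real ((norm (c *s v))\<^sup>2) = cinner (c *s v) (c *s v)"
      by (rule cinner_self[symmetric])
    also have "\<dots> = c * cnj c * cinner v v"
      by (simp add: cinner_smult_left cinner_smult_right)
    also have "c * cnj c = 1" using nc by (simp flip: complex_norm_square)
    finally have "(norm (c *s v))\<^sup>2 = (norm v)\<^sup>2" by (simp add: cinner_self del: of_real_power)
    then show ?thesis by simp
  qed
  then obtain V where V: "V \<in> gauge_group \<A>" "V *v (c *s v) = w"
    using reflection_in_gauge_group[OF E, of "c *s v" w] v ci by (auto simp: mat_vec_smult)
  have "blockdiag (\<lambda>_. c) = cscale c (mat 1)"
    by (simp add: blockdiag_def flip: cscale_sum sum_J)
  then have "(V ** blockdiag (\<lambda>_. c)) *v v = w"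
    using V by (simp add: cscale_mult_vec mat_vec_smult)
  moreover have "V ** blockdiag (\<lambda>_. c) \<in> gauge_group \<A>"
    using V nc by (intro gauge_group_mult phases_in_gauge_group)
  ultimately show ?thesis by blast
qed

text \<open>The unitaries found on the separate blocks are glued together. Each commutes with its
  own projector, so the blocks do not interfere and the sum is again unitary.\<close>

lemma gauge_transitive:
  assumes "\<And>E. E \<in> J \<Longrightarrow> norm (E *v v) = norm (E *v w)"
  shows "\<exists>V\<in>gauge_group \<A>. V *v v = w"
proof -
  have "\<exists>V\<in>gauge_group \<A>. V *v (E *v v) = E *v w" if "E \<in> J" for E
    using that assms J_projector(2)[OF that]
    by (intro gauge_transitive_block[OF that]) (auto simp: matrix_vector_mul_assoc)
  then obtain U where U: "\<And>E. E \<in> J \<Longrightarrow> U E \<in> gauge_group \<A> \<and> U E *v (E *v v) = E *v w"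
    by metis
  have UE: "U E ** E = E ** U E" "U E ** dagger (U E) = mat 1" if "E \<in> J" for E
  proof -
    have g: "U E \<in> gauge_group \<A>" using U[OF that] by blast
    show "U E ** E = E ** U E" by (rule gauge_group_commutes_J[OF g that])
    show "U E ** dagger (U E) = mat 1" using g unfolding gauge_group_def unitary_def by blast
  qed
  define V where "V = (\<Sum>E\<in>J. U E ** E)"
  have EV: "E ** V = U E ** E" "V ** E = U E ** E" if E: "E \<in> J" for E
  proof -
    have "E ** V = (\<Sum>F\<in>J. if F = E then U E ** E else 0)"
      unfolding V_def mat_mult_sum_right
    proof (intro sum.cong refl)
      fix F assume F: "F \<in> J"
      have "E ** (U F ** F) = (E ** F) ** U F" by (simp add: UE(1)[OF F] matrix_mul_assoc)
      then show "E ** (U F ** F) = (if F = E then U E ** E else 0)"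
        using J_mult[OF E F] UE(1)[OF E] by auto
    qed
    then show "E ** V = U E ** E" using E finite_J by simp
    have "V ** E = (\<Sum>F\<in>J. if F = E then U E ** E else 0)"
      unfolding V_def mat_mult_sum_left
    proof (intro sum.cong refl)
      fix F assume F: "F \<in> J"
      have "(U F ** F) ** E = U F ** (F ** E)" by (simp only: matrix_mul_assoc)
      then show "(U F ** F) ** E = (if F = E then U E ** E else 0)"
        using J_mult[OF F E] by auto
    qed
    then show "V ** E = U E ** E" using E finite_J by simp
  qed
  have "V ** dagger V = mat 1"
  proof -
    have "E ** V ** dagger V = E" if E: "E \<in> J" for E
    proof -
      have "E ** V ** dagger V = U E ** (E ** dagger V)"
        by (simp only: EV(1)[OF E] matrix_mul_assoc)
      also have "E ** dagger V = dagger (V ** E)" using J_projector(1)[OF E] by (simp only: dagger_mult)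
      also have "\<dots> = E ** dagger (U E)" using J_projector(1)[OF E] unfolding EV(2)[OF E] by (simp only: dagger_mult)
      also have "U E ** (E ** dagger (U E)) = E ** (U E ** dagger (U E))"
        by (simp only: matrix_mul_assoc UE(1)[OF E])
      also have "\<dots> = E" by (simp add: UE(2)[OF E])
      finally show ?thesis .
    qed
    then have "(\<Sum>E\<in>J. E ** V ** dagger V) = mat 1" by (simp add: sum_J)
    then show ?thesis by (simp add: sum_J flip: mat_mult_sum_left)
  qed
  then have "unitary V" by (simp add: unitary_def matrix_left_right_inverse)
  then have "V \<in> gauge_group \<A>" by (rule gauge_groupI) (simp add: EV)
  moreover have "V *v v = w"
  proof -
    have "V *v v = (\<Sum>E\<in>J. E *v w)"
      using U by (simp add: V_def mat_sum_vec matrix_vector_mul_assoc[symmetric])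
    also have "\<dots> = w" by (simp add: sum_J flip: mat_sum_vec)
    finally show ?thesis .
  qed
  ultimately show ?thesis by blast
qed

end

section \<open>Tensor products\<close>

lemma prod_sum_UNIV:
  fixes f :: "'n::finite \<Rightarrow> 'b \<Rightarrow> 'c::comm_semiring_1"
  assumes "finite S"
  shows "(\<Prod>k\<in>UNIV. \<Sum>x\<in>S. f k x) = (\<Sum>e\<in>UNIV \<rightarrow> S. \<Prod>k\<in>UNIV. f k (e k))"
proof -
  have "PiE UNIV (\<lambda>_::'n. S) = (UNIV \<rightarrow> S)" by auto
  then show ?thesis using prod_sum_PiE[of "UNIV :: 'n set" "\<lambda>_. S" f] assms by simp
qed

lemma finite_funs: "finite S \<Longrightarrow> finite ((UNIV :: 'n::finite set) \<rightarrow> S)"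
  using finite_PiE[of "UNIV :: 'n set" "\<lambda>_. S"] by (simp add: PiE_def extensional_def)

lemma tensor_nth: "tensor A $ f $ g = (\<Prod>k\<in>UNIV. A k $ f k $ g k)"
  by (simp add: tensor_def)

lemma tensor_mult: "tensor A ** tensor B = tensor (\<lambda>k. A k ** B k)"
proof -
  have "(\<Sum>h\<in>UNIV. (\<Prod>k\<in>UNIV. A k $ f k $ h k) * (\<Prod>k\<in>UNIV. B k $ h k $ g k)) =
    (\<Prod>k\<in>UNIV. \<Sum>x\<in>UNIV. A k $ f k $ x * B k $ x $ g k)" for f g
    by (subst prod_sum_UNIV) (simp_all add: prod.distrib)
  then show ?thesis by (simp add: vec_eq_iff mat_mult_nth tensor_nth)
qed

lemma dagger_tensor: "dagger (tensor A) = tensor (\<lambda>k. dagger (A k))"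
  by (simp add: vec_eq_iff tensor_nth)

lemma trace_tensor: "trace (tensor A) = (\<Prod>k\<in>UNIV. trace (A k))"
  unfolding trace_def tensor_nth by (subst prod_sum_UNIV) simp_all

lemma tensor_mat_1: "tensor (\<lambda>_. mat 1) = mat 1"
proof -
  have "(\<Prod>k\<in>UNIV. if f k = g k then 1 else 0) = (if f = g then 1 else (0::complex))" for f g :: "'a \<Rightarrow> 'b"
    by (auto simp: fun_eq_iff intro!: prod_zero)
  then show ?thesis by (simp add: vec_eq_iff tensor_nth mat_def)
qed

lemma tensor_sum:
  assumes "finite S"
  shows "tensor (\<lambda>k. \<Sum>x\<in>S. F k x) = (\<Sum>e\<in>UNIV \<rightarrow> S. tensor (\<lambda>k. F k (e k)))"
  using assms by (simp add: vec_eq_iff tensor_nth prod_sum_UNIV)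

lemma tensor_cscale: "tensor (\<lambda>k. cscale (c k) (A k)) = cscale (\<Prod>k\<in>UNIV. c k) (tensor A)"
  by (simp add: vec_eq_iff tensor_nth prod.distrib)

text \<open>Factor each \<open>A k\<close> as \<open>dagger B ** B\<close>; the tensor product of
  such factorisations is again one.\<close>

lemma positive_op_tensor:
  assumes "\<And>k. positive_op (A k)"
  shows "positive_op (tensor A)"
proof -
  have "\<forall>k. \<exists>B. A k = dagger B ** B" using positive_op_sqrt[OF assms] ..
  from choice[OF this] obtain B where B: "\<And>k. A k = dagger (B k) ** B k" by blast
  have "tensor A = dagger (tensor B) ** tensor B"
    unfolding dagger_tensor tensor_mult by (simp flip: B)
  then show ?thesis by (simp add: positive_op_dagger_mult)
qed

lemma tensor_power_mult: "tensor_power A ** tensor_power B = tensor_power (A ** B)"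
  by (simp add: tensor_power_def tensor_mult)

lemma dagger_tensor_power: "dagger (tensor_power A) = tensor_power (dagger A)"
  by (simp add: tensor_power_def dagger_tensor)

lemma tensor_power_conjugate:
  "tensor_power (conjugate_by V X) = conjugate_by (tensor_power V) (tensor_power X)"
  by (simp add: conjugate_by_def dagger_tensor_power tensor_power_mult)

lemma unitary_tensor_power: "unitary V \<Longrightarrow> unitary (tensor_power V)"
  by (simp add: unitary_def dagger_tensor_power tensor_power_mult)
    (simp add: tensor_power_def tensor_mat_1)

lemma density_tensor_power: "\<rho> \<in> density_ops \<Longrightarrow> tensor_power \<rho> \<in> density_ops"
  by (simp add: density_ops_def tensor_power_def positive_op_tensor trace_tensor)

lemma trace_conjugate_by: "unitary V \<Longrightarrow> trace (conjugate_by V X) = trace X"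
  by (simp add: conjugate_by_def trace_cyclic3[of V] unitary_def)
    (metis matrix_mul_assoc matrix_mul_rid unitary_def)

lemma density_conjugate_by: "unitary V \<Longrightarrow> \<rho> \<in> density_ops \<Longrightarrow> conjugate_by V \<rho> \<in> density_ops"
  by (simp add: density_ops_def positive_op_conjugate_by trace_conjugate_by)

text \<open>Writing the state as \<open>dagger B ** B\<close>, the squared entries of
  \<open>B\<close> add up to the trace, so every column has norm at most one. The bound makes
  outcome probabilities integrable against the prior.\<close>

lemma density_ops_norm:
  assumes "\<rho> \<in> density_ops"
  shows "cmod (\<rho> $ i $ j) \<le> 1"
proof -
  have pos: "positive_op \<rho>" and tr: "trace \<rho> = 1" using assms by (auto simp: density_ops_def)
  obtain B where B: "\<rho> = dagger B ** B" using positive_op_sqrt[OF pos] by blast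
  have nB: "inner B B = 1" using tr by (simp add: inner_mat B)
  have col: "(\<Sum>k\<in>UNIV. (cmod (B $ k $ i))\<^sup>2) \<le> 1" for i
  proof -
    have "(\<Sum>k\<in>UNIV. (cmod (B $ k $ i))\<^sup>2) \<le> (\<Sum>k\<in>UNIV. \<Sum>j\<in>UNIV. (cmod (B $ k $ j))\<^sup>2)"
      by (intro sum_mono member_le_sum) auto
    also have "\<dots> = inner B B"
      by (simp add: inner_vec_def power2_norm_eq_inner)
    finally show ?thesis by (simp add: nB)
  qed
  have "cmod (\<rho> $ i $ j) \<le> (\<Sum>k\<in>UNIV. cmod (B $ k $ i) * cmod (B $ k $ j))"
    unfolding B mat_mult_nth
    by (rule order_trans[OF norm_sum]) (simp add: norm_mult)
  also have "\<dots> \<le> (\<Sum>k\<in>UNIV. ((cmod (B $ k $ i))\<^sup>2 + (cmod (B $ k $ j))\<^sup>2) / 2)"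
  proof (rule sum_mono)
    show "cmod (B $ k $ i) * cmod (B $ k $ j) \<le> ((cmod (B $ k $ i))\<^sup>2 + (cmod (B $ k $ j))\<^sup>2) / 2" for k
      using sum_squares_bound[of "cmod (B $ k $ i)" "cmod (B $ k $ j)"] by simp
  qed
  also have "\<dots> \<le> 1"
    using col[of i] col[of j] by (simp add: sum.distrib flip: sum_divide_distrib)
  finally show ?thesis .
qed

section \<open>Averaging over a group of isometries\<close>

text \<open>The point of smallest norm in the closed convex hull of an orbit is invariant. This makes
  integration over the Haar measure unnecessary.\<close>

lemma invariant_average_exists:
  fixes G :: "('a::euclidean_space \<Rightarrow> 'a) set"
  assumes ne: "id \<in> G" and comp: "\<And>g h. g \<in> G \<Longrightarrow> h \<in> G \<Longrightarrow> g \<circ> h \<in> G"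
    and lin: "\<And>g. g \<in> G \<Longrightarrow> linear g"
    and iso: "\<And>g x y. g \<in> G \<Longrightarrow> inner (g x) (g y) = inner x y"
  shows "\<exists>T. linear T \<and> (\<forall>x. \<forall>g\<in>G. g (T x) = T x) \<and>
    (\<forall>x. T x \<in> closure (convex hull ((\<lambda>g. g x) ` G)))"
proof -
  define K where "K x = closure (convex hull ((\<lambda>g. g x) ` G))" for x
  define T where "T x = closest_point (K x) 0" for x
  have K: "closed (K x)" "convex (K x)" "K x \<noteq> {}" for x
    using ne by (auto simp: K_def intro: convex_closure)
  have TK: "T x \<in> K x" for x unfolding T_def using K by (intro closest_point_in_set)
  have Kmin: "K x \<subseteq> S" if "closed S" "convex S" "\<And>g. g \<in> G \<Longrightarrow> g x \<in> S" for x S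
    unfolding K_def using that by (intro closure_minimal hull_minimal) auto
  have inv: "g (T x) = T x" if g: "g \<in> G" for g x
  proof -
    \<comment> \<open>The aim is that \<open>g\<close> maps \<open>K x\<close> into itself. As it
      preserves the norm, \<open>g (T x)\<close> is then another point closest to 0, and uniqueness
      applies.\<close>
    have "closed (g -` K x)"
      using linear_continuous_on[of g UNIV] lin[OF g] K
      by (intro continuous_closed_vimage) (auto simp: linear_conv_bounded_linear continuous_on_eq_continuous_at)
    moreover have "convex (g -` K x)" using lin[OF g] K by (intro convex_linear_vimage)
    moreover have "h x \<in> g -` K x" if "h \<in> G" for h
    proof -
      have "g (h x) \<in> (\<lambda>g. g x) ` G" using comp[OF g that] by (intro image_eqI[of _ _ "g \<circ> h"]) auto
      then show ?thesis unfolding K_def by (intro vimageI2 subsetD[OF closure_subset] hull_inc)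
    qed
    ultimately have "K x \<subseteq> g -` K x" by (rule Kmin)
    then have "g (T x) \<in> K x" using TK by auto
    moreover have "dist 0 (g (T x)) = dist 0 (T x)"
      using iso[OF g, of "T x" "T x"] by (simp add: norm_eq_sqrt_inner)
    moreover have "dist 0 (T x) \<le> dist 0 z" if "z \<in> K x" for z
      unfolding T_def by (rule closest_point_le[OF K(1) that])
    ultimately have "g (T x) = closest_point (K x) 0"
      by (intro closest_point_unique[OF K(2,1)]) auto
    then show ?thesis by (simp only: T_def)
  qed
  \<comment> \<open>Closest points do not depend linearly on the set, but this identity together
    with invariance identifies \<open>T\<close> as the orthogonal projection onto the fixed vectors,
    whence linearity.\<close>
  have proj: "inner (T x) f = inner x f" if f: "\<forall>g\<in>G. g f = f" for x f
  proof -
    have "g x \<in> {y. inner f y = inner f x}" if "g \<in> G" for g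
      using iso[OF that, of f x] bspec[OF f that] by simp
    then have "K x \<subseteq> {y. inner f y = inner f x}"
      by (intro Kmin closed_hyperplane convex_hyperplane)
    then show ?thesis using TK[of x] by (auto simp: inner_commute)
  qed
  have uniq: "y = T x" if y: "\<forall>g\<in>G. g y = y" "\<And>f. \<forall>g\<in>G. g f = f \<Longrightarrow> inner y f = inner x f" for x y
  proof -
    have invd: "\<forall>g\<in>G. g (y - T x) = y - T x"
    proof
      fix g assume g: "g \<in> G"
      show "g (y - T x) = y - T x"
        by (simp only: linear_diff[OF lin[OF g]] bspec[OF y(1) g] inv[OF g])
    qed
    have "inner (y - T x) (y - T x) = 0"
      using y(2)[OF invd] proj[OF invd, of x] by (simp add: inner_diff_left)
    then show ?thesis by simp
  qed
  have "linear T"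
  proof (rule linearI)
    show "T (x + y) = T x + T y" for x y
    proof (rule uniq[symmetric])
      show "\<forall>g\<in>G. g (T x + T y) = T x + T y"
        by (auto simp only: linear_add[OF lin] inv)
    qed (simp add: inner_add_left proj)
    show "T (c *\<^sub>R x) = c *\<^sub>R T x" for c x
    proof (rule uniq[symmetric])
      show "\<forall>g\<in>G. g (c *\<^sub>R T x) = c *\<^sub>R T x"
        by (auto simp only: linear_scale[OF lin] inv)
    qed (simp add: proj)
  qed
  then show ?thesis using inv TK unfolding K_def by blast
qed

section \<open>Channels\<close>

lemma channel_complex_linear: "quantum_channel \<Phi> \<Longrightarrow> complex_linear \<Phi>"
  by (simp add: quantum_channel_def)

lemma complex_linear_imp_linear: "complex_linear \<Phi> \<Longrightarrow> linear \<Phi>"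
  by (simp add: complex_linear_def linear_iff scaleR_eq_cscale)

lemma complex_linear_sum: "complex_linear \<Phi> \<Longrightarrow> \<Phi> (\<Sum>x\<in>S. f x) = (\<Sum>x\<in>S. \<Phi> (f x))"
  by (rule linear_sum[OF complex_linear_imp_linear])

lemma channel_positive:
  assumes "quantum_channel \<Phi>" "positive_op X"
  shows "positive_op (\<Phi> X)"
proof -
  have eq: "positive_block_op 1 (\<lambda>_ _. Y) \<longleftrightarrow> positive_op Y" for Y :: "'a cmat"
    by (auto simp: positive_block_op_def positive_op_def)
  have "positive_block_op 1 (\<lambda>_ _. X)" using assms(2) by (simp only: eq)
  then have "positive_block_op 1 (\<lambda>_ _. \<Phi> X)"
    using assms(1) by (auto simp: quantum_channel_def completely_positive_def)
  then show ?thesis by (simp only: eq)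
qed

lemma channel_density: "quantum_channel \<Phi> \<Longrightarrow> \<rho> \<in> density_ops \<Longrightarrow> \<Phi> \<rho> \<in> density_ops"
  using channel_positive by (auto simp: density_ops_def quantum_channel_def)

lemma trace_mult_eqI:
  fixes A B :: "'a::finite cmat"
  assumes "\<And>Y. trace (A ** Y) = trace (B ** Y)"
  shows "A = B"
proof -
  have "trace ((A - B) ** dagger (A - B)) = 0"
    using assms by (simp add: mat_mult_diff_left trace_sub)
  then have "inner (dagger (A - B)) (dagger (A - B)) = 0"
    by (simp add: inner_mat)
  then have "dagger (dagger (A - B)) = dagger 0" by simp
  then show ?thesis by simp
qed

text \<open>The Heisenberg picture of \<open>\<Phi>\<close>, with respect to the bilinear trace
  pairing; pairing with matrix units reads off the entries of the adjoint.\<close>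

lemma trace_adjoint_exists:
  fixes \<Phi> :: "'a::finite cmat \<Rightarrow> 'a cmat"
  assumes "complex_linear \<Phi>"
  shows "\<exists>\<Phi>'. linear \<Phi>' \<and> (\<forall>M Y. trace (M ** \<Phi> Y) = trace (\<Phi>' M ** Y))"
proof -
  define u :: "'a \<Rightarrow> 'a \<Rightarrow> 'a cmat" where "u i j = (\<chi> a b. if a = i \<and> b = j then 1 else 0)" for i j
  define \<Phi>' :: "'a cmat \<Rightarrow> 'a cmat" where "\<Phi>' M = (\<chi> i j. trace (M ** \<Phi> (u j i)))" for M
  have "linear \<Phi>'"
    by (auto simp: linear_iff \<Phi>'_def vec_eq_iff mat_mult_add_left trace_add mat_mult_scaleR trace_scaleR)
      (simp add: scaleR_conv_of_real)
  moreover have "trace (M ** \<Phi> Y) = trace (\<Phi>' M ** Y)" for M Y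
  proof -
    have "Y = (\<Sum>j\<in>UNIV. \<Sum>i\<in>UNIV. cscale (Y $ j $ i) (u j i))"
    proof -
      have "(\<Sum>j\<in>UNIV. \<Sum>i\<in>UNIV. Y $ j $ i * (if a = j \<and> b = i then 1 else 0)) =
        (\<Sum>j\<in>UNIV. if a = j then Y $ j $ b else 0)" for a b
        by (intro sum.cong refl) (auto simp: if_distrib cong: if_cong)
      then show ?thesis by (simp add: vec_eq_iff u_def)
    qed
    then have "\<Phi> Y = \<Phi> (\<Sum>j\<in>UNIV. \<Sum>i\<in>UNIV. cscale (Y $ j $ i) (u j i))" by simp
    also have "\<dots> = (\<Sum>j\<in>UNIV. \<Sum>i\<in>UNIV. cscale (Y $ j $ i) (\<Phi> (u j i)))"
      using assms by (simp add: complex_linear_sum) (simp add: complex_linear_def)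
    finally have "trace (M ** \<Phi> Y) = (\<Sum>j\<in>UNIV. \<Sum>i\<in>UNIV. Y $ j $ i * trace (M ** \<Phi> (u j i)))"
      by (simp add: mat_mult_sum_right trace_sum trace_cscale)
    also have "\<dots> = (\<Sum>i\<in>UNIV. \<Sum>j\<in>UNIV. Y $ j $ i * trace (M ** \<Phi> (u j i)))"
      by (rule sum.swap)
    also have "\<dots> = trace (\<Phi>' M ** Y)"
      unfolding trace_def[of "\<Phi>' M ** Y"] mat_mult_nth[of "\<Phi>' M"] by (simp add: \<Phi>'_def mult.commute)
    finally show ?thesis .
  qed
  ultimately show ?thesis by blast
qed

text \<open>\<open>noiseless_on\<close> speaks of normalised states, whereas compressions such as
  \<open>E ** X ** E\<close> need not have trace one.\<close>

lemma noiseless_on_positive: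
  assumes N: "quantum_channel \<N>" "noiseless_on \<N> \<A>" and R: "R \<in> \<A>" and X: "positive_op X"
  shows "trace (R ** \<N> X) = trace (R ** X)"
proof (cases "X = 0")
  case True
  then show ?thesis
    using linear_0[OF complex_linear_imp_linear[OF channel_complex_linear[OF N(1)]]] by simp
next
  case False
  define t where "t = Re (trace X)"
  have t0: "0 \<le> t" and tr: "trace X = complex_of_real t"
    using trace_mult_positive[OF X, of "mat 1"] by (auto simp: t_def complex_eq_iff positive_op_iff cinner_self)
  have "t \<noteq> 0" using positive_op_trace_0[OF X] False tr by auto
  define \<rho> where "\<rho> = (1 / t) *\<^sub>R X"
  have "\<rho> \<in> density_ops"
    using t0 \<open>t \<noteq> 0\<close> X by (simp add: \<rho>_def density_ops_def trace_scaleR tr positive_op_scaleR)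
  then have *: "trace (R ** \<N> \<rho>) = trace (R ** \<rho>)" using N R by (simp add: noiseless_on_def)
  have "X = t *\<^sub>R \<rho>" using \<open>t \<noteq> 0\<close> by (simp add: \<rho>_def)
  moreover have "\<N> (t *\<^sub>R \<rho>) = t *\<^sub>R \<N> \<rho>"
    by (rule linear_scale[OF complex_linear_imp_linear[OF channel_complex_linear[OF N(1)]]])
  ultimately show ?thesis using * by (simp add: mat_mult_scaleR trace_scaleR)
qed

context generated_algebra
begin

text \<open>\<open>E ** X ** E'\<close> is an eigenvector of conjugation by the phase unitary, and a
  covariant map preserves the eigenvalue. Output blocks with another eigenvalue must vanish.\<close>

lemma covariant_block:
  assumes N: "complex_linear \<N>" "covariant_under \<N> (gauge_group \<A>)"
    and J: "E \<in> J" "E' \<in> J" "F \<in> J" "F' \<in> J" and z: "\<And>E. E \<in> J \<Longrightarrow> cmod (z E) = 1"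
    and ne: "z F * cnj (z F') \<noteq> z E * cnj (z E')"
  shows "F ** \<N> (E ** X ** E') ** F' = 0"
proof -
  define U where "U = blockdiag z"
  define Y where "Y = \<N> (E ** X ** E')"
  have "U \<in> gauge_group \<A>" unfolding U_def using z by (rule phases_in_gauge_group)
  then have "\<N> (conjugate_by U (E ** X ** E')) = conjugate_by U Y"
    using N(2) by (simp add: covariant_under_def Y_def)
  moreover have "conjugate_by U (E ** X ** E') = cscale (z E * cnj (z E')) (E ** X ** E')"
  proof -
    have "conjugate_by U (E ** X ** E') = (U ** E) ** X ** (E' ** dagger U)"
      by (simp only: conjugate_by_def matrix_mul_assoc)
    then show ?thesis
      using J by (simp add: U_def dagger_blockdiag J_mult_blockdiag mult.commute)
  qed
  ultimately have eq: "conjugate_by U Y = cscale (z E * cnj (z E')) Y"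
    using N(1) by (simp add: complex_linear_def Y_def)
  have "F ** conjugate_by U Y ** F' = (F ** U) ** Y ** (dagger U ** F')"
    by (simp only: conjugate_by_def matrix_mul_assoc)
  also have "\<dots> = cscale (z F * cnj (z F')) (F ** Y ** F')"
    using J by (simp add: U_def dagger_blockdiag J_mult_blockdiag mult.commute)
  finally have "cscale (z E * cnj (z E')) (F ** Y ** F') = cscale (z F * cnj (z F')) (F ** Y ** F')"
    using eq by simp
  then show ?thesis using ne by (simp add: vec_eq_iff Y_def)
qed

text \<open>A phase on one projector excludes every transfer except one from a diagonal block to
  another diagonal block. There noiselessness gives the output block trace zero, and it is
  positive.\<close>

lemma channel_block:
  assumes N: "quantum_channel \<N>" "noiseless_on \<N> \<A>" "covariant_under \<N> (gauge_group \<A>)"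
    and X: "positive_op X" and J: "E \<in> J" "E' \<in> J" "F \<in> J" "F' \<in> J" and ne: "(F, F') \<noteq> (E, E')"
  shows "F ** \<N> (E ** X ** E') ** F' = 0"
proof -
  \<comment> \<open>The phase is i rather than -1 because a sign would not distinguish the pair
    \<open>(E, E')\<close> from its transpose; here the eigenvalues are i and -i.\<close>
  define ph :: "'a cmat \<Rightarrow> 'a cmat \<Rightarrow> complex" where "ph G = (\<lambda>H. if H = G then \<i> else 1)" for G
  have ph: "cmod (ph G H) = 1" for G H by (simp add: ph_def)
  note block = covariant_block[OF channel_complex_linear[OF N(1)] N(3) J]
  have ii: "\<i> \<noteq> 1" "- \<i> \<noteq> 1" "\<i> \<noteq> -\<i>" "1 \<noteq> - \<i>" "-\<i> \<noteq> \<i>" by (auto simp: complex_eq_iff)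
  show ?thesis
  proof (cases "E = E'")
    case EE: True
    show ?thesis
    proof (cases "F = F'")
      case False
      show ?thesis
        by (rule block[of "ph F"]) (use EE False ii in \<open>auto simp: ph_def\<close>)
    next
      case True
      then have "F \<noteq> E" using ne EE by auto
      have pos: "positive_op (E ** X ** E)"
        using positive_op_sandwich[OF X, of E] J_projector(1)[OF J(1)] by simp
      define Y where "Y = F ** \<N> (E ** X ** E) ** F"
      have "positive_op Y"
        unfolding Y_def
        using positive_op_sandwich[OF channel_positive[OF N(1) pos], of F] J_projector(1)[OF J(3)] by simp
      moreover have "trace Y = 0"
      proof -
        have "trace Y = trace (F ** F ** \<N> (E ** X ** E))"
          unfolding Y_def by (metis trace_cyclic3 trace_mul_sym matrix_mul_assoc)
        also have "\<dots> = trace (F ** \<N> (E ** X ** E))" using J J_projector(2) by simp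
        also have "\<dots> = trace (F ** (E ** X ** E))"
          by (rule noiseless_on_positive[OF N(1,2) J_in_alg[OF J(3)] pos])
        also have "F ** (E ** X ** E) = (F ** E) ** X ** E" by (simp only: matrix_mul_assoc)
        also have "\<dots> = 0" using J_orthogonal[OF J(3,1) \<open>F \<noteq> E\<close>] by simp
        finally show ?thesis by simp
      qed
      ultimately have "Y = 0" by (rule positive_op_trace_0)
      then show ?thesis using EE True by (simp add: Y_def)
    qed
  next
    case EE: False
    show ?thesis
    proof (cases "F = E")
      case False
      show ?thesis
        by (rule block[of "ph E"]) (use EE False ii in \<open>auto simp: ph_def\<close>)
    next
      case True
      then have "F' \<noteq> E'" using ne by auto
      show ?thesis
        by (rule block[of "ph E'"]) (use EE True \<open>F' \<noteq> E'\<close> ii in \<open>auto simp: ph_def\<close>)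
    qed
  qed
qed

lemma double_resolution: "(\<Sum>E\<in>J. \<Sum>F\<in>J. E ** X ** F) = X"
  by (simp add: sum_J flip: mat_mult_sum_right mat_mult_sum_left)

text \<open>Both sides equal \<open>E ** \<N> (E ** X ** E') ** E'\<close>: on one side only this
  input block reaches the chosen output block, on the other the output has no further
  blocks.\<close>

lemma channel_compress:
  assumes N: "quantum_channel \<N>" "noiseless_on \<N> \<A>" "covariant_under \<N> (gauge_group \<A>)"
    and X: "positive_op X" and J: "E \<in> J" "E' \<in> J"
  shows "\<N> (E ** X ** E') = E ** \<N> X ** E'"
proof -
  have "X = (\<Sum>F\<in>J. \<Sum>F'\<in>J. F ** X ** F')" by (simp add: double_resolution)
  then have "\<N> X = \<N> (\<Sum>F\<in>J. \<Sum>F'\<in>J. F ** X ** F')" by simp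
  also have "\<dots> = (\<Sum>F\<in>J. \<Sum>F'\<in>J. \<N> (F ** X ** F'))"
    by (simp add: complex_linear_sum[OF channel_complex_linear[OF N(1)]])
  finally have "E ** \<N> X ** E' = (\<Sum>F\<in>J. \<Sum>F'\<in>J. E ** \<N> (F ** X ** F') ** E')"
    by (simp add: mat_mult_sum_left mat_mult_sum_right)
  also have "\<dots> = (\<Sum>F\<in>J. \<Sum>F'\<in>J. if F' = E' then (if F = E then E ** \<N> (E ** X ** E') ** E' else 0) else 0)"
    by (intro sum.cong refl) (use channel_block[OF N X _ _ J] in auto)
  also have "\<dots> = E ** \<N> (E ** X ** E') ** E'"
    using finite_J J by simp
  finally have 1: "E ** \<N> X ** E' = E ** \<N> (E ** X ** E') ** E'" .
  have "\<N> (E ** X ** E') = (\<Sum>F\<in>J. \<Sum>F'\<in>J. F ** \<N> (E ** X ** E') ** F')"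
    by (simp add: double_resolution)
  also have "\<dots> = (\<Sum>F\<in>J. \<Sum>F'\<in>J. if F' = E' then (if F = E then E ** \<N> (E ** X ** E') ** E' else 0) else 0)"
    by (intro sum.cong refl) (use channel_block[OF N X J] in auto)
  also have "\<dots> = E ** \<N> (E ** X ** E') ** E'"
    using finite_J J by simp
  finally show ?thesis using 1 by simp
qed

text \<open>Covariance covers unimodular weights only. Commuting with compression to each pair of
  blocks extends it to all weights by linearity.\<close>

lemma channel_blockdiag:
  assumes N: "quantum_channel \<N>" "noiseless_on \<N> \<A>" "covariant_under \<N> (gauge_group \<A>)"
    and X: "positive_op X"
  shows "\<N> (conjugate_by (blockdiag w) X) = conjugate_by (blockdiag w) (\<N> X)"
proof -
  have expand: "conjugate_by (blockdiag w) Y = (\<Sum>E\<in>J. \<Sum>F\<in>J. cscale (w E * cnj (w F)) (E ** Y ** F))" for Y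
  proof -
    have "conjugate_by (blockdiag w) Y = (\<Sum>E\<in>J. cscale (w E) E) ** Y ** (\<Sum>F\<in>J. cscale (cnj (w F)) F)"
      by (simp add: conjugate_by_def dagger_blockdiag) (simp add: blockdiag_def)
    also have "\<dots> = (\<Sum>F\<in>J. \<Sum>E\<in>J. cscale (w E * cnj (w F)) (E ** Y ** F))"
      by (simp add: mat_mult_sum_left mat_mult_sum_right cscale_sum mult.commute)
    finally show ?thesis by (subst sum.swap)
  qed
  have "\<N> (conjugate_by (blockdiag w) X) = (\<Sum>E\<in>J. \<Sum>F\<in>J. cscale (w E * cnj (w F)) (\<N> (E ** X ** F)))"
    using channel_complex_linear[OF N(1)]
    by (simp add: expand complex_linear_sum) (simp add: complex_linear_def)
  then show ?thesis
    by (simp add: expand channel_compress[OF N X])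
qed

end

section \<open>Twirling over the gauge group\<close>

lemma trace_conjugate_conjugate:
  assumes "unitary V"
  shows "trace (conjugate_by V X ** conjugate_by V Y) = trace (X ** Y)"
proof -
  have "conjugate_by V X ** conjugate_by V Y = V ** X ** (dagger V ** V) ** Y ** dagger V"
    by (simp only: conjugate_by_def matrix_mul_assoc)
  also have "\<dots> = conjugate_by V (X ** Y)"
    using assms by (simp add: unitary_def conjugate_by_def matrix_mul_assoc)
  finally show ?thesis by (simp add: trace_conjugate_by[OF assms])
qed

lemma dagger_conjugate_by: "dagger (conjugate_by V X) = conjugate_by V (dagger X)"
  by (simp add: conjugate_by_def dagger_mult matrix_mul_assoc)

lemma inner_conjugate_by:
  "unitary V \<Longrightarrow> inner (conjugate_by V X) (conjugate_by V Y) = inner X Y"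
  by (simp add: inner_mat dagger_conjugate_by trace_conjugate_conjugate)

lemma linear_conjugate_by: "linear (conjugate_by V)"
  by (simp add: linear_iff conjugate_by_def matrix_add_ldistrib mat_mult_add_left mat_mult_scaleR)

lemma conjugate_by_mult: "conjugate_by V (conjugate_by W X) = conjugate_by (V ** W) X"
  by (simp only: conjugate_by_def dagger_mult matrix_mul_assoc)

lemma closed_positive_op: "closed {A. positive_op A}"
proof -
  have "continuous_on UNIV (\<lambda>A. cinner v (A *v v))" for v :: "complex^'a"
    unfolding cinner_def mat_vec_nth by (intro continuous_intros)
  then have "closed {A. Im (cinner v (A *v v)) = 0 \<and> 0 \<le> Re (cinner v (A *v v))}" for v :: "complex^'a"
    by (intro closed_Collect_conj closed_Collect_eq closed_Collect_le continuous_on_Re continuous_on_Im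
        continuous_on_const)
  then show ?thesis
    unfolding positive_op_iff by (intro closed_Collect_all)
qed

lemma convex_positive_op: "convex {A. positive_op A}"
  by (simp add: convex_def positive_op_add positive_op_scaleR)

lemma tensor_power_mat_1: "tensor_power (mat 1) = mat 1"
  by (simp add: tensor_power_def tensor_mat_1)

lemma twirl_exists:
  fixes \<A> :: "'d::finite cmat set"
  shows "\<exists>T :: ('n::finite \<Rightarrow> 'd) cmat \<Rightarrow> ('n \<Rightarrow> 'd) cmat. linear T \<and>
    (\<forall>X. \<forall>V\<in>gauge_group \<A>. conjugate_by (tensor_power V) (T X) = T X) \<and>
    (\<forall>X. T X \<in> closure (convex hull ((\<lambda>V. conjugate_by (tensor_power V) X) ` gauge_group \<A>)))"
proof -
  define G :: "(('n \<Rightarrow> 'd) cmat \<Rightarrow> ('n \<Rightarrow> 'd) cmat) set"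
    where "G = (\<lambda>V. conjugate_by (tensor_power V)) ` gauge_group \<A>"
  have "\<exists>T. linear T \<and> (\<forall>x. \<forall>g\<in>G. g (T x) = T x) \<and>
    (\<forall>x. T x \<in> closure (convex hull ((\<lambda>g. g x) ` G)))"
  proof (rule invariant_average_exists)
    have "id = conjugate_by (tensor_power (mat 1) :: ('n \<Rightarrow> 'd) cmat)"
      by (simp add: fun_eq_iff conjugate_by_def tensor_power_mat_1)
    then show "id \<in> G" unfolding G_def using mat_1_in_gauge_group by blast
    show "g \<circ> h \<in> G" if gh: "g \<in> G" "h \<in> G" for g h
    proof -
      obtain V W where V: "V \<in> gauge_group \<A>" "g = conjugate_by (tensor_power V)"
        and W: "W \<in> gauge_group \<A>" "h = conjugate_by (tensor_power W)"
        using gh by (auto simp: G_def)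
      have "g \<circ> h = conjugate_by (tensor_power (V ** W))"
        by (simp add: fun_eq_iff V W conjugate_by_mult tensor_power_mult)
      then show ?thesis using gauge_group_mult[OF V(1) W(1)] by (simp add: G_def)
    qed
    show "linear g" if "g \<in> G" for g using that by (auto simp: G_def linear_conjugate_by)
    show "inner (g x) (g y) = inner x y" if "g \<in> G" for g x y
      using that by (auto simp: G_def gauge_group_def intro!: inner_conjugate_by unitary_tensor_power)
  qed
  then show ?thesis by (simp add: G_def image_image)
qed

section \<open>Type classes of outcome strings\<close>

text \<open>As \<open>q\<close> is constant on the fibres of \<open>c\<close>, averaging
  \<open>g\<close> over each fibre leaves the weighted sum unchanged. This is how coefficients of
  unclear sign get replaced by type averages.\<close>

lemma sum_class_average:
  fixes q g :: "'b \<Rightarrow> real"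
  assumes "finite S" and q: "\<And>e f. e \<in> S \<Longrightarrow> f \<in> S \<Longrightarrow> c e = c f \<Longrightarrow> q e = q f"
  shows "(\<Sum>e\<in>S. q e * g e) =
    (\<Sum>e\<in>S. q e * ((\<Sum>f\<in>{f\<in>S. c f = c e}. g f) / card {f\<in>S. c f = c e}))"
proof -
  define N where "N e = real (card {f\<in>S. c f = c e})" for e
  have N: "N e \<noteq> 0" if "e \<in> S" for e using that assms(1) by (auto simp: N_def card_eq_0_iff)
  have "(\<Sum>e\<in>S. q e * ((\<Sum>f\<in>{f\<in>S. c f = c e}. g f) / N e)) =
    (\<Sum>e\<in>S. \<Sum>f\<in>S. if c f = c e then q e * g f / N e else 0)"
    using assms(1) by (simp add: sum.inter_filter sum_distrib_left sum_divide_distrib)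
      (intro sum.cong refl, simp)
  also have "\<dots> = (\<Sum>f\<in>S. \<Sum>e\<in>S. if c f = c e then q e * g f / N e else 0)"
    by (rule sum.swap)
  also have "\<dots> = (\<Sum>f\<in>S. \<Sum>e\<in>S. if c e = c f then q f * g f / N f else 0)"
    by (intro sum.cong refl) (auto simp: N_def intro: q)
  also have "\<dots> = (\<Sum>f\<in>S. N f * (q f * g f / N f))"
    using assms(1) by (simp add: N_def flip: sum.inter_filter)
  also have "\<dots> = (\<Sum>f\<in>S. q f * g f)" using N by simp
  finally show ?thesis by (simp add: N_def)
qed

text \<open>The type of a string: two strings share it exactly when one is a rearrangement of the
  other.\<close>

definition multiplicities :: "('n::finite \<Rightarrow> 'b) \<Rightarrow> 'b \<Rightarrow> nat" where
  "multiplicities e x = card {k. e k = x}"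

lemma prod_eq_if_multiplicities_eq:
  fixes w :: "'b \<Rightarrow> 'c::comm_monoid_mult" and e f :: "'n::finite \<Rightarrow> 'b"
  assumes "multiplicities e = multiplicities f" "range e \<subseteq> S" "range f \<subseteq> S" "finite S"
  shows "(\<Prod>k\<in>UNIV. w (e k)) = (\<Prod>k\<in>UNIV. w (f k))"
proof -
  have *: "(\<Prod>k\<in>UNIV. w (e k)) = (\<Prod>x\<in>S. w x ^ multiplicities e x)" if "range e \<subseteq> S" for e :: "'n \<Rightarrow> 'b"
  proof -
    have "(\<Prod>x\<in>S. \<Prod>k\<in>{k\<in>UNIV. e k = x}. w (e k)) = (\<Prod>k\<in>UNIV. w (e k))"
      using that assms(4) by (intro prod.group) auto
    then show ?thesis by (simp add: multiplicities_def)
  qed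
  show ?thesis using *[OF assms(2)] *[OF assms(3)] assms(1) by simp
qed

context generated_algebra
begin

lemma strings_mult:
  fixes e f :: "'n::finite \<Rightarrow> 'a cmat"
  assumes "e \<in> UNIV \<rightarrow> J" "f \<in> UNIV \<rightarrow> J"
  shows "tensor e ** tensor f = (if e = f then tensor e else 0)"
proof (cases "e = f")
  case True
  then show ?thesis using assms J_projector(2) by (simp add: tensor_mult Pi_def)
next
  case False
  then obtain k where "e k \<noteq> f k" by auto
  then have "e k ** f k = 0" using assms by (intro J_orthogonal) auto
  then have "\<exists>k. (e k ** f k) $ a k $ b k = 0" for a b by (intro exI[of _ k]) simp
  then have "(\<Prod>k\<in>UNIV. (e k ** f k) $ a k $ b k) = 0" for a b
    by (intro prod_zero) auto
  then show ?thesis using False by (simp add: tensor_mult vec_eq_iff tensor_nth)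
qed

lemma dagger_string: "e \<in> UNIV \<rightarrow> J \<Longrightarrow> dagger (tensor e) = tensor e"
  by (simp add: dagger_tensor J_projector Pi_def)

lemma sum_strings: "(\<Sum>e\<in>UNIV \<rightarrow> J. tensor e) = mat 1"
  using tensor_sum[OF finite_J, of "\<lambda>_ E. E"] unfolding sum_J tensor_mat_1 by (rule sym)

lemma finite_strings: "finite ((UNIV :: 'n::finite set) \<rightarrow> J)"
  using finite_J by (rule finite_funs)

lemma string_mult_blockdiag:
  assumes "e \<in> UNIV \<rightarrow> J"
  shows "tensor e ** tensor_power (blockdiag z) = cscale (\<Prod>k\<in>UNIV. z (e k)) (tensor e)"
    "tensor_power (blockdiag z) ** tensor e = cscale (\<Prod>k\<in>UNIV. z (e k)) (tensor e)"
proof -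
  have "(\<lambda>k. e k ** blockdiag z) = (\<lambda>k. cscale (z (e k)) (e k))"
    "(\<lambda>k. blockdiag z ** e k) = (\<lambda>k. cscale (z (e k)) (e k))"
    using assms by (auto simp: fun_eq_iff J_mult_blockdiag Pi_def)
  then show "tensor e ** tensor_power (blockdiag z) = cscale (\<Prod>k\<in>UNIV. z (e k)) (tensor e)"
    "tensor_power (blockdiag z) ** tensor e = cscale (\<Prod>k\<in>UNIV. z (e k)) (tensor e)"
    by (simp_all add: tensor_power_def tensor_mult tensor_cscale)
qed

lemma invariant_between_types:
  fixes e f :: "'n::finite \<Rightarrow> 'a cmat"
  assumes Y: "\<And>V. V \<in> gauge_group \<A> \<Longrightarrow> conjugate_by (tensor_power V) Y = Y"
    and e: "e \<in> UNIV \<rightarrow> J" "f \<in> UNIV \<rightarrow> J" and ne: "multiplicities e \<noteq> multiplicities f"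
  shows "tensor e ** Y ** tensor f = 0"
proof -
  obtain E where E: "multiplicities e E \<noteq> multiplicities f E" using ne by auto
  \<comment> \<open>Multiplicities run from 0 to n, so the angles \<open>m * t\<close> stay between
    0 and pi, where \<open>Arg\<close> recovers them. A phase on the single projector
    \<open>E\<close> thus separates the two types.\<close>
  define t where "t = pi / (real CARD('n) + 1)"
  define z where "z H = (if H = E then cis t else 1)" for H
  have zprod: "(\<Prod>k\<in>UNIV. z (g k)) = cis (real (multiplicities g E) * t)" for g :: "'n \<Rightarrow> 'a cmat"
    by (simp add: z_def prod.If_cases multiplicities_def Complex.DeMoivre)
  have bound: "real (multiplicities g E) * t \<in> {-pi<..pi}" for g :: "'n \<Rightarrow> 'a cmat"
  proof -
    have "multiplicities g E \<le> CARD('n)"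
      unfolding multiplicities_def by (intro card_mono) auto
    then have "real (multiplicities g E) * t \<le> (real CARD('n) + 1) * t"
      by (intro mult_right_mono) (auto simp: t_def)
    also have "\<dots> = pi" by (simp add: t_def)
    finally have "real (multiplicities g E) * t \<le> pi" .
    moreover have "0 \<le> real (multiplicities g E) * t" by (simp add: t_def)
    ultimately show ?thesis using less_le_trans[of "- pi" 0] by auto
  qed
  define \<alpha> where "\<alpha> = cis (real (multiplicities e E) * t)"
  define \<beta> where "\<beta> = cis (real (multiplicities f E) * t)"
  have "t > 0" by (simp add: t_def)
  have "\<alpha> \<noteq> \<beta>"
  proof
    assume "\<alpha> = \<beta>"
    then have "Arg \<alpha> = Arg \<beta>" by simp
    then show False using E \<open>t > 0\<close> Arg_cis[OF bound] by (simp add: \<alpha>_def \<beta>_def)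
  qed
  have "blockdiag z \<in> gauge_group \<A>"
    by (rule phases_in_gauge_group) (simp add: z_def)
  from Y[OF this] have "tensor e ** Y ** tensor f =
      (tensor e ** tensor_power (blockdiag z)) ** Y ** (tensor_power (blockdiag (\<lambda>E. cnj (z E))) ** tensor f)"
    by (simp add: conjugate_by_def dagger_tensor_power dagger_blockdiag)
      (metis matrix_mul_assoc)
  also have "\<dots> = cscale (\<alpha> * cnj \<beta>) (tensor e ** Y ** tensor f)"
    using e by (simp add: string_mult_blockdiag zprod \<alpha>_def \<beta>_def mult.commute flip: cnj_prod)
  finally have "tensor e ** Y ** tensor f = cscale (\<alpha> * cnj \<beta>) (tensor e ** Y ** tensor f)" .
  moreover have "\<alpha> * cnj \<beta> \<noteq> 1"
  proof
    assume *: "\<alpha> * cnj \<beta> = 1"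
    have "\<alpha> = \<alpha> * (cnj \<beta> * \<beta>)" by (simp add: \<beta>_def cis_cnj cis_mult)
    also have "\<dots> = \<beta>" using * by (simp flip: mult.assoc)
    finally show False using \<open>\<alpha> \<noteq> \<beta>\<close> by simp
  qed
  ultimately show ?thesis by (simp add: vec_eq_iff)
qed

lemma trace_strings_expand:
  fixes Y S :: "('n::finite \<Rightarrow> 'a) cmat"
  shows "trace (Y ** S) = (\<Sum>e\<in>UNIV \<rightarrow> J. \<Sum>f\<in>UNIV \<rightarrow> J. trace (tensor f ** Y ** tensor e ** S))"
proof -
  have "(\<Sum>e\<in>UNIV \<rightarrow> J. \<Sum>f\<in>UNIV \<rightarrow> J. trace (tensor f ** Y ** tensor e ** S))
    = trace ((\<Sum>f\<in>UNIV \<rightarrow> J. tensor f) ** Y ** (\<Sum>e\<in>UNIV \<rightarrow> J. tensor e) ** S)"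
    by (simp add: trace_sum mat_mult_sum_left mat_mult_sum_right)
  then show ?thesis by (simp add: sum_strings)
qed

text \<open>The gauge orbit of a pure state contains a vector \<open>D \<psi>\<^sub>1\<close> with \<open>D\<close> in the algebra and
  \<open>\<psi>\<^sub>1\<close> fixed, and only the blocks of \<open>Y\<close> between strings of equal type survive. Averaging the
  coefficients over the type makes them nonnegative.\<close>

lemma separate_functionals_exist:
  assumes N: "quantum_channel \<N>" "noiseless_on \<N> \<A>" "covariant_under \<N> (gauge_group \<A>)"
  shows "\<exists>\<nu> :: ('n::finite \<Rightarrow> 'a cmat) \<Rightarrow> ('n \<Rightarrow> 'a) cmat \<Rightarrow> real.
    (\<forall>e\<in>UNIV \<rightarrow> J. linear (\<nu> e) \<and> (\<forall>Y. positive_op Y \<longrightarrow> 0 \<le> \<nu> e Y) \<and> \<nu> e (mat 1) = 1) \<and>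
    (\<forall>Y \<psi>. (\<forall>V\<in>gauge_group \<A>. conjugate_by (tensor_power V) Y = Y) \<longrightarrow>
      Re (trace (Y ** tensor_power (\<N> (ketbra \<psi> \<psi>)))) =
        (\<Sum>e\<in>UNIV \<rightarrow> J. (\<Prod>k\<in>UNIV. (norm (e k *v \<psi>))\<^sup>2) * \<nu> e Y))"
proof -
  \<comment> \<open>One unit vector per block. Their sum is deliberately not normalised: unit weight
    in every block gives each string expectation one in \<open>R\<close>.\<close>
  have "\<exists>b. E *v b = b \<and> norm b = 1" if E: "E \<in> J" for E
  proof -
    obtain v where v: "E *v v \<noteq> 0" using J_projector(3)[OF E] by (auto simp: matrix_eq)
    define b where "b = (1 / norm (E *v v)) *\<^sub>R (E *v v)"
    have "E *v b = b" using J_projector(2)[OF E] by (simp add: b_def mat_vec_scaleR matrix_vector_mul_assoc)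
    moreover have "norm b = 1" using v by (simp add: b_def)
    ultimately show ?thesis by blast
  qed
  then have "\<forall>E\<in>J. \<exists>b. E *v b = b \<and> norm b = 1" ..
  from bchoice[OF this] obtain b where b: "\<And>E. E \<in> J \<Longrightarrow> E *v b E = b E" "\<And>E. E \<in> J \<Longrightarrow> norm (b E) = 1"
    by blast
  define \<psi>\<^sub>1 where "\<psi>\<^sub>1 = (\<Sum>E\<in>J. b E)"
  have E\<psi>: "E *v \<psi>\<^sub>1 = b E" if E: "E \<in> J" for E
  proof -
    have "E *v b F = (if F = E then b E else 0)" if F: "F \<in> J" for F
    proof -
      have "E *v b F = (E ** F) *v b F" using b(1)[OF F] by (simp flip: matrix_vector_mul_assoc)
      then show ?thesis using J_mult[OF E F] b(1)[OF F] by auto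
    qed
    then have "(\<Sum>F\<in>J. E *v b F) = (\<Sum>F\<in>J. if F = E then b E else 0)" by (intro sum.cong) auto
    moreover have "E *v \<psi>\<^sub>1 = (\<Sum>F\<in>J. E *v b F)"
      unfolding \<psi>\<^sub>1_def by (rule mat_vec_sum)
    ultimately show ?thesis using E finite_J by simp
  qed
  define R :: "('n \<Rightarrow> 'a) cmat" where "R = tensor_power (\<N> (ketbra \<psi>\<^sub>1 \<psi>\<^sub>1))"
  have Rpos: "positive_op R"
    unfolding R_def tensor_power_def
    by (intro positive_op_tensor channel_positive[OF N(1)] positive_op_ketbra)
  define S :: "('n \<Rightarrow> 'a cmat) set" where "S = (UNIV \<rightarrow> J)"
  have finS: "finite S" unfolding S_def by (rule finite_strings)
  define cl where "cl e = {f\<in>S. multiplicities f = multiplicities e}" for e :: "'n \<Rightarrow> 'a cmat"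
  \<comment> \<open>The orthogonal projector onto the whole type of \<open>e\<close>.\<close>
  define Q where "Q e = (\<Sum>f\<in>cl e. tensor f)" for e
  \<comment> \<open>Positive because \<open>Q e ** Y ** Q e\<close> and \<open>R\<close> are; the
    divisor is the expectation of \<open>Q e\<close> in \<open>R\<close>, which normalises the value
    at the identity.\<close>
  define \<nu> where "\<nu> e Y = Re (trace (Q e ** Y ** Q e ** R)) / card (cl e)" for e Y
  have cl: "cl e \<subseteq> S" "finite (cl e)" for e using finS by (auto simp: cl_def)
  have Qdag: "dagger (Q e) = Q e" for e
    using cl[of e] by (auto simp: Q_def dagger_sum S_def intro!: sum.cong dagger_string)
  have QQ: "Q e ** Q e = Q e" for e
  proof -
    have "Q e ** Q e = (\<Sum>f\<in>cl e. \<Sum>g\<in>cl e. if g = f then tensor f else 0)"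
      unfolding Q_def mat_mult_sum_left mat_mult_sum_right
      using cl[of e] by (intro sum.cong refl) (auto simp: S_def strings_mult subset_eq)
    then show ?thesis using cl by (simp add: Q_def)
  qed
  have traceR: "trace (tensor f ** R) = 1" if f: "f \<in> S" for f
  proof -
    have "trace (f k ** \<N> (ketbra \<psi>\<^sub>1 \<psi>\<^sub>1)) = 1" for k
    proof -
      have fk: "f k \<in> J" using f by (auto simp: S_def)
      have "trace (f k ** \<N> (ketbra \<psi>\<^sub>1 \<psi>\<^sub>1)) = trace (f k ** ketbra \<psi>\<^sub>1 \<psi>\<^sub>1)"
        by (rule noiseless_on_positive[OF N(1,2) J_in_alg[OF fk] positive_op_ketbra])
      also have "\<dots> = cinner \<psi>\<^sub>1 (f k *v (f k *v \<psi>\<^sub>1))"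
        using J_projector(2)[OF fk] by (simp add: mat_mult_ketbra trace_ketbra matrix_vector_mul_assoc)
      also have "\<dots> = cinner (f k *v \<psi>\<^sub>1) (f k *v \<psi>\<^sub>1)"
        using J_projector(1)[OF fk] by (simp add: cinner_adjoint)
      also have "\<dots> = 1" using b(2)[OF fk] by (simp add: E\<psi>[OF fk] cinner_self)
      finally show ?thesis .
    qed
    then show ?thesis by (simp add: R_def tensor_power_def tensor_mult trace_tensor)
  qed
  have "linear (\<nu> e) \<and> (\<forall>Y. positive_op Y \<longrightarrow> 0 \<le> \<nu> e Y) \<and> \<nu> e (mat 1) = 1" if e: "e \<in> S" for e
  proof (intro conjI allI impI)
    show "linear (\<nu> e)"
      by (simp add: linear_iff \<nu>_def matrix_add_ldistrib mat_mult_add_left mat_mult_scaleR trace_add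
          trace_scaleR add_divide_distrib)
    show "0 \<le> \<nu> e Y" if "positive_op Y" for Y
    proof -
      have "positive_op (Q e ** Y ** Q e)" using positive_op_sandwich[OF that, of "Q e"] by (simp add: Qdag)
      then show ?thesis using trace_mult_positive(1)[OF _ Rpos] by (simp add: \<nu>_def)
    qed
    have "card (cl e) \<noteq> 0" using e cl[of e] by (auto simp: cl_def)
    moreover have "trace (Q e ** R) = of_nat (card (cl e))"
      using cl[of e] traceR by (simp add: Q_def mat_mult_sum_left trace_sum subset_eq)
    ultimately show "\<nu> e (mat 1) = 1" by (simp add: \<nu>_def QQ)
  qed
  moreover have "Re (trace (Y ** tensor_power (\<N> (ketbra \<psi> \<psi>)))) =
        (\<Sum>e\<in>S. (\<Prod>k\<in>UNIV. (norm (e k *v \<psi>))\<^sup>2) * \<nu> e Y)"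
    if Y: "\<forall>V\<in>gauge_group \<A>. conjugate_by (tensor_power V) Y = Y" for Y \<psi>
  proof -
    define w where "w E = complex_of_real (norm (E *v \<psi>))" for E :: "'a cmat"
    define D where "D = blockdiag w"
    define q where "q e = (\<Prod>k\<in>UNIV. (norm (e k *v \<psi>))\<^sup>2)" for e :: "'n \<Rightarrow> 'a cmat"
    define W where "W e = (\<Prod>k\<in>UNIV. w (e k))" for e :: "'n \<Rightarrow> 'a cmat"
    have "norm (E *v \<psi>) = norm (E *v (D *v \<psi>\<^sub>1))" if E: "E \<in> J" for E
    proof -
      have "E *v (D *v \<psi>\<^sub>1) = w E *s b E"
        using E\<psi>[OF E] J_mult_blockdiag[OF E] by (simp add: D_def matrix_vector_mul_assoc cscale_mult_vec)
      also have "\<dots> = norm (E *v \<psi>) *\<^sub>R b E" by (simp add: w_def scaleR_eq_smult)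
      finally show ?thesis using b(2)[OF E] by simp
    qed
    from gauge_transitive[OF this] obtain V where V: "V \<in> gauge_group \<A>" "V *v \<psi> = D *v \<psi>\<^sub>1" by blast
    have "conjugate_by V (\<N> (ketbra \<psi> \<psi>)) = \<N> (conjugate_by V (ketbra \<psi> \<psi>))"
      using N(3) V(1) by (simp add: covariant_under_def)
    also have "\<dots> = \<N> (conjugate_by D (ketbra \<psi>\<^sub>1 \<psi>\<^sub>1))" using V(2) by (simp add: conjugate_by_ketbra)
    also have "\<dots> = conjugate_by D (\<N> (ketbra \<psi>\<^sub>1 \<psi>\<^sub>1))"
      unfolding D_def by (rule channel_blockdiag[OF N positive_op_ketbra])
    finally have conj: "conjugate_by V (\<N> (ketbra \<psi> \<psi>)) = conjugate_by D (\<N> (ketbra \<psi>\<^sub>1 \<psi>\<^sub>1))" .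
    have uV: "unitary (tensor_power V :: ('n \<Rightarrow> 'a) cmat)"
      using V(1) by (intro unitary_tensor_power) (simp add: gauge_group_def)
    have cnj_w: "(\<lambda>E. cnj (w E)) = w" by (simp add: fun_eq_iff w_def)
    have Ddag: "dagger D = D"
      by (simp add: D_def dagger_blockdiag cnj_w)
    define DR where "DR = tensor_power D ** R ** tensor_power D"
    have "trace (Y ** tensor_power (\<N> (ketbra \<psi> \<psi>))) =
        trace (conjugate_by (tensor_power V) Y ** conjugate_by (tensor_power V) (tensor_power (\<N> (ketbra \<psi> \<psi>))))"
      by (rule trace_conjugate_conjugate[OF uV, symmetric])
    also have "conjugate_by (tensor_power V) (tensor_power (\<N> (ketbra \<psi> \<psi>))) = DR"
      unfolding tensor_power_conjugate[symmetric] conj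
      by (simp only: conjugate_by_def DR_def R_def tensor_power_mult Ddag)
    also have "conjugate_by (tensor_power V) Y = Y" using Y V(1) by blast
    also have "trace (Y ** DR) = (\<Sum>e\<in>S. \<Sum>f\<in>S. trace (tensor f ** Y ** tensor e ** DR))"
      unfolding S_def by (rule trace_strings_expand)
    \<comment> \<open>Pairs of different type drop out by gauge invariance. For equal types the two
      factors \<open>D\<close> contribute \<open>W e\<close> and \<open>W f\<close>, which agree and
      multiply to \<open>q e\<close>.\<close>
    also have "\<dots> = (\<Sum>e\<in>S. \<Sum>f\<in>S. if f \<in> cl e then complex_of_real (q e) * trace (tensor f ** Y ** tensor e ** R) else 0)"
    proof (intro sum.cong refl)
      fix e f assume e: "e \<in> S" and f: "f \<in> S"
      show "trace (tensor f ** Y ** tensor e ** DR) =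
        (if f \<in> cl e then complex_of_real (q e) * trace (tensor f ** Y ** tensor e ** R) else 0)"
      proof (cases "f \<in> cl e")
        case False
        then have "tensor f ** Y ** tensor e = 0"
          using e f Y by (intro invariant_between_types) (auto simp: cl_def S_def)
        then show ?thesis using False by simp
      next
        case True
        have eJ: "e \<in> UNIV \<rightarrow> J" and fJ: "f \<in> UNIV \<rightarrow> J" using e f by (auto simp: S_def)
        have ff: "tensor f ** tensor f = tensor f" using strings_mult[OF fJ fJ] by simp
        have "W f = W e" unfolding W_def
          by (rule prod_eq_if_multiplicities_eq[of _ _ J]) (use True eJ fJ finite_J in \<open>auto simp: cl_def\<close>)
        moreover have "W e * W e = complex_of_real (q e)"
          by (simp add: W_def q_def w_def power2_eq_square flip: prod.distrib)
        ultimately have WW: "W e * W f = complex_of_real (q e)" by simp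
        \<comment> \<open>The projector \<open>tensor f\<close> is doubled so that one copy can
          travel around the trace and absorb the right-hand factor
          \<open>tensor_power D\<close>.\<close>
        have "tensor f ** Y ** tensor e ** DR = (tensor f ** tensor f) ** Y ** (tensor e ** tensor_power D) ** R ** tensor_power D"
          by (simp only: DR_def matrix_mul_assoc ff)
        then have "trace (tensor f ** Y ** tensor e ** DR) =
            trace (tensor f ** (tensor f ** Y ** (tensor e ** tensor_power D) ** R ** tensor_power D))"
          by (simp only: matrix_mul_assoc)
        also have "\<dots> = trace (tensor f ** Y ** (tensor e ** tensor_power D) ** R ** (tensor_power D ** tensor f))"
          by (subst trace_mul_sym) (simp only: matrix_mul_assoc)
        also have "\<dots> = W e * W f * trace (tensor f ** Y ** tensor e ** R ** tensor f)"
          using eJ fJ by (simp add: D_def string_mult_blockdiag trace_cscale W_def mult.commute)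
        also have "trace (tensor f ** Y ** tensor e ** R ** tensor f) = trace (tensor f ** tensor f ** Y ** tensor e ** R)"
          by (subst trace_mul_sym) (simp only: matrix_mul_assoc)
        finally show ?thesis using True WW ff by simp
      qed
    qed
    also have "\<dots> = (\<Sum>e\<in>S. complex_of_real (q e) * (\<Sum>f\<in>cl e. trace (tensor f ** Y ** tensor e ** R)))"
    proof (intro sum.cong refl)
      fix e
      have "S \<inter> {f. f \<in> cl e} = cl e" using cl by blast
      then show "(\<Sum>f\<in>S. if f \<in> cl e then complex_of_real (q e) * trace (tensor f ** Y ** tensor e ** R) else 0)
        = complex_of_real (q e) * (\<Sum>f\<in>cl e. trace (tensor f ** Y ** tensor e ** R))"
        using finS by (simp add: sum.If_cases sum_distrib_left)
    qed
    finally have "Re (trace (Y ** tensor_power (\<N> (ketbra \<psi> \<psi>)))) =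
        (\<Sum>e\<in>S. q e * Re (\<Sum>f\<in>cl e. trace (tensor f ** Y ** tensor e ** R)))"
      by simp
    \<comment> \<open>A single term has the full type on the left of \<open>Y\<close> but one string
      on the right, so it has no evident sign. Averaging over the type completes the right side to
      \<open>Q e\<close>.\<close>
    also have "\<dots> = (\<Sum>e\<in>S. q e * ((\<Sum>g\<in>{g\<in>S. multiplicities g = multiplicities e}.
         Re (\<Sum>f\<in>cl g. trace (tensor f ** Y ** tensor g ** R))) / card {g\<in>S. multiplicities g = multiplicities e}))"
    proof (rule sum_class_average[OF finS])
      show "q e = q f" if "e \<in> S" "f \<in> S" "multiplicities e = multiplicities f" for e f
        unfolding q_def
        by (rule prod_eq_if_multiplicities_eq[of e f J]) (use that finite_J in \<open>auto simp: S_def\<close>)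
    qed
    also have "\<dots> = (\<Sum>e\<in>S. q e * \<nu> e Y)"
    proof (intro sum.cong refl)
      fix e assume "e \<in> S"
      have "(\<Sum>g\<in>cl e. \<Sum>f\<in>cl g. trace (tensor f ** Y ** tensor g ** R)) =
          (\<Sum>g\<in>cl e. \<Sum>f\<in>cl e. trace (tensor f ** Y ** tensor g ** R))"
        by (intro sum.cong refl) (auto simp: cl_def)
      also have "\<dots> = trace (Q e ** Y ** Q e ** R)"
        by (simp add: Q_def trace_sum mat_mult_sum_left mat_mult_sum_right)
      finally show "q e * ((\<Sum>g\<in>{g\<in>S. multiplicities g = multiplicities e}.
         Re (\<Sum>f\<in>cl g. trace (tensor f ** Y ** tensor g ** R))) / card {g\<in>S. multiplicities g = multiplicities e})
         = q e * \<nu> e Y"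
        by (simp add: \<nu>_def flip: cl_def Re_sum)
    qed
    finally show ?thesis by (simp add: q_def)
  qed
  ultimately show ?thesis unfolding S_def by blast
qed

end

section \<open>Integration against a prior\<close>

text \<open>An interval in this sense is the intersection of the cylinders over its coordinate
  projections, which are real intervals.\<close>

lemma is_interval_borel:
  fixes \<Delta> :: "'a::euclidean_space set"
  assumes "is_interval \<Delta>"
  shows "\<Delta> \<in> sets borel"
proof -
  have "(\<lambda>x. x \<bullet> i) ` \<Delta> \<in> sets borel" for i
  proof -
    have "connected ((\<lambda>x. x \<bullet> i) ` \<Delta>)"
      using assms by (intro connected_continuous_image continuous_intros is_interval_connected)
    then show ?thesis
      by (intro real_interval_borel_measurable) (simp add: is_interval_connected_1)
  qed
  then have "(\<lambda>x. x \<bullet> i) -` ((\<lambda>x. x \<bullet> i) ` \<Delta>) \<in> sets borel" for i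
    using measurable_sets[of "\<lambda>x. x \<bullet> i" borel borel] by simp
  then have "(\<Inter>i\<in>Basis. (\<lambda>x. x \<bullet> i) -` ((\<lambda>x. x \<bullet> i) ` \<Delta>)) \<in> sets borel"
    by (intro sets.finite_INT) auto
  moreover have "(\<Inter>i\<in>Basis. (\<lambda>x. x \<bullet> i) -` ((\<lambda>x. x \<bullet> i) ` \<Delta>)) = \<Delta>"
    by (auto intro!: mem_box_componentwiseI[OF assms])
  ultimately show ?thesis by simp
qed

text \<open>A linear functional in finite dimension is continuous, so it carries the operator sums
  of \<open>M\<close> to convergent real sums.\<close>

lemma povm_probability_measure:
  assumes M: "povm \<Omega> M" and l: "linear l" "\<And>Y. positive_op Y \<Longrightarrow> 0 \<le> l Y" "l (mat 1) = (1::real)"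
  shows "\<exists>\<nu>. prob_space \<nu> \<and> sets \<nu> = sets \<Omega> \<and> (\<forall>B\<in>sets \<Omega>. measure \<nu> B = l (M B))"
proof -
  define \<nu> where "\<nu> = measure_of (space \<Omega>) (sets \<Omega>) (\<lambda>B. ennreal (l (M B)))"
  have nn: "0 \<le> l (M B)" if "B \<in> sets \<Omega>" for B using M that l(2) by (simp add: povm_def)
  have sum: "(\<lambda>i. l (M (F i))) sums l (M (\<Union>i. F i))"
    if "range F \<subseteq> sets \<Omega>" "disjoint_family F" for F :: "nat \<Rightarrow> _"
    using M that bounded_linear.sums[OF linear_conv_bounded_linear[THEN iffD1, OF l(1)]]
    by (auto simp: povm_def)
  \<comment> \<open>\<open>povm\<close> does not state the value at the empty set; additivity for a
    constant sequence of empty sets forces it to vanish under \<open>l\<close>.\<close>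
  have "(\<lambda>i::nat. l (M {})) sums l (M (\<Union>i::nat. {}))"
    by (rule sum) (auto simp: disjoint_family_on_def)
  then have empty: "l (M {}) = 0" using sums_summable summable_const_iff by blast
  have em: "emeasure \<nu> B = ennreal (l (M B))" if "B \<in> sets \<Omega>" for B
    unfolding \<nu>_def
  proof (rule emeasure_measure_of_sigma)
    show "sigma_algebra (space \<Omega>) (sets \<Omega>)" by (rule sets.sigma_algebra_axioms)
    show "positive (sets \<Omega>) (\<lambda>B. ennreal (l (M B)))" by (simp add: positive_def empty)
    show "countably_additive (sets \<Omega>) (\<lambda>B. ennreal (l (M B)))"
    proof (rule countably_additiveI)
      fix F :: "nat \<Rightarrow> _" assume F: "range F \<subseteq> sets \<Omega>" "disjoint_family F"
      show "(\<Sum>i. ennreal (l (M (F i)))) = ennreal (l (M (\<Union>i. F i)))"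
        by (rule suminf_ennreal_eq[OF _ sum[OF F]]) (use F nn in auto)
    qed
  qed (fact that)
  have sets: "sets \<nu> = sets \<Omega>" and space: "space \<nu> = space \<Omega>"
    by (simp_all add: \<nu>_def)
  have "prob_space \<nu>"
    by (rule prob_spaceI) (use M l(3) in \<open>simp add: space em povm_def\<close>)
  moreover have "measure \<nu> B = l (M B)" if "B \<in> sets \<Omega>" for B
    using em[OF that] nn[OF that] by (simp add: measure_def)
  ultimately show ?thesis using sets by blast
qed

lemma space_reference: "reference_measure \<mu> \<Longrightarrow> space \<mu> = density_ops"
  using sets_eq_imp_space_eq[of \<mu> "restrict_space borel density_ops"]
  by (simp add: reference_measure_def space_restrict_space)

lemma continuous_measurable_reference:
  fixes f :: "'d::finite cmat \<Rightarrow> 'b::topological_space"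
  assumes "reference_measure \<mu>" "continuous_on UNIV f"
  shows "f \<in> borel_measurable \<mu>"
proof -
  have "f \<in> borel_measurable (restrict_space borel density_ops)"
    using assms(2) by (intro measurable_restrict_space1 borel_measurable_continuous_onI)
  moreover have "sets \<mu> = sets (restrict_space borel density_ops)"
    using assms(1) by (simp add: reference_measure_def)
  ultimately show ?thesis by (simp cong: measurable_cong_sets)
qed

lemma linear_measurable_reference:
  fixes f :: "'d::finite cmat \<Rightarrow> 'd cmat"
  assumes \<mu>: "reference_measure \<mu>" and f: "linear f" "\<And>\<rho>. \<rho> \<in> density_ops \<Longrightarrow> f \<rho> \<in> density_ops"
  shows "f \<in> measurable \<mu> \<mu>"
proof -
  have "continuous_on UNIV f"
    using f(1) by (intro linear_continuous_on) (simp add: linear_conv_bounded_linear)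
  then have "f \<in> borel_measurable \<mu>" by (rule continuous_measurable_reference[OF \<mu>])
  then have "f \<in> measurable \<mu> (restrict_space borel density_ops)"
    using f(2) by (intro measurable_restrict_space2) (auto simp: space_reference[OF \<mu>])
  then show ?thesis
    using \<mu> by (simp add: reference_measure_def cong: measurable_cong_sets)
qed

lemma continuous_on_tensor_power: "continuous_on UNIV (tensor_power :: 'd::finite cmat \<Rightarrow> ('n::finite \<Rightarrow> 'd) cmat)"
  unfolding tensor_power_def tensor_def by (intro continuous_intros)

lemma linear_Re_trace:
  fixes \<Phi> :: "'a::finite cmat \<Rightarrow> 'a cmat"
  shows "linear \<Phi> \<Longrightarrow> linear (\<lambda>X. Re (trace (A ** \<Phi> X)))"
  by (simp add: linear_iff matrix_add_ldistrib mat_mult_scaleR trace_add trace_scaleR)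

lemma continuous_on_outcome:
  fixes \<Phi> :: "('n::finite \<Rightarrow> 'd::finite) cmat \<Rightarrow> ('n \<Rightarrow> 'd) cmat"
  assumes "linear \<Phi>"
  shows "continuous_on UNIV (\<lambda>\<rho>. Re (trace (A ** \<Phi> (tensor_power \<rho>))))"
proof -
  have "continuous_on UNIV (\<lambda>X. Re (trace (A ** \<Phi> X)))"
    using linear_Re_trace[OF assms] by (intro linear_continuous_on) (simp add: linear_conv_bounded_linear)
  then show ?thesis
    using continuous_on_compose2[OF _ continuous_on_tensor_power] by blast
qed

section \<open>Weights of parameter events\<close>

locale prior =
  fixes \<mu> :: "'d::finite cmat measure" and p :: "'d cmat \<Rightarrow> real"
    and s :: "'d cmat \<Rightarrow> real^'l::finite"
  assumes reference: "reference_measure \<mu>" and density: "prior_density \<mu> p"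
    and param: "parameters \<mu> p s"
begin

lemma p_measurable [measurable]: "p \<in> borel_measurable \<mu>"
  using density by (simp add: prior_density_def)

lemma p_nonneg: "\<rho> \<in> space \<mu> \<Longrightarrow> 0 \<le> p \<rho>"
  using density by (simp add: prior_density_def space_reference[OF reference])

lemma p_integrable: "integrable \<mu> p"
  using density p_nonneg by (intro integrableI_nonneg) (auto simp: prior_density_def intro: AE_I2)

lemma param_event_measurable:
  assumes "is_interval \<Delta>"
  shows "param_event p s \<Delta> \<in> sets \<mu>"
proof -
  have supp: "supp p \<in> sets \<mu>"
  proof -
    have "{\<rho> \<in> space \<mu>. p \<rho> \<noteq> 0} \<in> sets \<mu>" by measurable
    then show ?thesis by (simp add: supp_def space_reference[OF reference])
  qed
  have "s -` \<Delta> \<inter> space (restrict_space \<mu> (supp p)) \<in> sets (restrict_space \<mu> (supp p))"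
    using param is_interval_borel[OF assms] unfolding parameters_def by (rule measurable_sets)
  then have "s -` \<Delta> \<inter> (supp p \<inter> space \<mu>) \<in> sets \<mu>"
    using supp by (simp add: sets_restrict_space_iff space_restrict_space Int_commute)
  moreover have "s -` \<Delta> \<inter> (supp p \<inter> space \<mu>) = param_event p s \<Delta>"
    by (auto simp: param_event_def supp_def space_reference[OF reference])
  ultimately show ?thesis by simp
qed

lemma integrable_outcome:
  fixes X :: "('n::finite \<Rightarrow> 'd) cmat"
  assumes "is_interval \<Delta>"
  shows "set_integrable \<mu> (param_event p s \<Delta>) (\<lambda>\<rho>. p \<rho> * Re (trace (X ** tensor_power \<rho>)))"
proof -
  define C where "C = (\<Sum>f\<in>UNIV. \<Sum>g\<in>UNIV. cmod (X $ f $ g))"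
  have bound: "\<bar>Re (trace (X ** tensor_power \<rho>))\<bar> \<le> C" if "\<rho> \<in> density_ops" for \<rho>
  proof -
    have "\<bar>Re (trace (X ** tensor_power \<rho>))\<bar> \<le> cmod (trace (X ** tensor_power \<rho>))"
      by (rule abs_Re_le_cmod)
    also have "\<dots> \<le> (\<Sum>f\<in>UNIV. \<Sum>g\<in>UNIV. cmod (X $ f $ g * tensor_power \<rho> $ g $ f))"
      unfolding trace_def mat_mult_nth by (rule order_trans[OF norm_sum sum_mono]) (rule norm_sum)
    also have "\<dots> \<le> C"
      unfolding C_def norm_mult
      by (intro sum_mono mult_left_le density_ops_norm density_tensor_power that norm_ge_zero)
    finally show ?thesis .
  qed
  have [measurable]: "(\<lambda>\<rho>. Re (trace (X ** tensor_power \<rho>))) \<in> borel_measurable \<mu>"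
    by (rule continuous_measurable_reference[OF reference])
      (rule continuous_on_outcome[of "\<lambda>X. X", OF linear_ident])
  have "integrable \<mu> (\<lambda>\<rho>. p \<rho> * Re (trace (X ** tensor_power \<rho>)))"
  proof (rule Bochner_Integration.integrable_bound)
    show "integrable \<mu> (\<lambda>\<rho>. C * p \<rho>)" using p_integrable by simp
    have C: "0 \<le> C" unfolding C_def by (intro sum_nonneg) auto
    have "\<bar>p \<rho> * Re (trace (X ** tensor_power \<rho>))\<bar> \<le> \<bar>C * p \<rho>\<bar>" if "\<rho> \<in> space \<mu>" for \<rho>
    proof -
      have "\<bar>Re (trace (X ** tensor_power \<rho>))\<bar> * \<bar>p \<rho>\<bar> \<le> C * \<bar>p \<rho>\<bar>"
        using bound that by (intro mult_right_mono) (auto simp: space_reference[OF reference])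
      then show ?thesis using C by (simp add: abs_mult mult.commute)
    qed
    then show "AE \<rho> in \<mu>. norm (p \<rho> * Re (trace (X ** tensor_power \<rho>))) \<le> norm (C * p \<rho>)"
      by (intro AE_I2) simp
  qed measurable
  then show ?thesis
    unfolding set_integrable_def by (intro integrable_mult_indicator param_event_measurable assms)
qed

text \<open>The numerator of \<open>cond_prob\<close> as a functional of the Heisenberg-evolved
  effect \<open>X\<close>. Its level sets are closed and convex, so they are respected by averaging
  over conjugates.\<close>

definition outcome_weight :: "(real^'l) set \<Rightarrow> ('n::finite \<Rightarrow> 'd) cmat \<Rightarrow> real" where
  "outcome_weight \<Delta> X = set_lebesgue_integral \<mu> (param_event p s \<Delta>)
     (\<lambda>\<rho>. p \<rho> * Re (trace (X ** tensor_power \<rho>)))"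

lemma linear_outcome_weight:
  assumes "is_interval \<Delta>"
  shows "linear (outcome_weight \<Delta> :: ('n::finite \<Rightarrow> 'd) cmat \<Rightarrow> real)"
proof (rule linearI)
  note int = integrable_outcome[OF assms]
  show "outcome_weight \<Delta> (X + Y) = outcome_weight \<Delta> X + outcome_weight \<Delta> Y" for X Y :: "('n \<Rightarrow> 'd) cmat"
    using int[of X] int[of Y]
    by (simp add: outcome_weight_def mat_mult_add_left trace_add distrib_left set_integral_add)
  show "outcome_weight \<Delta> (c *\<^sub>R X) = c *\<^sub>R outcome_weight \<Delta> X" for c and X :: "('n \<Rightarrow> 'd) cmat"
    by (simp add: outcome_weight_def mat_mult_scaleR trace_scaleR mult.left_commute)
qed

text \<open>Change of variables by \<open>dagger V\<close>, under which the reference measure, the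
  density and the event are all invariant.\<close>

lemma outcome_weight_invariant:
  fixes X :: "('n::finite \<Rightarrow> 'd) cmat"
  assumes \<Delta>: "is_interval \<Delta>" and V: "unitary V"
    and sym: "prior_symmetry {dagger V} p" "parameter_symmetry {dagger V} p s"
  shows "outcome_weight \<Delta> (conjugate_by (tensor_power V) X) = outcome_weight \<Delta> X"
proof -
  define W where "W = dagger V"
  define F where "F \<rho> = indicator (param_event p s \<Delta>) \<rho> *\<^sub>R (p \<rho> * Re (trace (X ** tensor_power \<rho>)))" for \<rho>
  have W: "unitary W" using V by (simp add: W_def unitary_dagger)
  have dens: "conjugate_by W \<rho> \<in> density_ops" if "\<rho> \<in> density_ops" for \<rho>
    using W that by (rule density_conjugate_by)
  have meas: "conjugate_by W \<in> measurable \<mu> \<mu>"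
    by (rule linear_measurable_reference[OF reference linear_conjugate_by dens])
  have "F \<in> borel_measurable \<mu>"
    using borel_measurable_integrable[OF integrable_outcome[OF \<Delta>, of X, unfolded set_integrable_def]]
    by (simp add: F_def[abs_def])
  then have "(\<integral>\<rho>. F \<rho> \<partial>distr \<mu> \<mu> (conjugate_by W)) = (\<integral>\<rho>. F (conjugate_by W \<rho>) \<partial>\<mu>)"
    using meas by (rule integral_distr[rotated])
  moreover have "distr \<mu> \<mu> (conjugate_by W) = \<mu>"
    using reference W by (simp add: reference_measure_def)
  ultimately have "outcome_weight \<Delta> X = (\<integral>\<rho>. F (conjugate_by W \<rho>) \<partial>\<mu>)"
    by (simp add: outcome_weight_def set_lebesgue_integral_def F_def)
  also have "\<dots> = outcome_weight \<Delta> (conjugate_by (tensor_power V) X)"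
    unfolding outcome_weight_def set_lebesgue_integral_def
  proof (rule Bochner_Integration.integral_cong)
    fix \<rho> assume "\<rho> \<in> space \<mu>"
    then have \<rho>: "\<rho> \<in> density_ops" by (simp add: space_reference[OF reference])
    have p: "p (conjugate_by W \<rho>) = p \<rho>" using sym(1) \<rho> by (simp add: prior_symmetry_def W_def)
    have "conjugate_by W \<rho> \<in> param_event p s \<Delta> \<longleftrightarrow> \<rho> \<in> param_event p s \<Delta>"
      using sym(2) \<rho> dens[OF \<rho>] p by (auto simp: param_event_def supp_def parameter_symmetry_def W_def)
    moreover have "trace (conjugate_by (tensor_power V) X ** tensor_power \<rho>) = trace (X ** tensor_power (conjugate_by W \<rho>))"
    proof -
      have "conjugate_by V (conjugate_by W \<rho>) = \<rho>"
        using V by (simp add: conjugate_by_mult W_def unitary_def) (simp add: conjugate_by_def)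
      then have "trace (conjugate_by (tensor_power V) X ** tensor_power \<rho>) =
        trace (conjugate_by (tensor_power V) X ** conjugate_by (tensor_power V) (tensor_power (conjugate_by W \<rho>)))"
        by (simp flip: tensor_power_conjugate)
      then show ?thesis by (simp add: trace_conjugate_conjugate unitary_tensor_power[OF V])
    qed
    ultimately show "F (conjugate_by W \<rho>) = indicator (param_event p s \<Delta>) \<rho> *\<^sub>R
        (p \<rho> * Re (trace (conjugate_by (tensor_power V) X ** tensor_power \<rho>)))"
      by (simp add: F_def p indicator_def)
  qed simp
  finally show ?thesis by simp
qed

lemma weight_eq_if_AE_law:
  assumes \<Delta>: "is_interval \<Delta>" and u: "continuous_on UNIV u" "continuous_on UNIV v"
    and ae: "AE \<rho> in law \<mu> p. u \<rho> = (v \<rho> :: real)"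
  shows "set_lebesgue_integral \<mu> (param_event p s \<Delta>) (\<lambda>\<rho>. p \<rho> * u \<rho>) =
    set_lebesgue_integral \<mu> (param_event p s \<Delta>) (\<lambda>\<rho>. p \<rho> * v \<rho>)"
proof (rule set_lebesgue_integral_cong_AE)
  show "param_event p s \<Delta> \<in> sets \<mu>" by (rule param_event_measurable[OF \<Delta>])
  have [measurable]: "u \<in> borel_measurable \<mu>" "v \<in> borel_measurable \<mu>"
    using u continuous_measurable_reference[OF reference] by blast+
  show "(\<lambda>\<rho>. p \<rho> * u \<rho>) \<in> borel_measurable \<mu>" "(\<lambda>\<rho>. p \<rho> * v \<rho>) \<in> borel_measurable \<mu>"
    by measurable
  have "AE \<rho> in \<mu>. 0 < ennreal (p \<rho>) \<longrightarrow> u \<rho> = v \<rho>"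
    using ae unfolding law_def by (subst (asm) AE_density) measurable
  then show "AE \<rho>\<in>param_event p s \<Delta> in \<mu>. p \<rho> * u \<rho> = p \<rho> * v \<rho>"
  proof (rule AE_mp, intro AE_I2 impI)
    fix \<rho> assume "\<rho> \<in> space \<mu>" "0 < ennreal (p \<rho>) \<longrightarrow> u \<rho> = v \<rho>"
    then show "p \<rho> * u \<rho> = p \<rho> * v \<rho>" using p_nonneg[of \<rho>] by (cases "p \<rho> = 0") auto
  qed
qed

text \<open>Under the law of \<open>p\<close> a state is almost surely the image under
  \<open>\<N>\<close> of a pure state, so a comparison on such images is enough.\<close>

lemma AE_law_if_pure:
  assumes p': "prior_density \<mu> p'" "supp p' \<subseteq> pure_states" and dist: "gauge_distortion \<mu> \<A> p p' \<N>"
    and P: "continuous_on UNIV u" "continuous_on UNIV v"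
    and eq: "\<And>\<psi>. norm \<psi> = 1 \<Longrightarrow> u (\<N> (ketbra \<psi> \<psi>)) = (v (\<N> (ketbra \<psi> \<psi>)) :: real)"
  shows "AE \<rho> in law \<mu> p. u \<rho> = v \<rho>"
proof -
  have N: "quantum_channel \<N>" and law: "law \<mu> p = distr (law \<mu> p') \<mu> \<N>"
    using dist by (auto simp: gauge_distortion_def)
  have "\<N> \<in> measurable \<mu> \<mu>"
    by (rule linear_measurable_reference[OF reference])
      (auto intro: channel_density[OF N] complex_linear_imp_linear[OF channel_complex_linear[OF N]])
  then have "\<N> \<in> measurable (law \<mu> p') \<mu>" by (simp add: law_def)
  moreover have [measurable]: "u \<in> borel_measurable \<mu>" "v \<in> borel_measurable \<mu>"
    using P continuous_measurable_reference[OF reference] by blast+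
  have "{\<rho> \<in> space \<mu>. u \<rho> = v \<rho>} \<in> sets \<mu>" by measurable
  moreover have "AE \<rho> in law \<mu> p'. u (\<N> \<rho>) = v (\<N> \<rho>)"
  proof -
    have [measurable]: "p' \<in> borel_measurable \<mu>" using p'(1) by (simp add: prior_density_def)
    have "AE \<rho> in \<mu>. 0 < ennreal (p' \<rho>) \<longrightarrow> u (\<N> \<rho>) = v (\<N> \<rho>)"
    proof (intro AE_I2 impI)
      fix \<rho> assume "\<rho> \<in> space \<mu>" "0 < ennreal (p' \<rho>)"
      then have "\<rho> \<in> supp p'" by (auto simp: supp_def space_reference[OF reference])
      with p'(2) have "\<rho> \<in> pure_states" by blast
      then obtain \<psi> where "norm \<psi> = 1" "\<rho> = ketbra \<psi> \<psi>" unfolding pure_states_iff by blast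
      then show "u (\<N> \<rho>) = v (\<N> \<rho>)" using eq by simp
    qed
    then show ?thesis unfolding law_def by (subst AE_density) measurable
  qed
  ultimately show ?thesis unfolding law by (subst AE_distr_iff)
qed

end

section \<open>Replacing a measurement by separate measurements\<close>

context generated_algebra
begin

text \<open>The functionals \<open>l e\<close> do not depend on the event, so both the new operators
  and the classical probabilities inherit countable additivity from \<open>M\<close>.\<close>

lemma separate_measurement_povm:
  assumes M: "povm \<Omega> M"
    and l: "\<And>e. e \<in> UNIV \<rightarrow> J \<Longrightarrow> linear (l e)" "\<And>e Y. e \<in> UNIV \<rightarrow> J \<Longrightarrow> positive_op Y \<Longrightarrow> 0 \<le> l e Y"
      "\<And>e. e \<in> UNIV \<rightarrow> J \<Longrightarrow> l e (mat 1) = (1::real)"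
  defines "M' \<equiv> \<lambda>B. \<Sum>e\<in>(UNIV :: 'n::finite set) \<rightarrow> J. l e (M B) *\<^sub>R tensor e"
  shows "povm \<Omega> M'" "realized_by_separate_measurement \<Omega> As M'"
proof -
  have pos: "positive_op (tensor e)" if "e \<in> UNIV \<rightarrow> J" for e :: "'n \<Rightarrow> 'a cmat"
  proof (rule positive_op_tensor)
    fix k
    have "e k \<in> J" using that by auto
    then show "positive_op (e k)"
      using positive_op_dagger_mult[of "e k"] J_projector[of "e k"] by simp
  qed
  show "povm \<Omega> M'"
    unfolding povm_def
  proof (intro conjI ballI allI impI)
    fix B assume "B \<in> sets \<Omega>"
    then have "positive_op (M B)" using M by (simp add: povm_def)
    then show "positive_op (M' B)"
      unfolding M'_def by (intro positive_op_sum positive_op_scaleR pos l)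
  next
    have "M (space \<Omega>) = mat 1" using M by (simp add: povm_def)
    then show "M' (space \<Omega>) = mat 1"
      unfolding M'_def by (simp add: l(3) sum_strings)
  next
    fix F :: "nat \<Rightarrow> _" assume F: "range F \<subseteq> sets \<Omega>" "disjoint_family F"
    then have "(\<lambda>i. M (F i)) sums M (\<Union>i. F i)" using M by (simp add: povm_def)
    then show "(\<lambda>i. M' (F i)) sums M' (\<Union>i. F i)"
      unfolding M'_def
      by (intro sums_sum sums_scaleR_left bounded_linear.sums[OF linear_conv_bounded_linear[THEN iffD1, OF l(1)]])
  qed
  have "\<forall>e\<in>UNIV \<rightarrow> J. \<exists>\<nu>. prob_space \<nu> \<and> sets \<nu> = sets \<Omega> \<and> (\<forall>B\<in>sets \<Omega>. measure \<nu> B = l e (M B))"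
    using povm_probability_measure[OF M l(1) l(2) l(3)] by blast
  from bchoice[OF this] obtain \<nu> where
    "\<forall>e\<in>UNIV \<rightarrow> J. prob_space (\<nu> e) \<and> sets (\<nu> e) = sets \<Omega> \<and> (\<forall>B\<in>sets \<Omega>. measure (\<nu> e) B = l e (M B))" ..
  then show "realized_by_separate_measurement \<Omega> As M'"
    unfolding realized_by_separate_measurement_def M'_def by (intro exI[of _ \<nu>]) auto
qed

text \<open>Noiselessness enters twice: \<open>\<E>\<close> is invisible to product projectors, and
  then \<open>\<N>\<close> is invisible to each single factor.\<close>

lemma trace_string_noiseless:
  fixes e :: "'n::finite \<Rightarrow> 'a cmat"
  assumes \<E>: "noiseless_on \<E> (tensor_power_algebra \<A>)"
    and N: "quantum_channel \<N>" "noiseless_on \<N> \<A>" and e: "e \<in> UNIV \<rightarrow> J"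
    and \<psi>: "norm \<psi> = 1"
  shows "trace (tensor e ** \<E> (tensor_power (\<N> (ketbra \<psi> \<psi>)))) =
    complex_of_real (\<Prod>k\<in>UNIV. (norm (e k *v \<psi>))\<^sup>2)"
proof -
  define \<rho> where "\<rho> = \<N> (ketbra \<psi> \<psi>)"
  have "ketbra \<psi> \<psi> \<in> density_ops"
    using \<psi> by (simp add: density_ops_def positive_op_ketbra trace_ketbra cinner_self)
  then have "\<rho> \<in> density_ops" unfolding \<rho>_def by (rule channel_density[OF N(1)])
  then have "tensor_power \<rho> \<in> (density_ops :: ('n \<Rightarrow> 'a) cmat set)" by (rule density_tensor_power)
  moreover have "tensor e \<in> tensor_power_algebra \<A>"
    unfolding tensor_power_algebra_def using e J_in_alg by (intro hull_inc) auto
  ultimately have "trace (tensor e ** \<E> (tensor_power \<rho>)) = trace (tensor e ** tensor_power \<rho>)"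
    using \<E> by (simp add: noiseless_on_def)
  also have "\<dots> = (\<Prod>k\<in>UNIV. trace (e k ** \<rho>))"
    by (simp add: tensor_power_def tensor_mult trace_tensor)
  also have "\<dots> = (\<Prod>k\<in>UNIV. complex_of_real ((norm (e k *v \<psi>))\<^sup>2))"
  proof (intro prod.cong refl)
    fix k
    have ek: "e k \<in> J" using e by auto
    have "trace (e k ** \<rho>) = trace (e k ** ketbra \<psi> \<psi>)"
      unfolding \<rho>_def by (rule noiseless_on_positive[OF N J_in_alg[OF ek] positive_op_ketbra])
    also have "\<dots> = cinner \<psi> (e k *v (e k *v \<psi>))"
      using J_projector(2)[OF ek] by (simp add: mat_mult_ketbra trace_ketbra matrix_vector_mul_assoc)
    also have "\<dots> = cinner (e k *v \<psi>) (e k *v \<psi>)"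
      using J_projector(1)[OF ek] by (simp add: cinner_adjoint)
    finally show "trace (e k ** \<rho>) = complex_of_real ((norm (e k *v \<psi>))\<^sup>2)" by (simp only: cinner_self)
  qed
  finally show ?thesis by (simp only: \<rho>_def of_real_prod)
qed

lemma separate_measurement_exists:
  fixes \<mu> :: "'a cmat measure" and s :: "'a cmat \<Rightarrow> real^'l::finite"
    and \<E> :: "('n::finite \<Rightarrow> 'a) cmat \<Rightarrow> ('n \<Rightarrow> 'a) cmat"
  assumes "prior \<mu> p s" and \<E>: "quantum_channel \<E>" "noiseless_on \<E> (tensor_power_algebra \<A>)"
    and sym: "prior_symmetry (gauge_group \<A>) p" "parameter_symmetry (gauge_group \<A>) p s"
    and p': "prior_density \<mu> p'" "supp p' \<subseteq> pure_states" and dist: "gauge_distortion \<mu> \<A> p p' \<N>"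
    and M: "povm \<Omega> M"
  shows "\<exists>M'. povm \<Omega> M' \<and> realized_by_separate_measurement \<Omega> As M' \<and>
    (\<forall>B \<Delta>. is_interval \<Delta> \<longrightarrow> cond_prob \<mu> p s \<E> M' B \<Delta> = cond_prob \<mu> p s \<E> M B \<Delta>)"
proof -
  interpret prior \<mu> p s by fact
  have N: "quantum_channel \<N>" "noiseless_on \<N> \<A>" "covariant_under \<N> (gauge_group \<A>)"
    using dist by (auto simp: gauge_distortion_def)
  have lin\<E>: "linear \<E>" by (rule complex_linear_imp_linear[OF channel_complex_linear[OF \<E>(1)]])
  obtain \<E>' where \<E>': "linear \<E>'" "\<And>X Y. trace (X ** \<E> Y) = trace (\<E>' X ** Y)"
    using trace_adjoint_exists[OF channel_complex_linear[OF \<E>(1)]] by blast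
  obtain T :: "('n \<Rightarrow> 'a) cmat \<Rightarrow> ('n \<Rightarrow> 'a) cmat" where T: "linear T"
    "\<And>X V. V \<in> gauge_group \<A> \<Longrightarrow> conjugate_by (tensor_power V) (T X) = T X"
    "\<And>X. T X \<in> closure (convex hull ((\<lambda>V. conjugate_by (tensor_power V) X) ` gauge_group \<A>))"
    using twirl_exists[of \<A>, where 'n = 'n] by blast
  obtain \<nu> :: "('n \<Rightarrow> 'a cmat) \<Rightarrow> ('n \<Rightarrow> 'a) cmat \<Rightarrow> real" where \<nu>:
    "\<forall>e\<in>UNIV \<rightarrow> J. linear (\<nu> e) \<and> (\<forall>Y. positive_op Y \<longrightarrow> 0 \<le> \<nu> e Y) \<and> \<nu> e (mat 1) = 1"
    "\<forall>Y \<psi>. (\<forall>V\<in>gauge_group \<A>. conjugate_by (tensor_power V) Y = Y) \<longrightarrow>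
      Re (trace (Y ** tensor_power (\<N> (ketbra \<psi> \<psi>)))) =
        (\<Sum>e\<in>UNIV \<rightarrow> J. (\<Prod>k\<in>UNIV. (norm (e k *v \<psi>))\<^sup>2) * \<nu> e Y)"
    using separate_functionals_exist[OF N, where 'n = 'n] by blast
  \<comment> \<open>Any closed convex condition met by all conjugates passes to the average. It is
    used for positivity, for the identity operator and for the level set of an outcome
    weight.\<close>
  have T_in: "T X \<in> S" if "closed S" "convex S" "\<And>V. V \<in> gauge_group \<A> \<Longrightarrow> conjugate_by (tensor_power V) X \<in> S" for X S
  proof -
    have "closure (convex hull ((\<lambda>V. conjugate_by (tensor_power V) X) ` gauge_group \<A>)) \<subseteq> S"
      using that by (intro closure_minimal hull_minimal) auto
    then show ?thesis using T(3) by blast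
  qed
  have Tpos: "positive_op (T X)" if "positive_op X" for X
    using T_in[OF closed_positive_op convex_positive_op] that by (simp add: positive_op_conjugate_by)
  have T1: "T (mat 1) = mat 1"
  proof -
    have "T (mat 1) \<in> {mat 1}"
    proof (rule T_in)
      fix V assume "V \<in> gauge_group \<A>"
      then have "unitary (tensor_power V :: ('n \<Rightarrow> 'a) cmat)"
        by (intro unitary_tensor_power) (simp add: gauge_group_def)
      then show "conjugate_by (tensor_power V) (mat 1) \<in> {mat 1 :: ('n \<Rightarrow> 'a) cmat}"
        by (simp add: conjugate_by_def unitary_def)
    qed auto
    then show ?thesis by simp
  qed
  have \<E>'pos: "positive_op (\<E>' X)" if "positive_op X" for X
  proof -
    \<comment> \<open>Rank-one inputs turn the quadratic form of the adjoint into a trace of two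
      positive operators.\<close>
    have "cinner v (\<E>' X *v v) = trace (X ** \<E> (ketbra v v))" for v
      by (simp add: \<E>'(2) mat_mult_ketbra trace_ketbra)
    then show ?thesis
      using trace_mult_positive[OF that channel_positive[OF \<E>(1) positive_op_ketbra]]
      by (simp add: positive_op_iff)
  qed
  have \<E>'1: "\<E>' (mat 1) = mat 1"
    by (rule trace_mult_eqI) (use \<E>(1) in \<open>simp add: quantum_channel_def flip: \<E>'(2)\<close>)
  define l where "l e X = \<nu> e (T (\<E>' X))" for e X
  have l: "linear (l e)" "positive_op Y \<Longrightarrow> 0 \<le> l e Y" "l e (mat 1) = 1" if "e \<in> UNIV \<rightarrow> J" for e Y
  proof -
    have \<nu>e: "linear (\<nu> e)" "\<And>Y. positive_op Y \<Longrightarrow> 0 \<le> \<nu> e Y" "\<nu> e (mat 1) = 1"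
      using \<nu>(1) that by auto
    show "linear (l e)"
      using linear_compose[OF \<E>'(1) linear_compose[OF T(1) \<nu>e(1)]] by (simp add: l_def[abs_def] o_def)
    show "0 \<le> l e Y" if "positive_op Y" unfolding l_def by (intro \<nu>e Tpos \<E>'pos that)
    show "l e (mat 1) = 1" by (simp add: l_def \<E>'1 T1 \<nu>e)
  qed
  define M' :: "_ \<Rightarrow> ('n \<Rightarrow> 'a) cmat" where "M' = (\<lambda>B. \<Sum>e\<in>UNIV \<rightarrow> J. l e (M B) *\<^sub>R tensor e)"
  have "povm \<Omega> M'" "realized_by_separate_measurement \<Omega> As M'"
    unfolding M'_def by (rule separate_measurement_povm[OF M l]; assumption)+
  moreover have "cond_prob \<mu> p s \<E> M' B \<Delta> = cond_prob \<mu> p s \<E> M B \<Delta>" if \<Delta>: "is_interval \<Delta>" for B \<Delta>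
  proof -
    define X where "X = \<E>' (M B)"
    have "outcome_weight \<Delta> (T X) = outcome_weight \<Delta> X"
    proof -
      have linw: "linear (outcome_weight \<Delta> :: ('n \<Rightarrow> 'a) cmat \<Rightarrow> real)" by (rule linear_outcome_weight[OF \<Delta>])
      have "T X \<in> {Y :: ('n \<Rightarrow> 'a) cmat. outcome_weight \<Delta> Y = outcome_weight \<Delta> X}"
      proof (rule T_in)
        have "continuous_on UNIV (outcome_weight \<Delta> :: ('n \<Rightarrow> 'a) cmat \<Rightarrow> real)"
          using linw by (intro linear_continuous_on) (simp add: linear_conv_bounded_linear)
        then show "closed {Y :: ('n \<Rightarrow> 'a) cmat. outcome_weight \<Delta> Y = outcome_weight \<Delta> X}"
          by (intro closed_Collect_eq continuous_on_const)
        show "convex {Y :: ('n \<Rightarrow> 'a) cmat. outcome_weight \<Delta> Y = outcome_weight \<Delta> X}"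
          by (simp add: convex_def linear_add[OF linw] linear_scale[OF linw] flip: distrib_right)
        fix V assume V: "V \<in> gauge_group \<A>"
        have "dagger V \<in> gauge_group \<A>" by (rule gauge_group_dagger[OF vn V])
        then have "prior_symmetry {dagger V} p" "parameter_symmetry {dagger V} p s"
          using sym by (auto simp: prior_symmetry_def parameter_symmetry_def)
        moreover have "unitary V" using V by (simp add: gauge_group_def)
        ultimately show "conjugate_by (tensor_power V) X \<in> {Y :: ('n \<Rightarrow> 'a) cmat. outcome_weight \<Delta> Y = outcome_weight \<Delta> X}"
          using outcome_weight_invariant[OF \<Delta>] by blast
      qed
      then show ?thesis by simp
    qed
    \<comment> \<open>Here averaged effect and separate measurement meet: on \<open>\<N>\<close> of
      a pure state both expectations are the same combination of products of block weights.\<close>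
    moreover have "outcome_weight \<Delta> (T X) =
      set_lebesgue_integral \<mu> (param_event p s \<Delta>) (\<lambda>\<rho>. p \<rho> * outcome_prob \<E> M' B \<rho>)"
      unfolding outcome_weight_def outcome_prob_def
    proof (rule weight_eq_if_AE_law[OF \<Delta>])
      show c1: "continuous_on UNIV (\<lambda>\<rho>. Re (trace (T X ** tensor_power \<rho>)))"
        by (rule continuous_on_outcome[of "\<lambda>X. X", OF linear_ident])
      show c2: "continuous_on UNIV (\<lambda>\<rho>. Re (trace (M' B ** \<E> (tensor_power \<rho>))))"
        by (rule continuous_on_outcome[OF lin\<E>])
      show "AE \<rho> in law \<mu> p. Re (trace (T X ** tensor_power \<rho>)) = Re (trace (M' B ** \<E> (tensor_power \<rho>)))"
      proof (rule AE_law_if_pure[OF p' dist c1 c2])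
        fix \<psi> :: "complex^'a"
        assume \<psi>: "norm \<psi> = 1"
        define \<rho> where "\<rho> = \<N> (ketbra \<psi> \<psi>)"
        have "Re (trace (M' B ** \<E> (tensor_power \<rho>))) =
            (\<Sum>e\<in>UNIV \<rightarrow> J. l e (M B) * Re (trace (tensor e ** \<E> (tensor_power \<rho>))))"
          by (simp add: M'_def mat_mult_sum_left mat_mult_scaleR trace_sum trace_scaleR)
        also have "\<dots> = (\<Sum>e\<in>UNIV \<rightarrow> J. (\<Prod>k\<in>UNIV. (norm (e k *v \<psi>))\<^sup>2) * \<nu> e (T X))"
          unfolding \<rho>_def
          by (intro sum.cong refl) (simp only: trace_string_noiseless[OF \<E>(2) N(1,2) _ \<psi>] Re_complex_of_real l_def X_def mult.commute)
        also have "\<dots> = Re (trace (T X ** tensor_power \<rho>))"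
          unfolding \<rho>_def by (rule \<nu>(2)[rule_format, OF T(2), symmetric])
        finally show "Re (trace (T X ** tensor_power (\<N> (ketbra \<psi> \<psi>)))) =
            Re (trace (M' B ** \<E> (tensor_power (\<N> (ketbra \<psi> \<psi>)))))"
          by (simp only: \<rho>_def)
      qed
    qed
    moreover have "outcome_weight \<Delta> X =
      set_lebesgue_integral \<mu> (param_event p s \<Delta>) (\<lambda>\<rho>. p \<rho> * outcome_prob \<E> M B \<rho>)"
      by (simp add: outcome_weight_def outcome_prob_def \<E>'(2) X_def)
    ultimately show ?thesis by (simp add: cond_prob_def)
  qed
  ultimately show ?thesis by blast
qed

end

theorem mainTheorem12:
  fixes \<mu> :: "'d::finite cmat measure"
    and p :: "'d cmat \<Rightarrow> real"
    and s :: "'d cmat \<Rightarrow> real^'l::finite"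
    and \<E> :: "('n::finite \<Rightarrow> 'd) cmat \<Rightarrow> ('n \<Rightarrow> 'd) cmat"
    and \<Omega> :: "'w measure"
    and fom :: "('w set \<Rightarrow> ('n \<Rightarrow> 'd) cmat) \<Rightarrow> real"
    and \<A> :: "'d cmat set"
  assumes "reference_measure \<mu>"
    and "prior_density \<mu> p"
    and "parameters \<mu> p s"
    and "quantum_channel \<E>"
    and "functional_of_cond_prob \<mu> p s \<E> \<Omega> fom"
    and "von_neumann_algebra \<A>" and "commutative_algebra \<A>"
    and "prior_symmetry (gauge_group \<A>) p"
    and "parameter_symmetry (gauge_group \<A>) p s"
    and "noiseless_on \<E> (tensor_power_algebra \<A>)"
    and "\<exists>p' \<N>. prior_density \<mu> p' \<and> supp p' \<subseteq> pure_states \<and> gauge_distortion \<mu> \<A> p p' \<N>"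
  shows "(\<exists>As. generating_observables \<A> As) \<and>
    (\<forall>As. generating_observables \<A> As \<longrightarrow>
       ((\<exists>M. maximizing_povm \<Omega> fom M) \<longrightarrow>
          (\<exists>M. maximizing_povm \<Omega> fom M \<and> realized_by_separate_measurement \<Omega> As M)) \<and>
       ((\<exists>M. minimizing_povm \<Omega> fom M) \<longrightarrow>
          (\<exists>M. minimizing_povm \<Omega> fom M \<and> realized_by_separate_measurement \<Omega> As M)))"
proof (intro conjI allI impI)
  show "\<exists>As. generating_observables \<A> As"
    using assms(6) by (rule generating_observables_exist)
next
  fix As assume As: "generating_observables \<A> As"
  interpret generated_algebra \<A> As
    using assms(6,7) As by unfold_locales
  have pr: "prior \<mu> p s" using assms(1-3) by unfold_locales
  \<comment> \<open>Optimality plays no part in the replacement: every POVM has a separate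
    counterpart of equal merit, so maxima and minima are handled alike.\<close>
  have replace: "\<exists>M'. povm \<Omega> M' \<and> realized_by_separate_measurement \<Omega> As M' \<and> fom M' = fom M"
    if M: "povm \<Omega> M" for M
  proof -
    obtain p' \<N> where d: "prior_density \<mu> p'" "supp p' \<subseteq> pure_states" "gauge_distortion \<mu> \<A> p p' \<N>"
      using assms(11) by blast
    obtain M' where "povm \<Omega> M'" "realized_by_separate_measurement \<Omega> As M'"
      "\<And>B \<Delta>. is_interval \<Delta> \<Longrightarrow> cond_prob \<mu> p s \<E> M' B \<Delta> = cond_prob \<mu> p s \<E> M B \<Delta>"
      using separate_measurement_exists[OF pr assms(4,10,8,9) d M] by blast
    moreover from this have "fom M' = fom M"
      using assms(5) M unfolding functional_of_cond_prob_def by blast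
    ultimately show ?thesis by blast
  qed
  show "\<exists>M. maximizing_povm \<Omega> fom M \<and> realized_by_separate_measurement \<Omega> As M"
    if "\<exists>M. maximizing_povm \<Omega> fom M"
    using that replace unfolding maximizing_povm_def by metis
  show "\<exists>M. minimizing_povm \<Omega> fom M \<and> realized_by_separate_measurement \<Omega> As M"
    if "\<exists>M. minimizing_povm \<Omega> fom M"
    using that replace unfolding minimizing_povm_def by metis
qed

end
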